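(* Let $n\geq 1$ be an integer and let $\alpha\in\mathbb{R}$ satisfy $n-2\alpha>0$, $n+2\alpha>0$ and $n+2+4\alpha>0$. Then the inequality $$\int_{\mathbb{R}^n} \frac{|\Delta u|^2}{|x|^{2\alpha}}\,dx \int_{\mathbb{R}^n} |x|^{2\alpha}\,|\nabla u\cdot x|^2\,dx \;\geq\; \Big(\frac{n+4\alpha+2}{2}\Big)^2\Big(\int_{\mathbb{R}^n}|\nabla u|^2\,dx\Big)^2$$ holds for every function $u\in H^2_{\alpha,-2-2\alpha}(\mathbb{R}^n)$. Furthermore, if $1+\alpha>0$, then this inequality is sharp (the constant $\big(\frac{n+4\alpha+2}{2}\big)^2$ cannot be replaced by a larger one), and equality is attained by the function $$U_0(x)=\exp\Big(-\frac{|x|^{2(1+\alpha)}}{2(1+\alpha)}\Big).$$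
   Context: Functions are real-valued. For $\alpha,\beta\in\mathbb{R}$ with $n-2\alpha>0$ and $n-\beta>0$, $H^2_{\alpha,\beta}(\mathbb{R}^n)$ denotes the second order Sobolev space which is the completion of $C_0^\infty(\mathbb{R}^n)$ under the norm $$\|u\|_{H^2_{\alpha,\beta}(\mathbb{R}^n)}=\Big(\int_{\mathbb{R}^n}|\Delta u|^2|x|^{-2\alpha}\,dx+\int_{\mathbb{R}^n}|\nabla u|^2|x|^{-\beta}\,dx\Big)^{1/2},\qquad u\in C_0^\infty(\mathbb{R}^n).$$ Here the space is used with $\beta=-2-2\alpha$. *)

theory Defs
  imports "HOL-Analysis.Analysis"
begin

definition partial :: "'n::finite \<Rightarrow> (real^'n \<Rightarrow> real) \<Rightarrow> real^'n \<Rightarrow> real" where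
  "partial i f x = frechet_derivative f (at x) (axis i 1)"

definition grad :: "(real^'n::finite \<Rightarrow> real) \<Rightarrow> real^'n \<Rightarrow> real^'n" where
  "grad f x = (\<chi> i. partial i f x)"

definition laplacian :: "(real^'n::finite \<Rightarrow> real) \<Rightarrow> real^'n \<Rightarrow> real" where
  "laplacian f x = (\<Sum>i\<in>UNIV. partial i (partial i f) x)"

text \<open>The space \<open>C_0^\<infinity>\<close>. Asking every iterated partial derivative (of any order, in any
  directions) to be totally differentiable everywhere makes all of them continuous, so this is
  smoothness in the usual sense.\<close>

definition test_function :: "(real^'n::finite \<Rightarrow> real) \<Rightarrow> bool" where
  "test_function f \<longleftrightarrow>
     (\<forall>is. foldr partial is f differentiable_on UNIV) \<and> compact (closure {x. f x \<noteq> 0})"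

text \<open>The norm of \<open>H^2_{\<alpha>,\<beta>}\<close> on test functions; both integrals are finite when
  \<open>n - 2\<alpha> > 0\<close> and \<open>n - \<beta> > 0\<close>. Here and below, the value that \<open>powr\<close> assigns at the
  origin is irrelevant, because the origin is a null set.\<close>

definition H2_norm :: "real \<Rightarrow> real \<Rightarrow> (real^'n::finite \<Rightarrow> real) \<Rightarrow> real" where
  "H2_norm \<alpha> \<beta> f =
     sqrt ((\<integral>x. (laplacian f x)\<^sup>2 * norm x powr (- 2 * \<alpha>) \<partial>lborel)
         + (\<integral>x. (norm (grad f x))\<^sup>2 * norm x powr (- \<beta>) \<partial>lborel))"

text \<open>\<open>H2_element \<alpha> \<beta> u Du Lu\<close>: the function \<open>u\<close> is (a representative of) an element of the
  completion \<open>H^2_{\<alpha>,\<beta>}\<close> of the test functions under \<open>H2_norm\<close>, and \<open>Du\<close>, \<open>Lu\<close> are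
  (representatives of) its gradient and its Laplacian.

  An element of the completion is given by a norm-Cauchy sequence of test functions \<open>\<phi> k\<close>. The
  operators \<open>grad\<close> and \<open>laplacian\<close> extend to the completion by continuity, with values in the
  (complete) weighted spaces \<open>L^2(|x|^{-\<beta>} dx)\<close> and \<open>L^2(|x|^{-2\<alpha>} dx)\<close>, which is what
  the last two conditions say; such limits \<open>Du\<close>, \<open>Lu\<close> exist for every Cauchy sequence.

  The almost everywhere convergence names the function that the element is. For
  \<open>\<beta> = -2-2\<alpha>\<close> with \<open>n + 2\<alpha> > 0\<close>, Hardy's inequality bounds the norm of
  \<open>L^2(|x|^{2\<alpha>} dx)\<close> by \<open>H2_norm\<close>, so that every Cauchy sequence has a subsequence converging
  almost everywhere to a function which depends only on the element and determines it. If moreover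
  \<open>n - 2\<alpha> > 0\<close>, all three limits are locally \<open>L^1\<close> limits on the whole space, hence \<open>Du\<close> and \<open>Lu\<close>
  are the weak gradient and weak Laplacian of \<open>u\<close>.\<close>

definition H2_element ::
  "real \<Rightarrow> real \<Rightarrow> (real^'n::finite \<Rightarrow> real) \<Rightarrow> (real^'n \<Rightarrow> real^'n) \<Rightarrow> (real^'n \<Rightarrow> real) \<Rightarrow> bool" where
  "H2_element \<alpha> \<beta> u Du Lu \<longleftrightarrow>
     u \<in> borel_measurable borel \<and> Du \<in> borel_measurable borel \<and> Lu \<in> borel_measurable borel \<and>
     (\<exists>\<phi>. (\<forall>k::nat. test_function (\<phi> k)) \<and>
          (\<forall>e>0. \<exists>N. \<forall>j\<ge>N. \<forall>k\<ge>N. H2_norm \<alpha> \<beta> (\<lambda>x. \<phi> j x - \<phi> k x) < e) \<and>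
          (AE x in lborel. (\<lambda>k. \<phi> k x) \<longlonglongrightarrow> u x) \<and>
          (\<lambda>k. \<integral>\<^sup>+x. ennreal ((norm (grad (\<phi> k) x - Du x))\<^sup>2 * norm x powr (- \<beta>)) \<partial>lborel)
             \<longlonglongrightarrow> 0 \<and>
          (\<lambda>k. \<integral>\<^sup>+x. ennreal ((laplacian (\<phi> k) x - Lu x)\<^sup>2 * norm x powr (- 2 * \<alpha>)) \<partial>lborel)
             \<longlonglongrightarrow> 0)"

definition U0 :: "real \<Rightarrow> real^'n::finite \<Rightarrow> real" where
  "U0 \<alpha> x = exp (- (norm x powr (2 * (1 + \<alpha>)) / (2 * (1 + \<alpha>))))"

end

theory Submission
  imports Defs
begin

text \<open>
  For a test function \<open>u\<close> put \<open>E = \<nabla>u \<bullet> x\<close>, \<open>m = n + 2\<alpha>\<close> and \<open>V = E + m u\<close>. Integrating by parts,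
  \<open>\<integral> u \<Delta>u = - \<integral> |\<nabla>u|^2\<close> and \<open>\<integral> E \<Delta>u = (n - 2)/2 \<integral> |\<nabla>u|^2\<close>, hence
  \<open>\<integral> V \<Delta>u = - (n + 4\<alpha> + 2)/2 \<integral> |\<nabla>u|^2\<close>; and \<open>\<integral> |x|^{2\<alpha>} V^2 = \<integral> |x|^{2\<alpha>} E^2\<close>, because
  \<open>2 u E + m u^2\<close>, multiplied by \<open>|x|^{2\<alpha>}\<close>, is the divergence of \<open>|x|^{2\<alpha>} u^2 x\<close>. The inequality is
  then the Cauchy-Schwarz inequality for \<open>|x|^{-\<alpha>} \<Delta>u\<close> and \<open>|x|^\<alpha> V\<close>, and it passes to the
  completion by Fatou's lemma.

  The moments \<open>M(s) = \<integral> |x|^s U0^2\<close> satisfy \<open>M(s + 2 + 2\<alpha>) = (s + n)/2 M(s)\<close>, which makes both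
  factors on the left equal to \<open>(n + 4\<alpha> + 2)/2 \<integral> |\<nabla>U0|^2\<close>. Integrations by parts against
  singular weights are obtained by differentiating the scaling identity
  \<open>\<integral> |x|^s f(tx) = t^{-s-n} \<integral> |x|^s f(x)\<close> at \<open>t = 1\<close>.
\<close>

section \<open>Integrability of radial powers\<close>

text \<open>The origin shapes the proof: the weights \<open>|x|^s\<close> are singular there, and
  for general \<alpha> so are the derivatives of \<open>U0\<close>. A homogeneous weight survives a
  dilation up to a factor, so scaling spares cutting out a ball around the origin. \<open>U0\<close>
  is no test function, so its membership in the completion needs explicit test functions, dominated
  uniformly near the origin and at infinity in both weighted norms. In the passage to the completion
  the difficulty is that the unweighted integral of \<open>|\<nabla>u|^2\<close> is not part of the
  norm. The inequality for test functions itself supplies the bound that Fatou's lemma needs, while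
  the two left-hand factors converge from above. For \<open>U0\<close> one has
  \<open>\<Delta>U0 = - |x|^{2\<alpha>} V\<close>, so the two functions in the Cauchy-Schwarz
  inequality are proportional and equality is to be expected; it is then verified with moments.
  Sharpness needs no minimizing sequence: \<open>\<integral> |\<nabla>U0|^2\<close> is positive and
  finite, so a larger constant fails for \<open>U0\<close> itself.\<close>

lemma nn_integral_lborel_scale:
  fixes f :: "'a::euclidean_space \<Rightarrow> ennreal"
  assumes [measurable]: "f \<in> borel_measurable borel" and c: "c > 0"
  shows "(\<integral>\<^sup>+x. f x \<partial>lborel) = ennreal (c ^ DIM('a)) * (\<integral>\<^sup>+x. f (c *\<^sub>R x) \<partial>lborel)"
  using c
  by (subst lborel_affine[of c 0])
     (simp_all add: nn_integral_density nn_integral_distr nn_integral_cmult)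

lemma integral_lborel_scale:
  fixes f :: "'a::euclidean_space \<Rightarrow> real"
  assumes f: "integrable lborel f" and c: "c > 0"
  shows "integrable lborel (\<lambda>x. f (c *\<^sub>R x))"
    and "(\<integral>x. f x \<partial>lborel) = c ^ DIM('a) * (\<integral>x. f (c *\<^sub>R x) \<partial>lborel)"
proof -
  have [measurable]: "f \<in> borel_measurable borel"
    using borel_measurable_integrable[OF f] by simp
  have "(\<integral>\<^sup>+x. ennreal (norm (f x)) \<partial>lborel) < \<infinity>"
    using f by (simp add: integrable_iff_bounded)
  then show "integrable lborel (\<lambda>x. f (c *\<^sub>R x))"
    using nn_integral_lborel_scale[of "\<lambda>x. ennreal (norm (f x))" c] c
    by (auto simp: integrable_iff_bounded ennreal_mult_less_top)
  show "(\<integral>x. f x \<partial>lborel) = c ^ DIM('a) * (\<integral>x. f (c *\<^sub>R x) \<partial>lborel)"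
    using c by (subst lborel_affine[of c 0]) (simp_all add: integral_density integral_distr)
qed

lemma integral_lborel_translate:
  fixes f :: "'a::euclidean_space \<Rightarrow> real"
  assumes [measurable]: "f \<in> borel_measurable borel"
  shows "(\<integral>x. f (c + x) \<partial>lborel) = (\<integral>x. f x \<partial>lborel)"
    and "integrable lborel f \<Longrightarrow> integrable lborel (\<lambda>x. f (c + x))"
proof -
  have "(\<integral>x. f x \<partial>lborel) = (\<integral>x. f x \<partial>(distr lborel borel ((+) c)))"
    by (simp add: lborel_distr_plus)
  also have "\<dots> = (\<integral>x. f (c + x) \<partial>lborel)"
    by (subst integral_distr) auto
  finally show "(\<integral>x. f (c + x) \<partial>lborel) = (\<integral>x. f x \<partial>lborel)" ..
  assume "integrable lborel f"
  then have "integrable (distr lborel borel ((+) c)) f"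
    by (simp add: lborel_distr_plus)
  then show "integrable lborel (\<lambda>x. f (c + x))"
    by (subst (asm) integrable_distr_eq) auto
qed

text \<open>Dyadic scaling turns the integral into a geometric series; \<open>b = 2\<close> covers a neighbourhood
  of the origin and \<open>b = 1/2\<close> a neighbourhood of infinity.\<close>

lemma nn_integral_dyadic_finite:
  fixes b s :: real
  defines "g \<equiv> (\<lambda>x::'a::euclidean_space. ennreal (norm x powr s) * indicator {x. 1/2 \<le> norm x \<and> norm x \<le> 1} x)"
  assumes b: "b > 0" "b powr (- (s + real DIM('a))) < 1"
  shows "(\<integral>\<^sup>+x. (\<Sum>k. ennreal ((b ^ k) powr (- s)) * g ((b ^ k) *\<^sub>R x)) \<partial>lborel) < \<infinity>"
proof -
  define G where "G = (\<integral>\<^sup>+x. g x \<partial>lborel)"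
  have gm[measurable]: "g \<in> borel_measurable borel"
    unfolding g_def by measurable
  have "G \<le> (\<integral>\<^sup>+x. ennreal (1 + (1/2) powr s) * indicator (cball 0 1) (x::'a) \<partial>lborel)"
    unfolding G_def
  proof (rule nn_integral_mono)
    fix x :: 'a
    have "norm x powr s \<le> 1 + (1/2) powr s" if "1/2 \<le> norm x" "norm x \<le> 1"
    proof (cases "s \<ge> 0")
      case True
      then have "norm x powr s \<le> 1 powr s" using that by (intro powr_mono2) auto
      then show ?thesis by (simp add: add_increasing2)
    next
      case False
      then have "norm x powr s \<le> (1/2) powr s" using that by (intro powr_mono2') auto
      then show ?thesis by simp
    qed
    then have "ennreal (norm x powr s) \<le> ennreal (1 + (1/2) powr s)"
      if "1/2 \<le> norm x" "norm x \<le> 1" using that by (intro ennreal_leI)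
    then show "g x \<le> ennreal (1 + (1/2) powr s) * indicator (cball 0 1) x"
      unfolding g_def indicator_def by (auto simp del: ennreal_plus)
  qed
  also have "\<dots> < \<infinity>"
    using emeasure_lborel_cball_finite[of "0::'a" 1]
    by (simp add: nn_integral_cmult_indicator ennreal_mult_less_top)
  finally have G: "G < \<infinity>" .
  \<comment> \<open>The factor \<open>(b ^ k) powr (- s)\<close> undoes the homogeneity of the
    weight, so the term equals \<open>|x|^s\<close> on the shell
    \<open>b^(-k)/2 \<le> |x| \<le> b^(-k)\<close> and 0 elsewhere. The substitution contributes
    \<open>(b^k)^(-d)\<close>, d being the dimension; together they give the k-th power of one fixed
    ratio.\<close>
  have term_eq: "(\<integral>\<^sup>+x. ennreal ((b ^ k) powr (- s)) * g ((b ^ k) *\<^sub>R x) \<partial>lborel)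
      = G * ennreal ((b powr (- (s + real DIM('a)))) ^ k)" for k
  proof -
    have c: "b ^ k > 0" using b by simp
    have "G = ennreal ((b ^ k) ^ DIM('a)) * (\<integral>\<^sup>+x. g ((b ^ k) *\<^sub>R x) \<partial>lborel)"
      unfolding G_def by (rule nn_integral_lborel_scale[OF gm c])
    moreover have "ennreal (1 / (b ^ k) ^ DIM('a)) * ennreal ((b ^ k) ^ DIM('a)) = 1"
      using b by (subst ennreal_mult[symmetric]) auto
    ultimately have "(\<integral>\<^sup>+x. g ((b ^ k) *\<^sub>R x) \<partial>lborel) = ennreal (1 / (b ^ k) ^ DIM('a)) * G"
      by (simp only: mult.assoc[symmetric] mult_1_left)
    moreover have "(b powr (- (s + real DIM('a)))) ^ k = (b ^ k) powr (- s) * (1 / (b ^ k) ^ DIM('a))"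
    proof -
      have "b powr (- (s + real DIM('a))) = b powr (- s) * (1 / b ^ DIM('a))"
        using b powr_diff[of b "- s" "real DIM('a)"] powr_realpow[of b "DIM('a)"] by simp
      moreover have "(b powr (- s)) ^ k = (b ^ k) powr (- s)"
        using b by (subst powr_realpow[of b k, symmetric]) (simp_all add: powr_power powr_powr)
      ultimately show ?thesis
        by (simp add: power_mult_distrib power_divide power_mult[symmetric] mult.commute)
    qed
    moreover have "(\<integral>\<^sup>+x. ennreal ((b ^ k) powr (- s)) * g ((b ^ k) *\<^sub>R x) \<partial>lborel)
        = ennreal ((b ^ k) powr (- s)) * (\<integral>\<^sup>+x. g ((b ^ k) *\<^sub>R x) \<partial>lborel)"
      by (rule nn_integral_cmult) measurable
    ultimately show ?thesis
      by (simp only: ennreal_mult''[of "1 / (b ^ k) ^ DIM('a)"] less_imp_le[OF zero_less_one] c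
          ennreal_mult powr_ge_zero divide_nonneg_nonneg zero_le_one zero_le_power less_imp_le[OF b(1)] mult.left_commute mult.commute)
  qed
  have "(\<integral>\<^sup>+x. (\<Sum>k. ennreal ((b ^ k) powr (- s)) * g ((b ^ k) *\<^sub>R x)) \<partial>lborel)
      = (\<Sum>k. G * ennreal ((b powr (- (s + real DIM('a)))) ^ k))"
    by (subst nn_integral_suminf) (auto simp: term_eq)
  also have "\<dots> = G * (\<Sum>k. ennreal ((b powr (- (s + real DIM('a)))) ^ k))"
    by simp
  also have "\<dots> = G * ennreal (\<Sum>k. (b powr (- (s + real DIM('a)))) ^ k)"
    using b by (subst suminf_ennreal2) (auto intro!: summable_geometric)
  also have "\<dots> < \<infinity>"
    using G by (simp add: ennreal_mult_less_top)
  finally show ?thesis .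
qed

lemma ex_power2_interval:
  fixes y :: real
  assumes "y \<ge> 1"
  shows "\<exists>k. 2 ^ k \<le> y \<and> y < 2 ^ (k + 1)"
proof -
  have "1 \<le> nat \<lfloor>y\<rfloor>" using assms by (simp add: le_nat_floor)
  then obtain k where k: "2 ^ k \<le> nat \<lfloor>y\<rfloor>" "nat \<lfloor>y\<rfloor> < 2 ^ (k + 1)"
    using ex_power_ivl1[of 2 "nat \<lfloor>y\<rfloor>"] by auto
  have "real (2 ^ k) \<le> real (nat \<lfloor>y\<rfloor>)" "real (nat \<lfloor>y\<rfloor> + 1) \<le> real (2 ^ (k + 1))"
    using k by (simp_all only: of_nat_le_iff)
  moreover have "real (nat \<lfloor>y\<rfloor>) \<le> y" "y < real (nat \<lfloor>y\<rfloor>) + 1"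
    using assms by linarith+
  ultimately have "real (2 ^ k) \<le> y" "y < real (2 ^ (k + 1))" by linarith+
  then show ?thesis by (intro exI[of _ k]) simp
qed

lemma dyadic_cover:
  fixes r :: real
  assumes "r > 0"
  shows "r \<le> 1 \<Longrightarrow> \<exists>k. 1/2 \<le> 2 ^ k * r \<and> 2 ^ k * r \<le> 1"
    and "r > 1 \<Longrightarrow> \<exists>k. 1/2 \<le> (1/2) ^ k * r \<and> (1/2) ^ k * r \<le> 1"
proof -
  assume "r \<le> 1"
  then have "1 \<le> 1 / r" using assms by simp
  then obtain k where "2 ^ k \<le> 1 / r" "1 / r < 2 ^ (k + 1)"
    using ex_power2_interval by blast
  then show "\<exists>k. 1/2 \<le> 2 ^ k * r \<and> 2 ^ k * r \<le> 1"
    using assms by (intro exI[of _ k]) (auto simp: field_simps)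
next
  assume "r > 1"
  then obtain k where "2 ^ k \<le> r" "r < 2 ^ (k + 1)"
    using ex_power2_interval[of r] by auto
  then show "\<exists>k. 1/2 \<le> (1/2) ^ k * r \<and> (1/2) ^ k * r \<le> 1"
    \<comment> \<open>Dividing by \<open>2^k\<close> would leave a value in [1, 2), hence one
      further halving.\<close>
    using assms by (intro exI[of _ "Suc k"]) (auto simp: field_simps)
qed

text \<open>With d the dimension, the ratio \<open>b powr (- (s + d))\<close> of the dyadic series
  is below 1 for b = 2 when s > -d, and for b = 1/2 when s < -d. Each point only has to lie in some
  shell: a single term of the series dominates the integrand there, so overlaps of neighbouring
  shells do no harm.\<close>

lemma nn_integral_norm_powr_finite:
  fixes s :: real
  shows "s > - real DIM('a) \<Longrightarrow>
      (\<integral>\<^sup>+(x::'a::euclidean_space). ennreal (norm x powr s) * indicator {x. norm x \<le> 1} x \<partial>lborel) < (\<infinity>::ennreal)"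
    and "s < - real DIM('a) \<Longrightarrow>
      (\<integral>\<^sup>+(x::'a::euclidean_space). ennreal (norm x powr s) * indicator {x. norm x > 1} x \<partial>lborel) < (\<infinity>::ennreal)"
proof -
  define g where "g = (\<lambda>x::'a. ennreal (norm x powr s) * indicator {x. 1/2 \<le> norm x \<and> norm x \<le> 1} x)"
  have bound: "ennreal (norm x powr s) \<le> (\<Sum>k. ennreal ((b ^ k) powr (- s)) * g ((b ^ k) *\<^sub>R x))"
    if b: "b > 0" and x: "x \<noteq> 0" and k: "1/2 \<le> b ^ k * norm x" "b ^ k * norm x \<le> 1" for x b k
  proof -
    have "(b ^ k) powr (- s) * (b ^ k * norm x) powr s = norm x powr s"
      using b x by (simp add: powr_mult powr_minus field_simps)
    then have "ennreal (norm x powr s) = ennreal ((b ^ k) powr (- s)) * g ((b ^ k) *\<^sub>R x)"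
      using k b by (simp add: g_def ennreal_mult''[symmetric])
    also have "\<dots> = (\<Sum>j\<in>{k}. ennreal ((b ^ j) powr (- s)) * g ((b ^ j) *\<^sub>R x))" by simp
    also have "\<dots> \<le> (\<Sum>k. ennreal ((b ^ k) powr (- s)) * g ((b ^ k) *\<^sub>R x))"
      by (rule sum_le_suminf) auto
    finally show ?thesis .
  qed
  { assume s: "s > - real DIM('a)"
    have "(\<integral>\<^sup>+x. ennreal (norm x powr s) * indicator {x. norm x \<le> 1} (x::'a) \<partial>lborel)
      \<le> (\<integral>\<^sup>+x. (\<Sum>k. ennreal ((2 ^ k) powr (- s)) * g ((2 ^ k) *\<^sub>R x)) \<partial>lborel)"
    proof (rule nn_integral_mono)
      fix x :: 'a
      show "ennreal (norm x powr s) * indicator {x. norm x \<le> 1} x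
        \<le> (\<Sum>k. ennreal ((2 ^ k) powr (- s)) * g ((2 ^ k) *\<^sub>R x))"
      proof (cases "x = 0 \<or> norm x > 1")
        case False
        then obtain k where "1/2 \<le> 2 ^ k * norm x" "2 ^ k * norm x \<le> 1"
          using dyadic_cover(1)[of "norm x"] by auto
        then show ?thesis using bound[of 2 x k] False by simp
      qed auto
    qed
    also have "\<dots> < \<infinity>"
      unfolding g_def using s by (intro nn_integral_dyadic_finite) (auto simp: powr_less_one)
    finally show "(\<integral>\<^sup>+x. ennreal (norm x powr s) * indicator {x. norm x \<le> 1} (x::'a) \<partial>lborel) < \<infinity>" . }
  { assume s: "s < - real DIM('a)"
    have "(\<integral>\<^sup>+x. ennreal (norm x powr s) * indicator {x. norm x > 1} (x::'a) \<partial>lborel)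
      \<le> (\<integral>\<^sup>+x. (\<Sum>k. ennreal (((1/2) ^ k) powr (- s)) * g (((1/2) ^ k) *\<^sub>R x)) \<partial>lborel)"
    proof (rule nn_integral_mono)
      fix x :: 'a
      show "ennreal (norm x powr s) * indicator {x. norm x > 1} x
        \<le> (\<Sum>k. ennreal (((1/2) ^ k) powr (- s)) * g (((1/2) ^ k) *\<^sub>R x))"
      proof (cases "norm x > 1")
        case True
        then have "x \<noteq> 0" by auto
        moreover from this True obtain k where "1/2 \<le> (1/2) ^ k * norm x" "(1/2) ^ k * norm x \<le> 1"
          using dyadic_cover(2)[of "norm x"] by auto
        ultimately show ?thesis using bound[of "1/2" x k] True by simp
      qed auto
    qed
    also have "\<dots> < \<infinity>"
      unfolding g_def using s
      by (intro nn_integral_dyadic_finite) (auto simp: powr01_less_one)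
    finally show "(\<integral>\<^sup>+x. ennreal (norm x powr s) * indicator {x. norm x > 1} (x::'a) \<partial>lborel) < \<infinity>" . }
qed

text \<open>The common criterion for the weighted integrals below: compare with a power integrable
  at the origin inside the unit ball and with a power integrable at infinity outside it.\<close>

lemma integrable_norm_powr_bound:
  fixes f :: "'a::euclidean_space \<Rightarrow> real"
  assumes [measurable]: "f \<in> borel_measurable borel"
    and s: "s > - real DIM('a)" and t: "t < - real DIM('a)"
    and 1: "\<And>x. x \<noteq> 0 \<Longrightarrow> norm x \<le> 1 \<Longrightarrow> \<bar>f x\<bar> \<le> C * norm x powr s"
    and 2: "\<And>x. norm x > 1 \<Longrightarrow> \<bar>f x\<bar> \<le> C * norm x powr t"
  shows "integrable lborel f"
proof -
  \<comment> \<open>The sign of \<open>C\<close> is not prescribed, and \<open>ennreal\<close> would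
    truncate a negative constant to 0.\<close>
  define D where "D = max C 0"
  let ?I = "\<lambda>x::'a. ennreal (norm x powr s) * indicator {x. norm x \<le> 1} x"
  let ?J = "\<lambda>x::'a. ennreal (norm x powr t) * indicator {x. norm x > 1} x"
  have D: "\<bar>f x\<bar> \<le> D * norm x powr s" if "x \<noteq> 0" "norm x \<le> 1" for x
    using 1[OF that] by (rule order_trans) (auto simp: D_def intro!: mult_right_mono)
  have D': "\<bar>f x\<bar> \<le> D * norm x powr t" if "norm x > 1" for x
    using 2[OF that] by (rule order_trans) (auto simp: D_def intro!: mult_right_mono)
  have "AE x in lborel. ennreal (norm (f x)) \<le> ennreal D * (?I x + ?J x)"
    using AE_lborel_singleton[of "0::'a"]
  proof eventually_elim
    case (elim x)
    show ?case
      using D[of x] D'[of x] elim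
      by (cases "norm x \<le> 1") (auto simp: ennreal_mult''[symmetric] D_def intro!: ennreal_leI)
  qed
  then have "(\<integral>\<^sup>+x. ennreal (norm (f x)) \<partial>lborel) \<le> (\<integral>\<^sup>+x. ennreal D * (?I x + ?J x) \<partial>lborel)"
    by (rule nn_integral_mono_AE)
  also have "\<dots> = ennreal D * ((\<integral>\<^sup>+x. ?I x \<partial>lborel) + (\<integral>\<^sup>+x. ?J x \<partial>lborel))"
    by (simp add: nn_integral_cmult nn_integral_add)
  also have "\<dots> < \<infinity>"
    using nn_integral_norm_powr_finite(1)[OF s] nn_integral_norm_powr_finite(2)[OF t]
    by (auto simp: ennreal_mult_less_top)
  finally show ?thesis by (simp add: integrable_iff_bounded)
qed

section \<open>Powers against exponential decay\<close>

lemma power_div_fact_le_exp: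
  fixes y :: real
  assumes "y \<ge> 0"
  shows "y ^ k / fact k \<le> exp y"
proof -
  have "(\<Sum>n\<in>{k}. y ^ n /\<^sub>R fact n) \<le> (\<Sum>n. y ^ n /\<^sub>R fact n)"
    using assms by (intro sum_le_suminf summable_exp_generic) auto
  then show ?thesis by (simp add: exp_def divide_inverse mult.commute)
qed

text \<open>One term of the exponential series is enough: with \<open>y = b r^p\<close> and
  \<open>k \<ge> q/p\<close>, the bound \<open>y^k / k! \<le> exp y\<close> controls
  \<open>r^(p k)\<close>, which dominates \<open>r^q\<close> because
  \<open>r \<ge> 1\<close>.\<close>

lemma powr_mult_exp_bounded:
  fixes b p q :: real
  assumes b: "b > 0" and p: "p > 0"
  obtains C where "\<And>r. r \<ge> 1 \<Longrightarrow> r powr q * exp (- b * r powr p) \<le> C"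
proof -
  obtain k :: nat where k: "q / p \<le> real k" using real_arch_simple by blast
  show thesis
  proof (rule that)
    fix r :: real assume r: "r \<ge> 1"
    have y: "b * r powr p > 0" using b r by simp
    have "(b * r powr p) ^ k / fact k \<le> exp (b * r powr p)"
      using power_div_fact_le_exp[of "b * r powr p" k] y by simp
    moreover have "(b * r powr p) ^ k = b ^ k * r powr (p * k)"
      using r by (simp add: power_mult_distrib powr_power mult.commute)
    ultimately have "b ^ k * r powr (p * k) \<le> fact k * exp (b * r powr p)"
      by (simp add: pos_divide_le_eq mult.commute)
    then have "b ^ k * r powr (p * k) * exp (- b * r powr p) \<le> fact k * exp (b * r powr p) * exp (- b * r powr p)"
      by (rule mult_right_mono) simp
    then have "b ^ k * r powr (p * k) * exp (- b * r powr p) \<le> fact k"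
      by (simp add: mult.assoc flip: exp_add)
    then have "r powr (p * k) * exp (- b * r powr p) \<le> fact k / b ^ k"
      using b by (simp add: pos_le_divide_eq mult_ac)
    moreover have "r powr q \<le> r powr (p * k)"
      using k p r by (intro powr_mono) (auto simp: field_simps)
    ultimately show "r powr q * exp (- b * r powr p) \<le> fact k / b ^ k"
      by (meson exp_ge_zero mult_right_mono order_trans)
  qed
qed

text \<open>\<open>N = 0\<close> serves the moments of \<open>U0\<close>; a positive
  \<open>N\<close> serves the polynomial growth of the function that dominates the approximations of
  \<open>U0\<close>.\<close>

lemma integrable_norm_powr_exp:
  fixes b p s N :: real
  assumes b: "b > 0" and p: "p > 0" and s: "s > - real DIM('a)" and N: "N \<ge> 0"
  shows "integrable lborel (\<lambda>x::'a::euclidean_space.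
    norm x powr s * (1 + (norm x)\<^sup>2) powr N * exp (- b * norm x powr p))"
proof -
  \<comment> \<open>For \<open>r > 1\<close> one has \<open>1 + r^2 \<le> 2 r^2\<close>, so the
    integrand grows at most like \<open>r^(s + 2N)\<close> before the decay. The additional exponent
    \<open>d + 1\<close> leaves \<open>r^(-d-1)\<close>, which is integrable at infinity.\<close>
  obtain C where C: "\<And>r. r \<ge> 1 \<Longrightarrow> r powr (s + 2 * N + real DIM('a) + 1) * exp (- b * r powr p) \<le> C"
    using powr_mult_exp_bounded[OF b p] by blast
  have "0 \<le> 1 powr (s + 2 * N + real DIM('a) + 1) * exp (- b * 1 powr p)"
    by (intro mult_nonneg_nonneg) auto
  with C[of 1] have C0: "C \<ge> 0" by linarith
  show ?thesis
  proof (rule integrable_norm_powr_bound[where s = s and t = "- real DIM('a) - 1" and C = "2 powr N * (1 + C)"])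
    fix x :: 'a assume x: "x \<noteq> 0" "norm x \<le> 1"
    have "(norm x)\<^sup>2 \<le> 1" using x by (simp add: power_le_one)
    then have "(1 + (norm x)\<^sup>2) powr N \<le> 2 powr N" using N by (intro powr_mono2) auto
    moreover have "exp (- b * norm x powr p) \<le> 1 + C" using b C0 by (rule_tac order_trans[of _ 1]) auto
    ultimately have "(1 + (norm x)\<^sup>2) powr N * exp (- b * norm x powr p) \<le> 2 powr N * (1 + C)"
      using C0 by (intro mult_mono) auto
    then have "norm x powr s * ((1 + (norm x)\<^sup>2) powr N * exp (- b * norm x powr p)) \<le> norm x powr s * (2 powr N * (1 + C))"
      by (rule mult_left_mono) simp
    then show "\<bar>norm x powr s * (1 + (norm x)\<^sup>2) powr N * exp (- b * norm x powr p)\<bar> \<le> 2 powr N * (1 + C) * norm x powr s"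
      by (simp add: abs_mult mult_ac)
  next
    fix x :: 'a assume x: "norm x > 1"
    let ?r = "norm x"
    have "1 + ?r\<^sup>2 \<le> 2 * ?r\<^sup>2" using x by (simp add: one_le_power)
    then have "(1 + ?r\<^sup>2) powr N \<le> (2 * ?r\<^sup>2) powr N" using N by (intro powr_mono2) auto
    also have "\<dots> = 2 powr N * ?r powr (2 * N)"
    proof -
      have "?r\<^sup>2 powr N = ?r powr (2 * N)"
        using x powr_powr[of ?r 2 N] by (simp add: powr_numeral)
      then show ?thesis by (simp add: powr_mult)
    qed
    finally have 1: "(1 + ?r\<^sup>2) powr N \<le> 2 powr N * ?r powr (2 * N)" .
    have "?r powr s * (1 + ?r\<^sup>2) powr N * exp (- b * ?r powr p)
      \<le> ?r powr s * (2 powr N * ?r powr (2 * N)) * exp (- b * ?r powr p)"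
      using 1 by (intro mult_right_mono mult_left_mono) auto
    also have "\<dots> = 2 powr N * ((?r powr (s + 2 * N + real DIM('a) + 1) * exp (- b * ?r powr p)) * ?r powr (- real DIM('a) - 1))"
    proof -
      have "?r powr s * ?r powr (2 * N) = ?r powr (s + 2 * N + real DIM('a) + 1) * ?r powr (- real DIM('a) - 1)"
        by (simp flip: powr_add)
      then show ?thesis by simp
    qed
    also have "\<dots> \<le> 2 powr N * ((1 + C) * ?r powr (- real DIM('a) - 1))"
      using C[of ?r] x by (intro mult_left_mono mult_right_mono) auto
    finally show "\<bar>?r powr s * (1 + ?r\<^sup>2) powr N * exp (- b * ?r powr p)\<bar> \<le> 2 powr N * (1 + C) * ?r powr (- real DIM('a) - 1)"
      by (simp add: abs_mult mult_ac)
  qed (use s in auto)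
qed

section \<open>Integration by parts\<close>

lemma partial_eqI:
  "(f has_derivative f') (at x) \<Longrightarrow> partial i f x = f' (axis i 1)"
  unfolding partial_def by (metis frechet_derivative_at)

lemma frechet_derivative_eq_grad:
  fixes f :: "real^'n::finite \<Rightarrow> real"
  assumes "f differentiable (at x)"
  shows "frechet_derivative f (at x) v = grad f x \<bullet> v"
proof -
  interpret l: linear "frechet_derivative f (at x)"
    using assms by (rule linear_frechet_derivative)
  have "frechet_derivative f (at x) v = frechet_derivative f (at x) (\<Sum>i\<in>UNIV. (v $ i) *\<^sub>R axis i 1)"
    by (simp add: basis_expansion flip: scalar_mult_eq_scaleR)
  also have "\<dots> = grad f x \<bullet> v"
    by (simp add: l.sum l.scaleR inner_vec_def grad_def partial_def mult.commute)
  finally show ?thesis .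
qed

lemma has_real_derivative_along_line:
  fixes f :: "real^'n::finite \<Rightarrow> real"
  assumes "f differentiable (at (a + t *\<^sub>R v))"
  shows "((\<lambda>t. f (a + t *\<^sub>R v)) has_real_derivative (grad f (a + t *\<^sub>R v) \<bullet> v)) (at t)"
proof -
  have f: "(f has_derivative (\<lambda>w. grad f (a + t *\<^sub>R v) \<bullet> w)) (at (a + t *\<^sub>R v))"
    using assms frechet_derivative_eq_grad[OF assms]
    by (metis (no_types, lifting) ext frechet_derivative_works)
  have "((\<lambda>t. f (a + t *\<^sub>R v)) has_derivative (\<lambda>h. grad f (a + t *\<^sub>R v) \<bullet> (h *\<^sub>R v))) (at t)"
    by (rule has_derivative_compose[where f = "\<lambda>t. a + t *\<^sub>R v" and g = f, OF _ f])
       (auto intro!: derivative_eq_intros)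
  moreover have "(\<lambda>h. grad f (a + t *\<^sub>R v) \<bullet> (h *\<^sub>R v)) = (*) (grad f (a + t *\<^sub>R v) \<bullet> v)"
    by (rule ext) simp
  ultimately show ?thesis
    by (simp add: has_field_derivative_def)
qed

lemma grad_inner_axis: "grad f x \<bullet> axis i 1 = partial i f x"
  by (simp add: grad_def inner_axis)

lemma partial_mult:
  assumes "f differentiable (at x)" "g differentiable (at x)"
  shows "partial i (\<lambda>x. f x * g x) x = f x * partial i g x + partial i f x * g x"
proof -
  have "((\<lambda>x. f x * g x) has_derivative
     (\<lambda>h. f x * frechet_derivative g (at x) h + frechet_derivative f (at x) h * g x)) (at x)"
    using assms by (intro has_derivative_mult) (auto simp: frechet_derivative_works)
  from partial_eqI[OF this] show ?thesis by (simp add: partial_def)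
qed

lemma partial_add:
  assumes "f differentiable (at x)" "g differentiable (at x)"
  shows "partial i (\<lambda>x. f x + g x) x = partial i f x + partial i g x"
proof -
  have "((\<lambda>x. f x + g x) has_derivative
     (\<lambda>h. frechet_derivative f (at x) h + frechet_derivative g (at x) h)) (at x)"
    using assms by (intro has_derivative_add) (auto simp: frechet_derivative_works)
  from partial_eqI[OF this] show ?thesis by (simp add: partial_def)
qed

lemma partial_diff:
  assumes "f differentiable (at x)" "g differentiable (at x)"
  shows "partial i (\<lambda>x. f x - g x) x = partial i f x - partial i g x"
proof -
  have "((\<lambda>x. f x - g x) has_derivative
     (\<lambda>h. frechet_derivative f (at x) h - frechet_derivative g (at x) h)) (at x)"
    using assms by (intro has_derivative_diff) (auto simp: frechet_derivative_works)
  from partial_eqI[OF this] show ?thesis by (simp add: partial_def)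
qed

lemma has_derivative_component: "((\<lambda>x::real^'n::finite. x $ j) has_derivative (\<lambda>h. h $ j)) F"
  by (rule bounded_linear_imp_has_derivative[OF bounded_linear_vec_nth])

lemma partial_component: "partial i (\<lambda>x::real^'n::finite. x $ j) = (\<lambda>x. if i = j then 1 else 0)"
  by (rule ext) (auto simp: partial_eqI[OF has_derivative_component] axis_def)

text \<open>The class in which the vector fields of the integrations by parts are formed: it
  contains the coordinate functions, is closed under products, and suffices for integrating a
  partial derivative.\<close>

definition C1 :: "(real^'n::finite \<Rightarrow> real) \<Rightarrow> bool" where
  "C1 f \<longleftrightarrow> (\<forall>x. f differentiable (at x)) \<and> (\<forall>i. continuous_on UNIV (partial i f))"

lemma C1_D:
  assumes "C1 f"
  shows "f differentiable (at x)" "continuous_on S (partial i f)" "continuous_on S f"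
  using assms unfolding C1_def
  by (auto intro: continuous_on_subset simp: continuous_at_imp_continuous_on differentiable_imp_continuous_within)

lemma C1_mult:
  assumes "C1 f" "C1 g"
  shows "C1 (\<lambda>x. f x * g x)"
proof -
  have "partial i (\<lambda>x. f x * g x) = (\<lambda>x. f x * partial i g x + partial i f x * g x)" for i
    using assms by (intro ext partial_mult C1_D)
  then show ?thesis
    using C1_D[OF assms(1)] C1_D[OF assms(2)]
    by (auto simp: C1_def intro!: continuous_intros differentiable_mult)
qed

lemma C1_component: "C1 (\<lambda>x::real^'n::finite. x $ j)"
  unfolding C1_def partial_component
  using has_derivative_component by (auto simp: differentiable_def)

lemma partial_outside_support:
  fixes f :: "real^'n::finite \<Rightarrow> real"
  assumes "\<And>x. norm x > R \<Longrightarrow> f x = 0" "norm x > R"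
  shows "partial i f x = 0"
proof -
  have "open {x::real^'n. norm x > R}"
    by (intro open_Collect_less continuous_intros)
  then have "(f has_derivative (\<lambda>h. 0)) (at x)"
    using assms by (rule_tac has_derivative_transform_within_open[of "\<lambda>x. 0" "\<lambda>h. 0"]) auto
  from partial_eqI[OF this] show ?thesis by simp
qed

lemma bounded_if_compact_support:
  fixes f :: "'a::euclidean_space \<Rightarrow> real"
  assumes "continuous_on UNIV f" "\<And>x. norm x > R \<Longrightarrow> f x = 0"
  obtains C where "C \<ge> 0" "\<And>x. \<bar>f x\<bar> \<le> C * indicator (cball 0 R) x"
proof -
  have "compact (f ` cball 0 R)"
    using assms by (intro compact_continuous_image) (auto intro: continuous_on_subset)
  then obtain C where C: "\<And>x. x \<in> cball 0 R \<Longrightarrow> \<bar>f x\<bar> \<le> C"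
    by (meson compact_imp_bounded bounded_real image_eqI)
  have "\<bar>f x\<bar> \<le> max C 0 * indicator (cball 0 R) x" for x
    using C[of x] assms(2)[of x] by (cases "norm x > R") (auto simp: indicator_def)
  then show thesis by (intro that[of "max C 0"]) auto
qed

lemma integrable_if_compact_support:
  fixes f :: "'a::euclidean_space \<Rightarrow> real"
  assumes "continuous_on UNIV f" "\<And>x. norm x > R \<Longrightarrow> f x = 0"
  shows "integrable lborel f"
proof -
  obtain C where C: "C \<ge> 0" "\<And>x. \<bar>f x\<bar> \<le> C * indicator (cball 0 R) x"
    using bounded_if_compact_support[OF assms] by blast
  have "integrable lborel (\<lambda>x::'a. C * indicator (cball 0 R) x)"
    using emeasure_lborel_cball_finite[of "0::'a" R] by (auto simp: integrable_indicator_iff)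
  then show ?thesis
  proof (rule Bochner_Integration.integrable_bound)
    show "AE x in lborel. norm (f x) \<le> norm (C * indicator (cball 0 R) x)"
      using C by (intro AE_I2) (simp add: abs_mult)
  qed (use assms(1) in \<open>auto intro: borel_measurable_continuous_onI\<close>)
qed

text \<open>Translation invariance gives every difference quotient integral 0, and dominated
  convergence passes this to the derivative. The steps \<open>h k\<close> are at most 1, so all
  quotients vanish outside the ball of radius \<open>R + 1\<close>; inside, the mean value theorem
  bounds them by the maximum of the derivative.\<close>

lemma integral_partial_eq_0:
  fixes f :: "real^'n::finite \<Rightarrow> real"
  assumes f: "C1 f" and supp: "\<And>x. norm x > R \<Longrightarrow> f x = 0"
  shows "integrable lborel (partial i f)" "(\<integral>x. partial i f x \<partial>lborel) = 0"
proof -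
  let ?e = "axis i 1 :: real^'n"
  define h where "h k = 1 / real (Suc k)" for k
  have h: "0 < h k" "h k \<le> 1" for k by (auto simp: h_def)
  have h0: "h \<longlonglongrightarrow> 0" unfolding h_def by (rule LIMSEQ_Suc[OF lim_1_over_n])
  have fm[measurable]: "f \<in> borel_measurable borel"
    using C1_D[OF f] by (intro borel_measurable_continuous_onI)
  have pm[measurable]: "partial i f \<in> borel_measurable borel"
    using C1_D[OF f] by (intro borel_measurable_continuous_onI)
  have fi: "integrable lborel f"
    using C1_D(3)[OF f] supp by (rule integrable_if_compact_support)
  obtain C where C: "C \<ge> 0" "\<And>x. \<bar>partial i f x\<bar> \<le> C * indicator (cball 0 R) x"
    using bounded_if_compact_support[OF C1_D(2)[OF f], of R i] partial_outside_support[of R f] supp by blast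
  define s where "s k x = (f (h k *\<^sub>R ?e + x) - f x) / h k" for k x
  have line: "((\<lambda>t. f (x + t *\<^sub>R ?e)) has_real_derivative partial i f (x + t *\<^sub>R ?e)) (at t)" for x t
    using has_real_derivative_along_line[of f x t ?e] C1_D(1)[OF f] by (simp add: grad_inner_axis)
  have lim: "(\<lambda>k. s k x) \<longlonglongrightarrow> partial i f x" for x
  proof -
    have "((\<lambda>t. (f (x + t *\<^sub>R ?e) - f x) / t) \<longlongrightarrow> partial i f x) (at 0)"
      using line[of x 0] by (simp add: has_field_derivative_iff)
    moreover have "filterlim h (at 0) sequentially"
      using h0 h(1) by (auto simp: filterlim_at less_imp_neq[symmetric])
    ultimately have "((\<lambda>k. (f (x + h k *\<^sub>R ?e) - f x) / h k) \<longlongrightarrow> partial i f x) sequentially"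
      by (rule filterlim_compose)
    then show ?thesis by (simp add: s_def add.commute)
  qed
  have bound: "\<bar>s k x\<bar> \<le> C * indicator (cball 0 (R + 1)) x" for k x
  proof (cases "norm x > R + 1")
    case True
    have "norm x \<le> norm (h k *\<^sub>R ?e + x) + norm (h k *\<^sub>R ?e)"
      by (metis add_diff_cancel_left' norm_triangle_ineq4 add.commute)
    also have "norm (h k *\<^sub>R ?e) \<le> 1" using h[of k] by simp
    finally have "f (h k *\<^sub>R ?e + x) = 0" "f x = 0" using True by (auto intro: supp)
    then show ?thesis using C by (simp add: s_def)
  next
    case False
    obtain z where "0 < z" "z < h k"
      "f (x + h k *\<^sub>R ?e) - f (x + 0 *\<^sub>R ?e) = (h k - 0) * partial i f (x + z *\<^sub>R ?e)"
      using MVT2[of 0 "h k" "\<lambda>t. f (x + t *\<^sub>R ?e)" "\<lambda>t. partial i f (x + t *\<^sub>R ?e)"] line h(1)[of k] by blast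
    then have "s k x = partial i f (x + z *\<^sub>R ?e)" using h(1)[of k] by (simp add: s_def add.commute)
    moreover have "C * indicator (cball 0 R) (x + z *\<^sub>R ?e) \<le> C"
      using C(1) by (auto simp: indicator_def)
    ultimately show ?thesis using C(2)[of "x + z *\<^sub>R ?e"] False by simp
  qed
  have si: "(\<integral>x. s k x \<partial>lborel) = 0" for k
    using integral_lborel_translate[OF fm, of "h k *\<^sub>R ?e"] fi by (simp add: s_def)
  have w: "integrable lborel (\<lambda>x::real^'n. C * indicator (cball 0 (R + 1)) x)"
    using emeasure_lborel_cball_finite[of "0::real^'n" "R+1"] by (auto simp: integrable_indicator_iff)
  have sm: "s k \<in> borel_measurable lborel" for k unfolding s_def by measurable
  note dc = sm w AE_I2[OF lim] AE_I2[of lborel, OF bound[folded real_norm_def]]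
  show "integrable lborel (partial i f)"
    by (rule integrable_dominated_convergence[OF _ dc]) measurable
  have "(\<lambda>k. \<integral>x. s k x \<partial>lborel) \<longlonglongrightarrow> (\<integral>x. partial i f x \<partial>lborel)"
    by (rule integral_dominated_convergence[OF _ dc]) measurable
  then show "(\<integral>x. partial i f x \<partial>lborel) = 0"
    by (simp add: si LIMSEQ_const_iff)
qed

text \<open>\<open>D x 1\<close> is the radial derivative \<open>\<nabla>f \<bullet> x\<close>. The
  quotients of \<open>t \<mapsto> f(tx)\<close> at 1 have integrals computed by scaling, namely the
  quotients of \<open>t^(-s-d)\<close> times a constant, d being the dimension; the factor
  \<open>-(s + d)\<close> is the derivative of that power at 1. The interval from 1 to 2 contains
  all mean value points, since the increments are at most 1.\<close>

lemma integral_euler_homogeneous: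
  fixes f :: "'a::euclidean_space \<Rightarrow> real" and s :: real
  assumes [measurable]: "f \<in> borel_measurable borel"
    and fi: "integrable lborel (\<lambda>x. norm x powr s * f x)"
    and gi: "integrable lborel g"
    and D: "\<And>x t. x \<noteq> 0 \<Longrightarrow> 1 \<le> t \<Longrightarrow> t \<le> 2 \<Longrightarrow> ((\<lambda>t. f (t *\<^sub>R x)) has_real_derivative D x t) (at t)"
    and g: "\<And>x t. x \<noteq> 0 \<Longrightarrow> 1 \<le> t \<Longrightarrow> t \<le> 2 \<Longrightarrow> norm x powr s * \<bar>D x t\<bar> \<le> g x"
  shows "integrable lborel (\<lambda>x. norm x powr s * D x 1)"
    and "(\<integral>x. norm x powr s * D x 1 \<partial>lborel) = - (s + real DIM('a)) * (\<integral>x. norm x powr s * f x \<partial>lborel)"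
proof -
  define h where "h k = 1 / real (Suc k)" for k
  have h: "0 < h k" "h k \<le> 1" for k by (auto simp: h_def)
  have h0: "h \<longlonglongrightarrow> 0" unfolding h_def by (rule LIMSEQ_Suc[OF lim_1_over_n])
  have hat: "filterlim h (at 0) sequentially"
    using h0 h(1) by (auto simp: filterlim_at less_imp_neq[symmetric])
  define I where "I = (\<integral>x. norm x powr s * f x \<partial>lborel)"
  define S where "S k x = norm x powr s * ((f ((1 + h k) *\<^sub>R x) - f x) / h k)" for k x
  have lim: "(\<lambda>k. S k x) \<longlonglongrightarrow> norm x powr s * D x 1" for x
  \<comment> \<open>At the origin both sides are 0, because \<open>0 powr s = 0\<close>.\<close>
  proof (cases "x = 0")
    case False
    have "((\<lambda>t. (f ((1 + t) *\<^sub>R x) - f (1 *\<^sub>R x)) / t) \<longlongrightarrow> D x 1) (at 0)"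
      using D[OF False, of 1] by (simp add: DERIV_def)
    from filterlim_compose[OF this hat]
    have "(\<lambda>k. (f ((1 + h k) *\<^sub>R x) - f x) / h k) \<longlonglongrightarrow> D x 1" by simp
    then show ?thesis unfolding S_def by (rule tendsto_mult_left)
  qed (simp add: S_def)
  have sm: "S k \<in> borel_measurable lborel" for k unfolding S_def by measurable
  have Dm: "(\<lambda>x. norm x powr s * D x 1) \<in> borel_measurable lborel"
    by (rule borel_measurable_LIMSEQ_real[OF lim sm])
  have bound: "AE x in lborel. norm (S k x) \<le> g x" for k
    using AE_lborel_singleton[of "0::'a"]
  proof eventually_elim
    case (elim x)
    obtain z where z: "1 < z" "z < 1 + h k"
      "f ((1 + h k) *\<^sub>R x) - f (1 *\<^sub>R x) = (1 + h k - 1) * D x z"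
      using MVT2[of 1 "1 + h k" "\<lambda>t. f (t *\<^sub>R x)" "D x"] D[OF elim] h[of k]
      by (smt (verit, best))
    then have "S k x = norm x powr s * D x z" using h(1)[of k] by (simp add: S_def)
    then show ?case using g[OF elim, of z] z h(2)[of k] by (simp add: abs_mult)
  qed
  have Si: "(\<integral>x. S k x \<partial>lborel) = (((1 + h k) powr (- s - real DIM('a)) - 1) / h k) * I" for k
  proof -
    have p: "1 + h k > 0" using h(1)[of k] by simp
    \<comment> \<open>Moving the weight to the dilated point makes the integrand a dilate of
      \<open>|x|^s f(x)\<close>, to which the scaling identity applies.\<close>
    have eq: "norm x powr s * f ((1 + h k) *\<^sub>R x)
        = (1 + h k) powr (- s) * (norm ((1 + h k) *\<^sub>R x) powr s * f ((1 + h k) *\<^sub>R x))" for x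
      using p by (simp add: powr_mult powr_minus)
    note sc = integral_lborel_scale[OF fi p]
    have i1: "integrable lborel (\<lambda>x. norm x powr s * f ((1 + h k) *\<^sub>R x))"
      unfolding eq using sc(1) by (intro integrable_mult_right) simp
    have "(\<integral>x. norm x powr s * f ((1 + h k) *\<^sub>R x) \<partial>lborel)
      = (1 + h k) powr (- s) * (\<integral>x. norm ((1 + h k) *\<^sub>R x) powr s * f ((1 + h k) *\<^sub>R x) \<partial>lborel)"
      unfolding eq by simp
    also have "\<dots> = (1 + h k) powr (- s) * (I / (1 + h k) ^ DIM('a))"
      unfolding I_def using sc(2) p by simp
    also have "\<dots> = (1 + h k) powr (- s - real DIM('a)) * I"
      using p by (simp add: powr_diff powr_realpow)
    finally have i2: "(\<integral>x. norm x powr s * f ((1 + h k) *\<^sub>R x) \<partial>lborel) = (1 + h k) powr (- s - real DIM('a)) * I" .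
    have "(\<integral>x. S k x \<partial>lborel) = (\<integral>x. (norm x powr s * f ((1 + h k) *\<^sub>R x) - norm x powr s * f x) / h k \<partial>lborel)"
      by (simp add: S_def algebra_simps)
    also have "\<dots> = ((1 + h k) powr (- s - real DIM('a)) * I - I) / h k"
      using i1 fi by (simp add: i2 I_def)
    finally show ?thesis by (simp add: algebra_simps)
  qed
  note dc = sm gi AE_I2[OF lim] bound
  show "integrable lborel (\<lambda>x. norm x powr s * D x 1)"
    by (rule integrable_dominated_convergence[OF Dm dc])
  have 1: "(\<lambda>k. \<integral>x. S k x \<partial>lborel) \<longlonglongrightarrow> (\<integral>x. norm x powr s * D x 1 \<partial>lborel)"
    by (rule integral_dominated_convergence[OF Dm dc])
  have "((\<lambda>t. t powr (- s - real DIM('a))) has_real_derivative (- s - real DIM('a)) * 1 powr (- s - real DIM('a) - 1)) (at 1)"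
    by (rule has_real_derivative_powr) simp
  then have "((\<lambda>t. ((1 + t) powr (- s - real DIM('a)) - 1) / t) \<longlongrightarrow> - (s + real DIM('a))) (at 0)"
    by (simp add: DERIV_def)
  from tendsto_mult_right[OF filterlim_compose[OF this hat], of I]
  have 2: "(\<lambda>k. \<integral>x. S k x \<partial>lborel) \<longlonglongrightarrow> - (s + real DIM('a)) * I"
    unfolding Si .
  show "(\<integral>x. norm x powr s * D x 1 \<partial>lborel) = - (s + real DIM('a)) * (\<integral>x. norm x powr s * f x \<partial>lborel)"
    using LIMSEQ_unique[OF 1 2] by (simp add: I_def)
qed

section \<open>Symmetry of second partial derivatives\<close>

lemma second_difference_mean_value:
  fixes f :: "real^'n::finite \<Rightarrow> real"
  assumes f: "\<And>x. f differentiable (at x)" "\<And>x. partial i f differentiable (at x)" and h: "h > 0"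
  obtains y where "norm (y - x) \<le> 2 * h"
    "f (x + h *\<^sub>R axis i 1 + h *\<^sub>R axis j 1) - f (x + h *\<^sub>R axis i 1) - f (x + h *\<^sub>R axis j 1) + f x
      = h\<^sup>2 * partial j (partial i f) y"
proof -
  let ?i = "axis i 1 :: real^'n" and ?j = "axis j 1 :: real^'n"
  have li: "((\<lambda>t. f (a + t *\<^sub>R ?i)) has_real_derivative partial i f (a + t *\<^sub>R ?i)) (at t)" for a t
    using has_real_derivative_along_line[of f a t ?i] f(1) by (simp add: grad_inner_axis)
  have lj: "((\<lambda>t. partial i f (a + t *\<^sub>R ?j)) has_real_derivative partial j (partial i f) (a + t *\<^sub>R ?j)) (at t)" for a t
    using has_real_derivative_along_line[of "partial i f" a t ?j] f(2) by (simp add: grad_inner_axis)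
  \<comment> \<open>The second difference is an increment of \<open>\<phi>\<close> over
    \<open>[0, h]\<close>. The mean value theorem in direction i turns it into a first difference of
    \<open>partial i f\<close> in direction j, and a second application in direction j
    finishes.\<close>
  define \<phi> where "\<phi> s = f ((x + h *\<^sub>R ?j) + s *\<^sub>R ?i) - f (x + s *\<^sub>R ?i)" for s
  have d\<phi>: "(\<phi> has_real_derivative (partial i f ((x + h *\<^sub>R ?j) + s *\<^sub>R ?i) - partial i f (x + s *\<^sub>R ?i))) (at s)" for s
    unfolding \<phi>_def by (intro DERIV_diff li)
  obtain \<xi> where \<xi>: "0 < \<xi>" "\<xi> < h"
    "\<phi> h - \<phi> 0 = (h - 0) * (partial i f ((x + h *\<^sub>R ?j) + \<xi> *\<^sub>R ?i) - partial i f (x + \<xi> *\<^sub>R ?i))"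
    using MVT2[OF h d\<phi>] by blast
  obtain \<eta> where \<eta>: "0 < \<eta>" "\<eta> < h"
    "partial i f ((x + \<xi> *\<^sub>R ?i) + h *\<^sub>R ?j) - partial i f ((x + \<xi> *\<^sub>R ?i) + 0 *\<^sub>R ?j)
      = (h - 0) * partial j (partial i f) ((x + \<xi> *\<^sub>R ?i) + \<eta> *\<^sub>R ?j)"
    using MVT2[OF h lj[of "x + \<xi> *\<^sub>R ?i"]] by blast
  show thesis
  proof (rule that)
    have "norm (\<xi> *\<^sub>R ?i + \<eta> *\<^sub>R ?j) \<le> norm (\<xi> *\<^sub>R ?i) + norm (\<eta> *\<^sub>R ?j)"
      by (rule norm_triangle_ineq)
    also have "\<dots> \<le> 2 * h" using \<xi> \<eta> by simp
    finally show "norm (((x + \<xi> *\<^sub>R ?i) + \<eta> *\<^sub>R ?j) - x) \<le> 2 * h" by (simp add: add.assoc)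
    have "\<phi> h - \<phi> 0 = h * (h * partial j (partial i f) ((x + \<xi> *\<^sub>R ?i) + \<eta> *\<^sub>R ?j))"
      using \<xi>(3) \<eta>(3) by (simp add: add_ac)
    then show "f (x + h *\<^sub>R ?i + h *\<^sub>R ?j) - f (x + h *\<^sub>R ?i) - f (x + h *\<^sub>R ?j) + f x
      = h\<^sup>2 * partial j (partial i f) ((x + \<xi> *\<^sub>R ?i) + \<eta> *\<^sub>R ?j)"
      by (simp add: \<phi>_def power2_eq_square add_ac)
  qed
qed

text \<open>The second difference is symmetric in i and j, so it equals \<open>h\<^sup>2\<close>
  times either mixed derivative, each at some point near x; continuity at x then identifies the two.
  The Pohozaev identity needs this to cancel its mixed terms.\<close>

lemma partial_commute:
  fixes f :: "real^'n::finite \<Rightarrow> real"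
  assumes f: "\<And>x. f differentiable (at x)"
    and i: "C1 (partial i f)" and j: "C1 (partial j f)"
  shows "partial j (partial i f) x = partial i (partial j f) x"
proof (rule ccontr)
  assume ne: "partial j (partial i f) x \<noteq> partial i (partial j f) x"
  define e where "e = \<bar>partial j (partial i f) x - partial i (partial j f) x\<bar> / 2"
  have e: "e > 0" using ne by (simp add: e_def)
  have ci: "isCont (partial j (partial i f)) x" and cj: "isCont (partial i (partial j f)) x"
    using i j by (auto simp: C1_def continuous_on_eq_continuous_at)
  obtain d where d: "d > 0" "\<And>y. dist y x < d \<Longrightarrow> dist (partial j (partial i f) y) (partial j (partial i f) x) < e"
    using ci e unfolding continuous_at_eps_delta by blast
  obtain d' where d': "d' > 0" "\<And>y. dist y x < d' \<Longrightarrow> dist (partial i (partial j f) y) (partial i (partial j f) x) < e"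
    using cj e unfolding continuous_at_eps_delta by blast
  \<comment> \<open>The intermediate points are only known to lie within \<open>2 * h\<close> of x,
    which must be less than both radii.\<close>
  define h where "h = min d d' / 3"
  have h: "h > 0" "2 * h < d" "2 * h < d'" using d(1) d'(1) by (auto simp: h_def min_def)
  obtain y where y: "norm (y - x) \<le> 2 * h"
    "f (x + h *\<^sub>R axis i 1 + h *\<^sub>R axis j 1) - f (x + h *\<^sub>R axis i 1) - f (x + h *\<^sub>R axis j 1) + f x
      = h\<^sup>2 * partial j (partial i f) y"
    using second_difference_mean_value[OF f C1_D(1)[OF i] h(1)] by blast
  obtain z where z: "norm (z - x) \<le> 2 * h"
    "f (x + h *\<^sub>R axis j 1 + h *\<^sub>R axis i 1) - f (x + h *\<^sub>R axis j 1) - f (x + h *\<^sub>R axis i 1) + f x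
      = h\<^sup>2 * partial i (partial j f) z"
    using second_difference_mean_value[OF f C1_D(1)[OF j] h(1)] by blast
  have "x + h *\<^sub>R axis i 1 + h *\<^sub>R axis j 1 = x + h *\<^sub>R axis j 1 + h *\<^sub>R axis i 1"
    by (simp only: add_ac)
  then have "f (x + h *\<^sub>R axis i 1 + h *\<^sub>R axis j 1) = f (x + h *\<^sub>R axis j 1 + h *\<^sub>R axis i 1)"
    by (rule arg_cong)
  with y(2) z(2) have "h\<^sup>2 * partial j (partial i f) y = h\<^sup>2 * partial i (partial j f) z"
    by linarith
  then have "partial j (partial i f) y = partial i (partial j f) z" using h by simp
  moreover have "dist (partial j (partial i f) y) (partial j (partial i f) x) < e"
    using d(2)[of y] y(1) h by (simp add: dist_norm)
  moreover have "dist (partial i (partial j f) z) (partial i (partial j f) x) < e"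
    using d'(2)[of z] z(1) h by (simp add: dist_norm)
  ultimately show False unfolding dist_real_def e_def by argo
qed

section \<open>The inequality\<close>

text \<open>On a bounded region outside the unit ball an arbitrary admissible power is traded for
  the exponent \<open>- d - 1\<close>, the form that the comparison at infinity asks for.\<close>

lemma norm_powr_le_outside:
  assumes "1 < norm x" "norm x \<le> R" "s > - d"
  shows "norm x powr s \<le> R powr (s + d + 1) * norm x powr (- d - 1)"
proof -
  have "norm x powr s = norm x powr (s + d + 1) * norm x powr (- d - 1)"
    by (simp flip: powr_add)
  also have "\<dots> \<le> R powr (s + d + 1) * norm x powr (- d - 1)"
    using assms by (intro mult_right_mono powr_mono2) auto
  finally show ?thesis .
qed

lemma integrable_norm_powr_mult:
  fixes f :: "'a::euclidean_space \<Rightarrow> real"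
  assumes [measurable]: "f \<in> borel_measurable borel" and s: "s > - real DIM('a)"
    and f: "\<And>x. \<bar>f x\<bar> \<le> C * indicator (cball 0 R) x" and C: "C \<ge> 0"
  shows "integrable lborel (\<lambda>x. norm x powr s * f x)"
\<comment> \<open>One constant serves both zones: \<open>C\<close> is enough in the unit ball,
  \<open>C * R powr (s + d + 1)\<close> outside it, where d is the dimension.\<close>
proof (rule integrable_norm_powr_bound[where s = s and t = "- real DIM('a) - 1" and C = "C * (1 + R powr (s + real DIM('a) + 1))"])
  fix x :: 'a
  have fC: "\<bar>f x\<bar> \<le> C"
    using f[of x] C by (cases "x \<in> cball 0 R") (simp_all del: mem_cball)
  show "\<bar>norm x powr s * f x\<bar> \<le> C * (1 + R powr (s + real DIM('a) + 1)) * norm x powr s"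
  proof -
    have "\<bar>f x\<bar> \<le> C * (1 + R powr (s + real DIM('a) + 1))"
      using fC C by (rule_tac order_trans[OF _ mult_left_mono[of 1]]) auto
    from mult_right_mono[OF this, of "norm x powr s"] show ?thesis
      by (simp add: abs_mult mult.commute)
  qed
  assume x: "norm x > 1"
  show "\<bar>norm x powr s * f x\<bar> \<le> C * (1 + R powr (s + real DIM('a) + 1)) * norm x powr (- real DIM('a) - 1)"
  proof (cases "norm x \<le> R")
    case True
    have "norm x powr s * \<bar>f x\<bar> \<le> (R powr (s + real DIM('a) + 1) * norm x powr (- real DIM('a) - 1)) * C"
      using fC norm_powr_le_outside[OF x True s] by (intro mult_mono) auto
    also have "\<dots> \<le> C * (1 + R powr (s + real DIM('a) + 1)) * norm x powr (- real DIM('a) - 1)"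
      using C by (simp add: algebra_simps)
    finally show ?thesis by (simp add: abs_mult)
  next
    case False
    then have "f x = 0" using f[of x] by simp
    then show ?thesis using C by simp
  qed
qed (use s in auto)

lemma integrable_norm_powr_mult_continuous:
  fixes f :: "'a::euclidean_space \<Rightarrow> real"
  assumes f: "continuous_on UNIV f" "\<And>x. norm x > R \<Longrightarrow> f x = 0" and s: "s > - real DIM('a)"
  shows "integrable lborel (\<lambda>x. norm x powr s * f x)"
proof -
  obtain C where "C \<ge> 0" "\<And>x. \<bar>f x\<bar> \<le> C * indicator (cball 0 R) x"
    using bounded_if_compact_support[OF f] by blast
  then show ?thesis
    using s f(1) by (intro integrable_norm_powr_mult) (auto intro: borel_measurable_continuous_onI)
qed

lemma test_function_support:
  assumes "test_function f"
  obtains R where "\<And>x. norm x > R \<Longrightarrow> f x = 0"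
proof -
  have "bounded (closure {x. f x \<noteq> 0})"
    using assms compact_imp_bounded by (auto simp: test_function_def)
  then obtain R where "\<And>x. x \<in> closure {x. f x \<noteq> 0} \<Longrightarrow> norm x \<le> R"
    by (auto simp: bounded_iff)
  moreover have "x \<in> closure {x. f x \<noteq> 0}" if "f x \<noteq> 0" for x
    using that closure_subset[of "{x. f x \<noteq> 0}"] by auto
  ultimately have "f x = 0" if "norm x > R" for x
    using that by force
  then show thesis by (rule that)
qed

lemma test_function_differentiable:
  assumes "test_function f"
  shows "foldr partial is f differentiable (at x)"
  using assms by (auto simp: test_function_def differentiable_on_def)

lemma test_function_C1: "test_function f \<Longrightarrow> C1 f"
  unfolding C1_def
  using test_function_differentiable[of f "[]"] test_function_differentiable[of f "[_]"]
  by (auto intro!: continuous_at_imp_continuous_on differentiable_imp_continuous_within)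

lemma test_function_partial:
  assumes f: "test_function f"
  shows "test_function (partial i f)"
proof -
  have "foldr partial is (partial i f) differentiable_on UNIV" for "is"
  proof -
    \<comment> \<open>Appending i makes it the innermost derivative, so this is the iterated
      derivative \<open>is\<close> of \<open>partial i f\<close>.\<close>
    have "foldr partial (is @ [i]) f differentiable_on UNIV"
      using f unfolding test_function_def by blast
    then show ?thesis by simp
  qed
  moreover obtain R where R: "\<And>x. norm x > R \<Longrightarrow> f x = 0"
    using test_function_support[OF f] by blast
  have "{x. partial i f x \<noteq> 0} \<subseteq> cball 0 R"
  proof
    fix x assume "x \<in> {x. partial i f x \<noteq> 0}"
    then show "x \<in> cball 0 R" using partial_outside_support[of R f x i] R by force
  qed
  then have "compact (closure {x. partial i f x \<noteq> 0})"
    using bounded_subset[OF bounded_cball] by (simp add: compact_closure)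
  ultimately show ?thesis by (simp add: test_function_def)
qed

text \<open>Since \<open>div (\<nabla>u + |x|^{2\<alpha>} x u)\<close> vanishes for the extremal \<open>u = U0\<close>, pairing the Laplacian with
  \<open>V = \<nabla>u \<bullet> x + (n + 2\<alpha>) u = |x|^{-2\<alpha>} div (|x|^{2\<alpha>} x u)\<close> loses nothing.\<close>

context
  fixes u :: "real^'n::finite \<Rightarrow> real" and R \<alpha> n :: real
  assumes u: "test_function u" and R: "\<And>x. norm x > R \<Longrightarrow> u x = 0"
  defines "n \<equiv> real CARD('n)"
begin

private lemma C1u: "C1 u" and C1p: "C1 (partial i u)" and C1pp: "C1 (partial j (partial i u))"
  using u by (auto intro!: test_function_C1 test_function_partial)

private lemma Rp: "norm x > R \<Longrightarrow> partial i u x = 0" and Rpp: "norm x > R \<Longrightarrow> partial j (partial i u) x = 0"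
proof -
  show 1: "partial i u x = 0" if "norm x > R" for x i
    by (rule partial_outside_support[OF R that])
  show "partial j (partial i u) x = 0" if "norm x > R"
    by (rule partial_outside_support[OF 1 that])
qed

private lemma cont: "continuous_on UNIV u" "continuous_on UNIV (partial i u)"
    "continuous_on UNIV (partial j (partial i u))"
  using C1_D(2,3)[OF C1u, of UNIV] C1_D(2)[OF C1p, of UNIV] by auto

private lemma cont_lap: "continuous_on UNIV (laplacian u)"
  unfolding laplacian_def[abs_def] by (intro continuous_intros cont)

private lemma cont_grad: "continuous_on UNIV (grad u)"
  unfolding grad_def[abs_def] by (intro continuous_on_vec_lambda cont)

private lemma R_lap: "norm x > R \<Longrightarrow> laplacian u x = 0"
  by (simp add: laplacian_def Rpp)

private lemma R_grad: "norm x > R \<Longrightarrow> grad u x = 0"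
  by (simp add: grad_def Rp vec_eq_iff)

text \<open>The field \<open>u \<nabla>u\<close> has compact support and divergence
  \<open>u \<Delta>u + |\<nabla>u|^2\<close>.\<close>

private lemma green: "(\<integral>x. u x * laplacian u x \<partial>lborel) = - (\<integral>x. (norm (grad u x))\<^sup>2 \<partial>lborel)"
proof -
  let ?F = "\<lambda>i x. u x * partial i u x"
  have F: "C1 (?F i)" for i by (intro C1_mult C1u C1p)
  have F0: "?F i x = 0" if "norm x > R" for i x using R[OF that] by simp
  have pF: "partial i (?F i) x = u x * partial i (partial i u) x + (partial i u x)\<^sup>2" for i x
    using partial_mult[OF C1_D(1)[OF C1u] C1_D(1)[OF C1p]] by (simp add: power2_eq_square)
  have "(\<Sum>i\<in>UNIV. partial i (?F i) x) = u x * laplacian u x + (norm (grad u x))\<^sup>2" for x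
    by (simp add: pF laplacian_def sum.distrib sum_distrib_left norm_vec_def L2_set_def grad_def sum_nonneg)
  moreover have "(\<integral>x. (\<Sum>i\<in>UNIV. partial i (?F i) x) \<partial>lborel) = 0"
    using integral_partial_eq_0[OF F F0] by simp
  moreover have "integrable lborel (\<lambda>x. u x * laplacian u x)"
    by (rule integrable_if_compact_support[of _ R]) (auto intro!: continuous_intros cont cont_lap simp: R)
  moreover have "integrable lborel (\<lambda>x. (norm (grad u x))\<^sup>2)"
    by (rule integrable_if_compact_support[of _ R]) (auto intro!: continuous_intros cont_grad simp: R_grad)
  ultimately show ?thesis by simp
qed

text \<open>With \<open>E = \<nabla>u \<bullet> x\<close>, the terms \<open>?P\<close> form the
  field \<open>E \<nabla>u\<close> and the terms \<open>?Q\<close> the field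
  \<open>|\<nabla>u|^2 x\<close>. Their divergences are \<open>E \<Delta>u + |\<nabla>u|^2 + x
  \<bullet> \<nabla>(|\<nabla>u|^2)/2\<close> and
  \<open>n |\<nabla>u|^2 + x \<bullet> \<nabla>(|\<nabla>u|^2)\<close>. Subtracting half of the
  second from the first removes the mixed derivatives and leaves
  \<open>E \<Delta>u + (1 - n/2) |\<nabla>u|^2\<close>.\<close>

private lemma pohozaev: "(\<integral>x. laplacian u x * (grad u x \<bullet> x) \<partial>lborel) = (n - 2) / 2 * (\<integral>x. (norm (grad u x))\<^sup>2 \<partial>lborel)"
proof -
  let ?P = "\<lambda>i j x. partial i u x * (x $ j * partial j u x)"
  let ?Q = "\<lambda>i j x. x $ j * (partial i u x * partial i u x)"
  have P: "C1 (?P i j)" and Q: "C1 (?Q i j)" for i j by (intro C1_mult C1p C1_component)+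
  have P0: "?P i j x = 0" and Q0: "?Q i j x = 0" if "norm x > R" for i j x using Rp[OF that] by simp_all
  have pP: "partial i (?P i j) x = partial i u x * (x $ j * partial i (partial j u) x)
      + (if i = j then (partial i u x)\<^sup>2 else 0) + partial i (partial i u) x * (x $ j * partial j u x)" for i j x
  proof -
    have "partial i (\<lambda>x. x $ j * partial j u x) x = x $ j * partial i (partial j u) x + (if i = j then 1 else 0) * partial j u x"
      using partial_mult[OF C1_D(1)[OF C1_component] C1_D(1)[OF C1p]] by (simp add: partial_component)
    moreover have "partial i (?P i j) x = partial i u x * partial i (\<lambda>x. x $ j * partial j u x) x
        + partial i (partial i u) x * (x $ j * partial j u x)"
      by (rule partial_mult[OF C1_D(1)[OF C1p] C1_D(1)[OF C1_mult[OF C1_component C1p]]])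
    ultimately show ?thesis by (simp add: power2_eq_square distrib_left)
  qed
  have pQ: "partial j (?Q i j) x = 2 * (partial i u x * (x $ j * partial j (partial i u) x)) + (partial i u x)\<^sup>2" for i j x
  proof -
    have "partial j (\<lambda>x. partial i u x * partial i u x) x = 2 * (partial i u x * partial j (partial i u) x)"
      using partial_mult[OF C1_D(1)[OF C1p] C1_D(1)[OF C1p]] by simp
    moreover have "partial j (?Q i j) x = x $ j * partial j (\<lambda>x. partial i u x * partial i u x) x
        + partial j (\<lambda>x. x $ j) x * (partial i u x * partial i u x)"
      by (rule partial_mult[OF C1_D(1)[OF C1_component] C1_D(1)[OF C1_mult[OF C1p C1p]]])
    ultimately show ?thesis by (simp add: power2_eq_square partial_component)
  qed
  have sym: "partial j (partial i u) x = partial i (partial j u) x" for i j x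
    by (rule partial_commute[OF C1_D(1)[OF C1u] C1p C1p])
  have "(\<Sum>i\<in>UNIV. \<Sum>j\<in>UNIV. partial i (?P i j) x - partial j (?Q i j) x / 2)
      = (\<Sum>i\<in>UNIV. \<Sum>j\<in>UNIV. (if i = j then (partial i u x)\<^sup>2 else 0)
          + partial i (partial i u) x * (x $ j * partial j u x) - (partial i u x)\<^sup>2 / 2)" for x
    unfolding pP pQ by (intro sum.cong refl) (simp add: sym[of _ _ x] field_simps)
  moreover have "(\<Sum>i\<in>UNIV. \<Sum>j\<in>UNIV. (if i = j then (partial i u x)\<^sup>2 else 0)
          + partial i (partial i u) x * (x $ j * partial j u x) - (partial i u x)\<^sup>2 / 2)
      = (norm (grad u x))\<^sup>2 + laplacian u x * (grad u x \<bullet> x) - n / 2 * (norm (grad u x))\<^sup>2" for x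
  proof -
    have 1: "(norm (grad u x))\<^sup>2 = (\<Sum>i\<in>UNIV. (partial i u x)\<^sup>2)"
      by (simp add: norm_vec_def L2_set_def grad_def sum_nonneg)
    have 2: "grad u x \<bullet> x = (\<Sum>j\<in>UNIV. x $ j * partial j u x)"
      by (simp add: inner_vec_def grad_def mult.commute)
    show ?thesis
      unfolding 1 2 laplacian_def sum_product
      by (simp add: sum.distrib sum_subtractf n_def flip: sum_distrib_left sum_divide_distrib)
  qed
  ultimately have "(\<integral>x. (\<Sum>i\<in>UNIV. \<Sum>j\<in>UNIV. partial i (?P i j) x - partial j (?Q i j) x / 2) \<partial>lborel)
     = (\<integral>x. (norm (grad u x))\<^sup>2 + laplacian u x * (grad u x \<bullet> x) - n / 2 * (norm (grad u x))\<^sup>2 \<partial>lborel)"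
    by simp
  moreover have "(\<integral>x. (\<Sum>i\<in>UNIV. \<Sum>j\<in>UNIV. partial i (?P i j) x - partial j (?Q i j) x / 2) \<partial>lborel) = 0"
    using integral_partial_eq_0[OF P P0] integral_partial_eq_0[OF Q Q0] by simp
  moreover have "integrable lborel (\<lambda>x. laplacian u x * (grad u x \<bullet> x))"
    by (rule integrable_if_compact_support[of _ R]) (auto intro!: continuous_intros cont_grad cont_lap simp: R_grad)
  moreover have "integrable lborel (\<lambda>x. (norm (grad u x))\<^sup>2)"
    by (rule integrable_if_compact_support[of _ R]) (auto intro!: continuous_intros cont_grad simp: R_grad)
  ultimately have "(\<integral>x. (norm (grad u x))\<^sup>2 \<partial>lborel) + (\<integral>x. laplacian u x * (grad u x \<bullet> x) \<partial>lborel)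
     - n / 2 * (\<integral>x. (norm (grad u x))\<^sup>2 \<partial>lborel) = 0" by simp
  then show ?thesis by (simp add: field_simps)
qed

text \<open>Expanding the square leaves, besides \<open>E^2\<close>, the terms
  \<open>m * 2 u E\<close> and \<open>m^2 u^2\<close> with \<open>m = n + 2\<alpha>\<close>. The
  Euler identity for \<open>u^2\<close> with \<open>s = 2\<alpha>\<close> makes the weighted
  integral of \<open>2 u E\<close> equal to \<open>-m\<close> times that of \<open>u^2\<close>, so
  they cancel.\<close>

private lemma weighted_square:
  assumes \<alpha>: "n + 2 * \<alpha> > 0"
  shows "(\<integral>x. norm x powr (2 * \<alpha>) * (grad u x \<bullet> x + (n + 2 * \<alpha>) * u x)\<^sup>2 \<partial>lborel)
    = (\<integral>x. norm x powr (2 * \<alpha>) * (grad u x \<bullet> x)\<^sup>2 \<partial>lborel)"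
proof -
  have s: "2 * \<alpha> > - real DIM(real^'n)" using \<alpha> by (simp add: n_def)
  have i: "integrable lborel (\<lambda>x. norm x powr (2 * \<alpha>) * (u x)\<^sup>2)"
    by (rule integrable_norm_powr_mult_continuous[of _ R, OF _ _ s]) (auto intro!: continuous_intros cont simp: R)
  have i2: "integrable lborel (\<lambda>x. norm x powr (2 * \<alpha>) * (grad u x \<bullet> x)\<^sup>2)"
    by (rule integrable_norm_powr_mult_continuous[of _ R, OF _ _ s]) (auto intro!: continuous_intros cont_grad simp: R_grad)
  obtain C where C: "C \<ge> 0" "\<And>x. \<bar>u x\<bar> \<le> C * indicator (cball 0 R) x"
    using bounded_if_compact_support[OF cont(1) R] by blast
  obtain C' where C': "C' \<ge> 0" "\<And>x. \<bar>grad u x \<bullet> x\<bar> \<le> C' * indicator (cball 0 R) x"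
  proof -
    have "continuous_on UNIV (\<lambda>x. grad u x \<bullet> x)" by (intro continuous_intros cont_grad)
    moreover have "grad u x \<bullet> x = 0" if "norm x > R" for x using R_grad[OF that] by simp
    ultimately show thesis using bounded_if_compact_support[of "\<lambda>x. grad u x \<bullet> x" R] that by blast
  qed
  define D where "D x t = 2 * u (t *\<^sub>R x) * (grad u (t *\<^sub>R x) \<bullet> x)" for x t
  have D: "((\<lambda>t. (u (t *\<^sub>R x))\<^sup>2) has_real_derivative D x t) (at t)" for x t
  proof -
    have "((\<lambda>t. u (t *\<^sub>R x)) has_real_derivative (grad u (t *\<^sub>R x) \<bullet> x)) (at t)"
      using has_real_derivative_along_line[of u 0 t x] C1_D(1)[OF C1u] by simp
    from DERIV_power[OF this, of 2] show ?thesis by (simp add: D_def mult_ac)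
  qed
  have gi: "integrable lborel (\<lambda>x::real^'n. norm x powr (2 * \<alpha>) * (2 * C * C' * indicator (cball 0 R) x))"
    using C(1) C'(1) by (intro integrable_norm_powr_mult[OF _ s, of _ "2 * C * C'" R]) (measurable, auto simp: abs_mult)
  \<comment> \<open>For \<open>t \<ge> 1\<close> the dilation moves points outward, so
    \<open>D x t\<close> vanishes once x lies outside the ball of radius R. Replacing x by
    \<open>t *\<^sub>R x\<close> in the inner product only enlarges it, which makes the bound
    \<open>C'\<close> on \<open>grad u y \<bullet> y\<close> applicable.\<close>
  have Db: "norm x powr (2 * \<alpha>) * \<bar>D x t\<bar> \<le> norm x powr (2 * \<alpha>) * (2 * C * C' * indicator (cball 0 R) x)"
    if "1 \<le> t" for x t
  proof (rule mult_left_mono)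
    have "norm x \<le> norm (t *\<^sub>R x)" using that by (simp add: mult_le_cancel_right1)
    show "\<bar>D x t\<bar> \<le> 2 * C * C' * indicator (cball 0 R) x"
    proof (cases "norm x \<le> R")
      case False
      then have "u (t *\<^sub>R x) = 0" using \<open>norm x \<le> norm (t *\<^sub>R x)\<close> by (intro R) simp
      then show ?thesis using False by (simp add: D_def)
    next
      case True
      have "\<bar>grad u (t *\<^sub>R x) \<bullet> x\<bar> \<le> t * \<bar>grad u (t *\<^sub>R x) \<bullet> x\<bar>"
        using that by (simp add: mult_le_cancel_right1)
      also have "\<dots> = \<bar>grad u (t *\<^sub>R x) \<bullet> (t *\<^sub>R x)\<bar>" using that by (simp add: abs_mult)
      also have "\<dots> \<le> C' * indicator (cball 0 R) (t *\<^sub>R x)" by (rule C'(2))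
      also have "\<dots> \<le> C' * 1" using C'(1) by (intro mult_left_mono) (auto simp: indicator_def)
      also have "\<dots> = C'" by simp
      finally have "\<bar>grad u (t *\<^sub>R x) \<bullet> x\<bar> \<le> C'" .
      moreover have "\<bar>u (t *\<^sub>R x)\<bar> \<le> C" using C(2)[of "t *\<^sub>R x"] C(1) by (cases "t *\<^sub>R x \<in> cball 0 R") (simp_all del: mem_cball)
      ultimately have "\<bar>u (t *\<^sub>R x)\<bar> * \<bar>grad u (t *\<^sub>R x) \<bullet> x\<bar> \<le> C * C'" using C(1) by (intro mult_mono) auto
      then show ?thesis using True by (simp add: D_def abs_mult)
    qed
  qed auto
  have um: "(\<lambda>x. (u x)\<^sup>2) \<in> borel_measurable borel"
    by (intro borel_measurable_continuous_onI continuous_intros cont)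
  note e = integral_euler_homogeneous[OF um i gi D Db]
  have D1: "D x 1 = 2 * (u x * (grad u x \<bullet> x))" for x by (simp add: D_def)
  let ?m = "n + 2 * \<alpha>"
  have "(\<integral>x. norm x powr (2 * \<alpha>) * (grad u x \<bullet> x + ?m * u x)\<^sup>2 \<partial>lborel)
    = (\<integral>x. norm x powr (2 * \<alpha>) * (grad u x \<bullet> x)\<^sup>2 + (?m * (norm x powr (2 * \<alpha>) * D x 1)
        + ?m\<^sup>2 * (norm x powr (2 * \<alpha>) * (u x)\<^sup>2)) \<partial>lborel)"
    by (intro Bochner_Integration.integral_cong refl) (simp add: D1 power2_eq_square algebra_simps)
  also have "\<dots> = (\<integral>x. norm x powr (2 * \<alpha>) * (grad u x \<bullet> x)\<^sup>2 \<partial>lborel) +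
      (?m * (\<integral>x. norm x powr (2 * \<alpha>) * D x 1 \<partial>lborel) + ?m\<^sup>2 * (\<integral>x. norm x powr (2 * \<alpha>) * (u x)\<^sup>2 \<partial>lborel))"
    using i i2 e(1) by simp
  also have "\<dots> = (\<integral>x. norm x powr (2 * \<alpha>) * (grad u x \<bullet> x)\<^sup>2 \<partial>lborel)"
    by (simp add: e(2)) (simp add: n_def power2_eq_square algebra_simps)
  finally show ?thesis .
qed

lemma test_function_integrable:
  shows "n - 2 * \<alpha> > 0 \<Longrightarrow> integrable lborel (\<lambda>x. (laplacian u x)\<^sup>2 * norm x powr (- 2 * \<alpha>))"
    and "n + 2 * \<alpha> > 0 \<Longrightarrow> integrable lborel (\<lambda>x. (grad u x \<bullet> x)\<^sup>2 * norm x powr (2 * \<alpha>))"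
    and "integrable lborel (\<lambda>x. (norm (grad u x))\<^sup>2)"
    and "laplacian u \<in> borel_measurable borel" "grad u \<in> borel_measurable borel"
proof -
  show "laplacian u \<in> borel_measurable borel" "grad u \<in> borel_measurable borel"
    by (intro borel_measurable_continuous_onI cont_lap cont_grad)+
  show "integrable lborel (\<lambda>x. (norm (grad u x))\<^sup>2)"
    by (rule integrable_if_compact_support[of _ R]) (auto intro!: continuous_intros cont_grad simp: R_grad)
  assume "n - 2 * \<alpha> > 0"
  then have s: "- 2 * \<alpha> > - real DIM(real^'n)" by (simp add: n_def)
  show "integrable lborel (\<lambda>x. (laplacian u x)\<^sup>2 * norm x powr (- 2 * \<alpha>))"
    by (subst mult.commute, rule integrable_norm_powr_mult_continuous[of _ R, OF _ _ s])
      (auto intro!: continuous_intros cont_lap simp: R_lap)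
next
  assume "n + 2 * \<alpha> > 0"
  then have s: "2 * \<alpha> > - real DIM(real^'n)" by (simp add: n_def)
  show "integrable lborel (\<lambda>x. (grad u x \<bullet> x)\<^sup>2 * norm x powr (2 * \<alpha>))"
    by (subst mult.commute, rule integrable_norm_powr_mult_continuous[of _ R, OF _ _ s])
      (auto intro!: continuous_intros cont_grad simp: R_grad)
qed

lemma test_function_CKN:
  assumes \<alpha>: "n - 2 * \<alpha> > 0" "n + 2 * \<alpha> > 0"
  shows "ennreal (((n + 4 * \<alpha> + 2) / 2)\<^sup>2) * (\<integral>\<^sup>+x. ennreal ((norm (grad u x))\<^sup>2) \<partial>lborel)\<^sup>2
    \<le> (\<integral>\<^sup>+x. ennreal ((laplacian u x)\<^sup>2 * norm x powr (- 2 * \<alpha>)) \<partial>lborel)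
      * (\<integral>\<^sup>+x. ennreal ((grad u x \<bullet> x)\<^sup>2 * norm x powr (2 * \<alpha>)) \<partial>lborel)"
proof -
  define V where "V x = grad u x \<bullet> x + (n + 2 * \<alpha>) * u x" for x
  define Dr where "Dr = (\<integral>x. (norm (grad u x))\<^sup>2 \<partial>lborel)"
  have contV: "continuous_on UNIV V" unfolding V_def[abs_def] by (intro continuous_intros cont cont_grad)
  have RV: "V x = 0" if "norm x > R" for x using that by (simp add: V_def R R_grad)
  have [measurable]: "V \<in> borel_measurable borel" "laplacian u \<in> borel_measurable borel" "grad u \<in> borel_measurable borel"
    using test_function_integrable contV by (auto intro: borel_measurable_continuous_onI)
  have iu: "integrable lborel (\<lambda>x. u x * laplacian u x)"
    by (rule integrable_if_compact_support[of _ R]) (auto intro!: continuous_intros cont cont_lap simp: R)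
  have iE: "integrable lborel (\<lambda>x. laplacian u x * (grad u x \<bullet> x))"
    by (rule integrable_if_compact_support[of _ R]) (auto intro!: continuous_intros cont_grad cont_lap simp: R_grad)
  have iLV: "integrable lborel (\<lambda>x. laplacian u x * V x)"
    by (rule integrable_if_compact_support[of _ R]) (auto intro!: continuous_intros contV cont_lap simp: RV)
  have "(\<integral>x. laplacian u x * V x \<partial>lborel)
    = (\<integral>x. laplacian u x * (grad u x \<bullet> x) + (n + 2 * \<alpha>) * (u x * laplacian u x) \<partial>lborel)"
    by (intro Bochner_Integration.integral_cong refl) (simp add: V_def algebra_simps)
  \<comment> \<open>The constant of the theorem is \<open>(n + 2\<alpha>) - (n - 2)/2\<close>:
    Green's identity contributes the first number, the Pohozaev identity the second.\<close>
  also have "\<dots> = - ((n + 4 * \<alpha> + 2) / 2) * Dr"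
  proof -
    have "(\<integral>x. laplacian u x * (grad u x \<bullet> x) + (n + 2 * \<alpha>) * (u x * laplacian u x) \<partial>lborel)
      = (\<integral>x. laplacian u x * (grad u x \<bullet> x) \<partial>lborel) + (n + 2 * \<alpha>) * (\<integral>x. u x * laplacian u x \<partial>lborel)"
      using iu iE by simp
    then show ?thesis by (simp only: green pohozaev Dr_def[symmetric]) (simp add: field_simps)
  qed
  finally have LV: "(\<integral>x. laplacian u x * V x \<partial>lborel) = - ((n + 4 * \<alpha> + 2) / 2) * Dr" .
  have Dr: "(\<integral>\<^sup>+x. ennreal ((norm (grad u x))\<^sup>2) \<partial>lborel) = ennreal Dr" "Dr \<ge> 0"
    unfolding Dr_def using test_function_integrable(3) by (auto intro!: nn_integral_eq_integral)
  have B: "(\<integral>\<^sup>+x. ennreal ((grad u x \<bullet> x)\<^sup>2 * norm x powr (2 * \<alpha>)) \<partial>lborel) = (\<integral>\<^sup>+x. ennreal (norm x powr (2 * \<alpha>) * (V x)\<^sup>2) \<partial>lborel)"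
  proof -
    have s: "2 * \<alpha> > - real DIM(real^'n)" using \<alpha> by (simp add: n_def)
    have "integrable lborel (\<lambda>x. norm x powr (2 * \<alpha>) * (V x)\<^sup>2)"
      by (rule integrable_norm_powr_mult_continuous[of _ R, OF _ _ s]) (auto intro!: continuous_intros contV simp: RV)
    then have "(\<integral>\<^sup>+x. ennreal (norm x powr (2 * \<alpha>) * (V x)\<^sup>2) \<partial>lborel) = ennreal (\<integral>x. norm x powr (2 * \<alpha>) * (V x)\<^sup>2 \<partial>lborel)"
      by (intro nn_integral_eq_integral) auto
    also have "\<dots> = ennreal (\<integral>x. (grad u x \<bullet> x)\<^sup>2 * norm x powr (2 * \<alpha>) \<partial>lborel)"
      using weighted_square[OF \<alpha>(2)] by (simp add: V_def mult.commute)
    also have "\<dots> = (\<integral>\<^sup>+x. ennreal ((grad u x \<bullet> x)\<^sup>2 * norm x powr (2 * \<alpha>)) \<partial>lborel)"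
      using test_function_integrable(2)[OF \<alpha>(2)] by (intro nn_integral_eq_integral[symmetric]) auto
    finally show ?thesis ..
  qed
  have "ennreal (((n + 4 * \<alpha> + 2) / 2)\<^sup>2) * (\<integral>\<^sup>+x. ennreal ((norm (grad u x))\<^sup>2) \<partial>lborel)\<^sup>2
    = ennreal \<bar>\<integral>x. laplacian u x * V x \<partial>lborel\<bar> ^ 2"
  proof -
    have "\<bar>- ((n + 4 * \<alpha> + 2) / 2) * Dr\<bar>\<^sup>2 = ((n + 4 * \<alpha> + 2) / 2)\<^sup>2 * Dr\<^sup>2"
      by (simp only: power2_abs power_mult_distrib power2_minus)
    then show ?thesis using Dr(2) by (simp only: Dr(1) LV ennreal_power abs_ge_zero ennreal_mult zero_le_power2)
  qed
  also have "\<dots> \<le> (\<integral>\<^sup>+x. ennreal \<bar>laplacian u x * V x\<bar> \<partial>lborel)\<^sup>2"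
    using integral_norm_bound_ennreal[OF iLV] by (intro power_mono) simp_all
  \<comment> \<open>The split \<open>1 = |x|^(-\<alpha>) |x|^\<alpha>\<close> fails at the origin,
    where \<open>powr\<close> gives 0; hence equality almost everywhere only.\<close>
  also have "(\<integral>\<^sup>+x. ennreal \<bar>laplacian u x * V x\<bar> \<partial>lborel)
      = (\<integral>\<^sup>+x. ennreal (\<bar>laplacian u x\<bar> * norm x powr (- \<alpha>)) * ennreal (norm x powr \<alpha> * \<bar>V x\<bar>) \<partial>lborel)"
    using AE_lborel_singleton[of "0::real^'n"]
    by (intro nn_integral_cong_AE, elim AE_mp, intro AE_I2 impI)
       (simp add: powr_minus abs_mult flip: ennreal_mult)
  also have "\<dots>\<^sup>2 \<le> (\<integral>\<^sup>+x. (ennreal (\<bar>laplacian u x\<bar> * norm x powr (- \<alpha>)))\<^sup>2 \<partial>lborel)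
      * (\<integral>\<^sup>+x. (ennreal (norm x powr \<alpha> * \<bar>V x\<bar>))\<^sup>2 \<partial>lborel)"
    by (rule Cauchy_Schwarz_nn_integral) measurable
  also have "\<dots> = (\<integral>\<^sup>+x. ennreal ((laplacian u x)\<^sup>2 * norm x powr (- 2 * \<alpha>)) \<partial>lborel)
      * (\<integral>\<^sup>+x. ennreal (norm x powr (2 * \<alpha>) * (V x)\<^sup>2) \<partial>lborel)"
  proof -
    have "(norm x powr a)\<^sup>2 = norm x powr (2 * a)" for x :: "real^'n" and a
      by (simp add: power2_eq_square flip: powr_add)
    from this[of _ "- \<alpha>"] this[of _ \<alpha>] show ?thesis
      by (simp add: ennreal_power power_mult_distrib)
  qed
  finally show ?thesis unfolding B .
qed

end


section \<open>Passage to the completion\<close>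

lemma nn_integral_weighted_square_le:
  fixes f g w :: "'a \<Rightarrow> real"
  assumes [measurable]: "f \<in> borel_measurable M" "g \<in> borel_measurable M" "w \<in> borel_measurable M"
    and w: "\<And>x. w x \<ge> 0" and d: "d > 0"
  shows "(\<integral>\<^sup>+x. ennreal ((f x)\<^sup>2 * w x) \<partial>M) \<le> ennreal (1 + d) * (\<integral>\<^sup>+x. ennreal ((g x)\<^sup>2 * w x) \<partial>M)
    + ennreal (1 + 1 / d) * (\<integral>\<^sup>+x. ennreal ((f x - g x)\<^sup>2 * w x) \<partial>M)"
proof -
  have "(f x)\<^sup>2 * w x \<le> (1 + d) * ((g x)\<^sup>2 * w x) + (1 + 1 / d) * ((f x - g x)\<^sup>2 * w x)" for x
  proof -
    define a where "a = f x - g x"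
    \<comment> \<open>Young's inequality \<open>2 g a \<le> d g^2 + a^2/d\<close> with the error
      \<open>a = f - g\<close>. A small d brings the coefficient of \<open>g^2\<close> close to 1,
      so that passing to the limit loses nothing.\<close>
    have "0 \<le> (d * g x - a)\<^sup>2 / d" using d by simp
    also have "\<dots> = d * (g x)\<^sup>2 - 2 * (g x * a) + a\<^sup>2 / d"
      using d by (simp add: power2_eq_square field_simps)
    finally have "0 \<le> d * (g x)\<^sup>2 - 2 * (g x * a) + a\<^sup>2 / d" .
    moreover have "(f x)\<^sup>2 = (g x)\<^sup>2 + 2 * (g x * a) + a\<^sup>2"
      unfolding a_def by (simp add: power2_eq_square algebra_simps)
    ultimately have "(f x)\<^sup>2 \<le> (1 + d) * (g x)\<^sup>2 + (1 + 1 / d) * a\<^sup>2"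
      by (simp add: distrib_right)
    then have "(f x)\<^sup>2 \<le> (1 + d) * (g x)\<^sup>2 + (1 + 1 / d) * (f x - g x)\<^sup>2"
      unfolding a_def .
    from mult_right_mono[OF this w[of x]] show ?thesis by (simp add: algebra_simps)
  qed
  then have "(\<integral>\<^sup>+x. ennreal ((f x)\<^sup>2 * w x) \<partial>M) \<le>
     (\<integral>\<^sup>+x. ennreal (1 + d) * ennreal ((g x)\<^sup>2 * w x) + ennreal (1 + 1 / d) * ennreal ((f x - g x)\<^sup>2 * w x) \<partial>M)"
    using d w by (intro nn_integral_mono) (simp flip: ennreal_mult ennreal_plus)
  then show ?thesis by (simp add: nn_integral_add nn_integral_cmult)
qed

text \<open>A one-sided form of the continuity of the norm: the left-hand factors of the inequality
  only have to be bounded from above along the sequence. Finiteness for the limit follows from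
  Young's inequality with d = 1 at a single index.\<close>

lemma weighted_square_limit:
  fixes f :: "nat \<Rightarrow> 'a \<Rightarrow> real" and g w :: "'a \<Rightarrow> real"
  assumes [measurable]: "\<And>k. f k \<in> borel_measurable M" "g \<in> borel_measurable M" "w \<in> borel_measurable M"
    and w: "\<And>x. w x \<ge> 0"
    and fin: "\<And>k. (\<integral>\<^sup>+x. ennreal ((f k x)\<^sup>2 * w x) \<partial>M) < \<infinity>"
    and lim: "(\<lambda>k. \<integral>\<^sup>+x. ennreal ((f k x - g x)\<^sup>2 * w x) \<partial>M) \<longlonglongrightarrow> 0"
  obtains G where "G \<ge> 0" "(\<integral>\<^sup>+x. ennreal ((g x)\<^sup>2 * w x) \<partial>M) = ennreal G"
    "\<And>e. e > 0 \<Longrightarrow> eventually (\<lambda>k. (\<integral>\<^sup>+x. ennreal ((f k x)\<^sup>2 * w x) \<partial>M) \<le> ennreal (G + e)) sequentially"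
proof -
  define E where "E k = (\<integral>\<^sup>+x. ennreal ((f k x - g x)\<^sup>2 * w x) \<partial>M)" for k
  have ev: "eventually (\<lambda>k. E k < ennreal e) sequentially" if "e > 0" for e
    using order_tendstoD(2)[OF lim, of "ennreal e"] that by (simp add: E_def)
  obtain k where k: "E k < ennreal 1"
    using ev[of 1] by (auto simp: eventually_sequentially)
  have "(\<integral>\<^sup>+x. ennreal ((g x)\<^sup>2 * w x) \<partial>M) \<le> ennreal (1 + 1) * (\<integral>\<^sup>+x. ennreal ((f k x)\<^sup>2 * w x) \<partial>M)
      + ennreal (1 + 1 / 1) * E k"
    using nn_integral_weighted_square_le[of g M "f k" w 1] w by (simp add: E_def power2_commute)
  also have "\<dots> < \<infinity>"
    using fin[of k] order_less_trans[OF k ennreal_less_top] by (auto simp: ennreal_mult_less_top)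
  finally obtain G where G: "G \<ge> 0" "(\<integral>\<^sup>+x. ennreal ((g x)\<^sup>2 * w x) \<partial>M) = ennreal G"
    by (auto simp: less_top_ennreal)
  show thesis
  proof (rule that[OF G])
    fix e :: real assume e: "e > 0"
    \<comment> \<open>The excess e is split in halves: \<open>d * G \<le> e / 2\<close>, with
      \<open>G + 1\<close> in the denominator because G may be 0, and the other half is left for the
      error term.\<close>
    define d where "d = e / (2 * (G + 1))"
    have d: "d > 0" using e G by (simp add: d_def)
    have dG: "d * G \<le> e / 2" using e G by (simp add: d_def field_simps)
    have e': "e / (2 * (1 + 1 / d)) > 0" using e d by (simp add: add_pos_pos)
    from ev[OF e'] show "eventually (\<lambda>k. (\<integral>\<^sup>+x. ennreal ((f k x)\<^sup>2 * w x) \<partial>M) \<le> ennreal (G + e)) sequentially"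
    proof eventually_elim
      case (elim k)
      have "(\<integral>\<^sup>+x. ennreal ((f k x)\<^sup>2 * w x) \<partial>M) \<le> ennreal (1 + d) * ennreal G + ennreal (1 + 1 / d) * E k"
        using nn_integral_weighted_square_le[of "f k" M g w d] w d by (simp only: E_def G) simp
      also have "\<dots> \<le> ennreal (1 + d) * ennreal G + ennreal (1 + 1 / d) * ennreal (e / (2 * (1 + 1 / d)))"
        using elim by (intro add_left_mono mult_left_mono) auto
      also have "\<dots> = ennreal ((1 + d) * G + (1 + 1 / d) * (e / (2 * (1 + 1 / d))))"
      proof -
        have "ennreal p * ennreal q + ennreal r * ennreal t = ennreal (p * q + r * t)"
          if "0 \<le> p" "0 \<le> q" "0 \<le> r" "0 \<le> t" for p q r t
          using that by (simp add: ennreal_mult)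
        note sum = this
        show ?thesis by (rule sum) (use d G(1) e' in \<open>auto simp: add_pos_pos\<close>)
      qed
      also have "(1 + 1 / d) * (e / (2 * (1 + 1 / d))) = e / 2"
      proof -
        have half: "q * (e / (2 * q)) = e / 2" if "q > 0" for q :: real using that by simp
        show ?thesis by (rule half) (use d in \<open>simp add: add_pos_pos\<close>)
      qed
      also have "ennreal ((1 + d) * G + e / 2) \<le> ennreal (G + e)"
        using dG by (intro ennreal_leI) (simp add: algebra_simps)
      finally show ?case .
    qed
  qed
qed

text \<open>Convergence is given with the weight, but the conclusion is about the unweighted
  integral. A subsequence converges almost everywhere after division by the positive weight, and
  Fatou's lemma needs no more than that.\<close>

lemma nn_integral_fatou_weighted:
  fixes f :: "nat \<Rightarrow> 'a \<Rightarrow> 'b::{real_normed_vector, second_countable_topology}" and w :: "'a \<Rightarrow> real"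
  assumes [measurable]: "\<And>k. f k \<in> borel_measurable M" "g \<in> borel_measurable M" "w \<in> borel_measurable M"
    and w: "AE x in M. w x > 0"
    and lim: "(\<lambda>k. \<integral>\<^sup>+x. ennreal ((norm (f k x - g x))\<^sup>2 * w x) \<partial>M) \<longlonglongrightarrow> 0"
    and bound: "eventually (\<lambda>k. (\<integral>\<^sup>+x. ennreal ((norm (f k x))\<^sup>2) \<partial>M) \<le> K) sequentially"
  shows "(\<integral>\<^sup>+x. ennreal ((norm (g x))\<^sup>2) \<partial>M) \<le> K"
proof -
  obtain N where N: "\<And>k. k \<ge> N \<Longrightarrow> (\<integral>\<^sup>+x. ennreal ((norm (f k x - g x))\<^sup>2 * w x) \<partial>M) < 1"
      "\<And>k. k \<ge> N \<Longrightarrow> (\<integral>\<^sup>+x. ennreal ((norm (f k x))\<^sup>2) \<partial>M) \<le> K"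
    using eventually_conj[OF order_tendstoD(2)[OF lim zero_less_one] bound]
    by (auto simp: eventually_sequentially)
  \<comment> \<open>Shifting by N makes every \<open>v k\<close> integrable and the bound by K valid
    for all indices.\<close>
  define v where "v k x = (norm (f (k + N) x - g x))\<^sup>2 * w x" for k x
  have [measurable]: "v k \<in> borel_measurable M" for k unfolding v_def by measurable
  have v0: "AE x in M. 0 \<le> v k x" for k
    using w by eventually_elim (auto simp: v_def)
  have vi: "integrable M (v k)" for k
    by (rule integrableI_nonneg[OF _ v0]) (use N(1)[of "k + N"] in \<open>auto simp: v_def intro: order_less_trans\<close>)
  have "(\<integral>x. norm (v k x) \<partial>M) = enn2real (\<integral>\<^sup>+x. ennreal (v k x) \<partial>M)" for k
  proof -
    have "(\<integral>x. norm (v k x) \<partial>M) = (\<integral>x. v k x \<partial>M)"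
      using v0[of k] by (intro integral_cong_AE) auto
    then show ?thesis using v0[of k] by (simp add: integral_eq_nn_integral)
  qed
  moreover have "(\<lambda>k. enn2real (\<integral>\<^sup>+x. ennreal (v k x) \<partial>M)) \<longlonglongrightarrow> enn2real 0"
    unfolding v_def using LIMSEQ_ignore_initial_segment[OF lim, of N] by (intro tendsto_enn2real) auto
  ultimately have "(\<lambda>k. \<integral>x. norm (v k x) \<partial>M) \<longlonglongrightarrow> 0" by simp
  then obtain r :: "nat \<Rightarrow> nat" where r: "AE x in M. (\<lambda>k. v (r k) x) \<longlonglongrightarrow> 0"
    using tendsto_L1_AE_subseq[of M v, OF vi] by blast
  let ?F = "\<lambda>k x. f (r k + N) x"
  from r w have "AE x in M. liminf (\<lambda>k. ennreal ((norm (?F k x))\<^sup>2)) = ennreal ((norm (g x))\<^sup>2)"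
  proof eventually_elim
    case (elim x)
    have "(\<lambda>k. v (r k) x / w x) \<longlonglongrightarrow> 0 / w x"
      using elim by (intro tendsto_divide) auto
    then have "(\<lambda>k. (norm (?F k x - g x))\<^sup>2) \<longlonglongrightarrow> 0"
      using elim by (simp add: v_def)
    from tendsto_real_sqrt[OF this] have "(\<lambda>k. ?F k x - g x) \<longlonglongrightarrow> 0"
      by (simp add: tendsto_norm_zero_iff)
    then have "(\<lambda>k. ?F k x) \<longlonglongrightarrow> g x" by (simp add: LIM_zero_iff)
    then have "(\<lambda>k. ennreal ((norm (?F k x))\<^sup>2)) \<longlonglongrightarrow> ennreal ((norm (g x))\<^sup>2)"
      by (intro tendsto_intros)
    then show ?case by (simp add: lim_imp_Liminf)
  qed
  then have "(\<integral>\<^sup>+x. ennreal ((norm (g x))\<^sup>2) \<partial>M) = (\<integral>\<^sup>+x. liminf (\<lambda>k. ennreal ((norm (?F k x))\<^sup>2)) \<partial>M)"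
    by (intro nn_integral_cong_AE) auto
  also have "\<dots> \<le> liminf (\<lambda>k. \<integral>\<^sup>+x. ennreal ((norm (?F k x))\<^sup>2) \<partial>M)"
    by (rule nn_integral_liminf) measurable
  also have "\<dots> \<le> liminf (\<lambda>k::nat. K)"
    using N(2) by (intro Liminf_mono always_eventually allI) auto
  also have "\<dots> = K" by (simp add: Liminf_const)
  finally show ?thesis .
qed

text \<open>For large k the two factors for \<open>\<phi> k\<close> are at most \<open>A + e\<close>
  and \<open>B + e\<close>. Dividing by the constant, which is positive by the third hypothesis,
  bounds the Dirichlet integrals uniformly; Fatou's lemma carries the bound to \<open>Du\<close>,
  and e tends to 0 only afterwards.\<close>

lemma H2_element_CKN:
  fixes u :: "real^'n::finite \<Rightarrow> real" and \<alpha> n :: real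
  defines "n \<equiv> real CARD('n)"
  assumes \<alpha>: "n - 2 * \<alpha> > 0" "n + 2 * \<alpha> > 0" "n + 2 + 4 * \<alpha> > 0"
    and u: "H2_element \<alpha> (- 2 - 2 * \<alpha>) u Du Lu"
  shows "ennreal (((n + 4 * \<alpha> + 2) / 2)\<^sup>2) * (\<integral>\<^sup>+x. ennreal ((norm (Du x))\<^sup>2) \<partial>lborel)\<^sup>2
    \<le> (\<integral>\<^sup>+x. ennreal ((Lu x)\<^sup>2 / norm x powr (2 * \<alpha>)) \<partial>lborel)
      * (\<integral>\<^sup>+x. ennreal (norm x powr (2 * \<alpha>) * (Du x \<bullet> x)\<^sup>2) \<partial>lborel)"
proof -
  obtain \<phi> where \<phi>: "\<And>k. test_function (\<phi> k)"
    and limD: "(\<lambda>k. \<integral>\<^sup>+x. ennreal ((norm (grad (\<phi> k) x - Du x))\<^sup>2 * norm x powr (2 + 2 * \<alpha>)) \<partial>lborel) \<longlonglongrightarrow> 0"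
    and limL: "(\<lambda>k. \<integral>\<^sup>+x. ennreal ((laplacian (\<phi> k) x - Lu x)\<^sup>2 * norm x powr (- 2 * \<alpha>)) \<partial>lborel) \<longlonglongrightarrow> 0"
    and [measurable]: "Du \<in> borel_measurable borel" "Lu \<in> borel_measurable borel"
    using u unfolding H2_element_def by (auto simp: algebra_simps)
  define c where "c = (n + 4 * \<alpha> + 2) / 2"
  have c: "c > 0" using \<alpha>(3) by (simp add: c_def)
  obtain R where R: "\<And>k x. norm x > R k \<Longrightarrow> \<phi> k x = 0"
  proof -
    have "\<forall>k. \<exists>R. \<forall>x. norm x > R \<longrightarrow> \<phi> k x = 0"
      using test_function_support[OF \<phi>] by metis
    then show thesis using that by metis
  qed
  note ti = test_function_integrable[OF \<phi> R]
  have [measurable]: "grad (\<phi> k) \<in> borel_measurable borel" "laplacian (\<phi> k) \<in> borel_measurable borel" for k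
    using ti(4,5) by auto
  have fin: "(\<integral>\<^sup>+x. ennreal (f x) \<partial>lborel) < \<infinity>" if "integrable lborel f" "\<And>x. f x \<ge> 0" for f :: "real^'n \<Rightarrow> real"
    using that by (simp add: integrable_iff_bounded)
  have finA: "(\<integral>\<^sup>+x. ennreal ((laplacian (\<phi> k) x)\<^sup>2 * norm x powr (- 2 * \<alpha>)) \<partial>lborel) < \<infinity>" for k
    using \<alpha> by (intro fin ti) (auto simp: n_def)
  have finB: "(\<integral>\<^sup>+x. ennreal ((grad (\<phi> k) x \<bullet> x)\<^sup>2 * norm x powr (2 * \<alpha>)) \<partial>lborel) < \<infinity>" for k
    using \<alpha> by (intro fin ti) (auto simp: n_def)
  \<comment> \<open>By the pointwise Cauchy-Schwarz inequality the radial component costs a factor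
    \<open>|x|^2\<close>; this is how the exponent \<open>2 + 2\<alpha>\<close> of the gradient
    weight in the norm controls the second factor.\<close>
  have limB: "(\<lambda>k. \<integral>\<^sup>+x. ennreal ((grad (\<phi> k) x \<bullet> x - Du x \<bullet> x)\<^sup>2 * norm x powr (2 * \<alpha>)) \<partial>lborel) \<longlonglongrightarrow> 0"
  proof (rule tendsto_sandwich[OF _ _ tendsto_const limD])
    show "eventually (\<lambda>k. (\<integral>\<^sup>+x. ennreal ((grad (\<phi> k) x \<bullet> x - Du x \<bullet> x)\<^sup>2 * norm x powr (2 * \<alpha>)) \<partial>lborel)
      \<le> (\<integral>\<^sup>+x. ennreal ((norm (grad (\<phi> k) x - Du x))\<^sup>2 * norm x powr (2 + 2 * \<alpha>)) \<partial>lborel)) sequentially"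
    proof (intro always_eventually allI nn_integral_mono ennreal_leI)
      fix k and x :: "real^'n"
      let ?d = "grad (\<phi> k) x - Du x"
      have "(?d \<bullet> x)\<^sup>2 \<le> (norm ?d)\<^sup>2 * (norm x)\<^sup>2"
        using power_mono[OF Cauchy_Schwarz_ineq2[of ?d x], of 2] by (simp add: power_mult_distrib)
      then have "(?d \<bullet> x)\<^sup>2 * norm x powr (2 * \<alpha>) \<le> (norm ?d)\<^sup>2 * (norm x)\<^sup>2 * norm x powr (2 * \<alpha>)"
        by (rule mult_right_mono) simp
      also have "\<dots> = (norm ?d)\<^sup>2 * norm x powr (2 + 2 * \<alpha>)"
        by (cases "x = 0") (simp_all add: powr_add)
      finally show "(grad (\<phi> k) x \<bullet> x - Du x \<bullet> x)\<^sup>2 * norm x powr (2 * \<alpha>) \<le> (norm ?d)\<^sup>2 * norm x powr (2 + 2 * \<alpha>)"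
        by (simp add: inner_diff_left)
    qed
  qed auto
  obtain A where A: "A \<ge> 0" "(\<integral>\<^sup>+x. ennreal ((Lu x)\<^sup>2 * norm x powr (- 2 * \<alpha>)) \<partial>lborel) = ennreal A"
    "\<And>e. e > 0 \<Longrightarrow> eventually (\<lambda>k. (\<integral>\<^sup>+x. ennreal ((laplacian (\<phi> k) x)\<^sup>2 * norm x powr (- 2 * \<alpha>)) \<partial>lborel) \<le> ennreal (A + e)) sequentially"
    using weighted_square_limit[OF _ _ _ _ finA limL] by auto
  obtain B where B: "B \<ge> 0" "(\<integral>\<^sup>+x. ennreal ((Du x \<bullet> x)\<^sup>2 * norm x powr (2 * \<alpha>)) \<partial>lborel) = ennreal B"
    "\<And>e. e > 0 \<Longrightarrow> eventually (\<lambda>k. (\<integral>\<^sup>+x. ennreal ((grad (\<phi> k) x \<bullet> x)\<^sup>2 * norm x powr (2 * \<alpha>)) \<partial>lborel) \<le> ennreal (B + e)) sequentially"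
    using weighted_square_limit[OF _ _ _ _ finB limB] by auto
  have D: "(\<integral>\<^sup>+x. ennreal ((norm (Du x))\<^sup>2) \<partial>lborel) \<le> ennreal (sqrt ((A + e) * (B + e)) / c)" if e: "e > 0" for e
  proof (rule nn_integral_fatou_weighted[OF _ _ _ _ limD])
    show "AE x::real^'n in lborel. norm x powr (2 + 2 * \<alpha>) > 0"
      using AE_lborel_singleton[of "0::real^'n"] by eventually_elim simp
    show "eventually (\<lambda>k. (\<integral>\<^sup>+x. ennreal ((norm (grad (\<phi> k) x))\<^sup>2) \<partial>lborel) \<le> ennreal (sqrt ((A + e) * (B + e)) / c)) sequentially"
      using A(3)[OF e] B(3)[OF e]
    proof eventually_elim
      case (elim k)
      define d where "d = (\<integral>x. (norm (grad (\<phi> k) x))\<^sup>2 \<partial>lborel)"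
      have d: "(\<integral>\<^sup>+x. ennreal ((norm (grad (\<phi> k) x))\<^sup>2) \<partial>lborel) = ennreal d" "d \<ge> 0"
        unfolding d_def using ti(3) by (auto intro!: nn_integral_eq_integral)
      have "ennreal (c\<^sup>2 * d\<^sup>2) = ennreal (c\<^sup>2) * (\<integral>\<^sup>+x. ennreal ((norm (grad (\<phi> k) x))\<^sup>2) \<partial>lborel)\<^sup>2"
        using d by (simp add: ennreal_mult ennreal_power)
      also have "\<dots> \<le> ennreal (A + e) * ennreal (B + e)"
        unfolding c_def n_def
        by (rule order_trans[OF test_function_CKN[OF \<phi> R] mult_mono[OF elim]]) (use \<alpha> in \<open>auto simp: n_def\<close>)
      also have "\<dots> = ennreal ((A + e) * (B + e))" using A B e by (simp add: ennreal_mult)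
      finally have "(c * d)\<^sup>2 \<le> (A + e) * (B + e)" using A(1) B(1) e by (simp add: power_mult_distrib)
      then have "c * d \<le> sqrt ((A + e) * (B + e))" by (rule real_le_rsqrt)
      then have "d \<le> sqrt ((A + e) * (B + e)) / c"
        using c by (simp only: pos_le_divide_eq mult.commute)
      then show ?case unfolding d(1) by (rule ennreal_leI)
    qed
  qed measurable
  define d where "d = enn2real (\<integral>\<^sup>+x. ennreal ((norm (Du x))\<^sup>2) \<partial>lborel)"
  have d: "(\<integral>\<^sup>+x. ennreal ((norm (Du x))\<^sup>2) \<partial>lborel) = ennreal d" "d \<ge> 0"
    using order_le_less_trans[OF D[OF zero_less_one] ennreal_less_top] by (auto simp: d_def)
  have "c * d \<le> sqrt ((A + e) * (B + e))" if "e > 0" for e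
  proof -
    have "d \<le> sqrt ((A + e) * (B + e)) / c"
      using D[OF that] c A(1) B(1) that by (simp add: d(1))
    then show ?thesis using c by (simp only: pos_le_divide_eq mult.commute)
  qed
  \<comment> \<open>The number d belongs to the limit \<open>Du\<close> and does not depend on e, so
    e may now tend to 0 from the right.\<close>
  then have "eventually (\<lambda>e. c * d \<le> sqrt ((A + e) * (B + e))) (at_right 0)"
    by (auto simp: eventually_at_filter)
  moreover have "((\<lambda>e. sqrt ((A + e) * (B + e))) \<longlongrightarrow> sqrt ((A + 0) * (B + 0))) (at_right 0)"
    by (intro tendsto_intros)
  ultimately have "c * d \<le> sqrt ((A + 0) * (B + 0))"
    by (intro tendsto_lowerbound) auto
  then have "(c * d)\<^sup>2 \<le> (sqrt (A * B))\<^sup>2" using c d by (intro power_mono) auto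
  then have "ennreal (c\<^sup>2 * d\<^sup>2) \<le> ennreal (A * B)"
    using A B by (intro ennreal_leI) (simp add: power_mult_distrib)
  then have "ennreal (c\<^sup>2) * (ennreal d)\<^sup>2 \<le> ennreal A * ennreal B"
    using A B d by (simp add: ennreal_mult ennreal_power)
  moreover have "(Lu x)\<^sup>2 / norm x powr (2 * \<alpha>) = (Lu x)\<^sup>2 * norm x powr (- 2 * \<alpha>)" for x
    by (simp add: powr_minus divide_inverse)
  moreover have "norm x powr (2 * \<alpha>) * (Du x \<bullet> x)\<^sup>2 = (Du x \<bullet> x)\<^sup>2 * norm x powr (2 * \<alpha>)" for x
    by (rule mult.commute)
  ultimately show ?thesis
    by (simp only: d(1) A(2) B(2) c_def)
qed

section \<open>Integrals of the extremal function\<close>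

text \<open>Radial functions are written in the variable \<open>x \<bullet> x\<close> rather than
  \<open>norm x\<close>, because the former is smooth at the origin as well.\<close>

lemma has_derivative_radial:
  fixes x :: "real^'n::finite"
  assumes "(G has_real_derivative G') (at (x \<bullet> x))"
  shows "((\<lambda>x. G (x \<bullet> x)) has_derivative (\<lambda>h. G' * (2 * (x \<bullet> h)))) (at x)"
proof -
  have "((\<lambda>x. x \<bullet> x) has_derivative (\<lambda>h. 2 * (x \<bullet> h))) (at x)"
    by (auto intro!: derivative_eq_intros simp: inner_commute)
  from has_derivative_compose[OF this assms[unfolded has_field_derivative_def]]
  show ?thesis .
qed

lemma partial_radial:
  fixes x :: "real^'n::finite"
  assumes "(G has_real_derivative G') (at (x \<bullet> x))"
  shows "partial i (\<lambda>x. G (x \<bullet> x)) x = 2 * G' * x $ i"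
  using partial_eqI[OF has_derivative_radial[OF assms]] by (simp add: inner_axis)

lemma grad_radial:
  fixes x :: "real^'n::finite"
  assumes "(G has_real_derivative G') (at (x \<bullet> x))"
  shows "grad (\<lambda>x. G (x \<bullet> x)) x = (2 * G') *\<^sub>R x"
  by (simp add: grad_def vec_eq_iff partial_radial[OF assms])

text \<open>The formula for the first derivative must hold on a neighbourhood in order to be
  differentiated again, hence the open set \<open>S\<close>. It is the positive axis for
  \<open>U0\<close>, whose profile may be singular at 0, and reaches below 0 for the shifted
  approximations.\<close>

lemma laplacian_radial:
  fixes x :: "real^'n::finite"
  assumes S: "open S" "x \<bullet> x \<in> S"
    and G: "\<And>r. r \<in> S \<Longrightarrow> (G has_real_derivative G1 r) (at r)"
    and G1: "(G1 has_real_derivative G2) (at (x \<bullet> x))"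
  shows "laplacian (\<lambda>x. G (x \<bullet> x)) x = 2 * real CARD('n) * G1 (x \<bullet> x) + 4 * (x \<bullet> x) * G2"
proof -
  let ?T = "(\<lambda>y::real^'n. y \<bullet> y) -` S"
  have T: "open ?T" "x \<in> ?T"
    using S by (auto intro!: open_vimage continuous_intros)
  have eq: "partial i (\<lambda>x. G (x \<bullet> x)) y = 2 * G1 (y \<bullet> y) * y $ i" if "y \<in> ?T" for y i
    using that by (intro partial_radial G) auto
  have "partial i (partial i (\<lambda>x. G (x \<bullet> x))) x = 4 * G2 * (x $ i)\<^sup>2 + 2 * G1 (x \<bullet> x)" for i
  proof -
    have "((\<lambda>y. 2 * G1 (y \<bullet> y) * y $ i) has_derivative
      (\<lambda>h. 2 * G1 (x \<bullet> x) * h $ i + 2 * (G2 * (2 * (x \<bullet> h))) * x $ i)) (at x)"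
      by (intro has_derivative_mult has_derivative_mult_right has_derivative_radial G1 has_derivative_component)
    then have "(partial i (\<lambda>x. G (x \<bullet> x)) has_derivative
      (\<lambda>h. 2 * G1 (x \<bullet> x) * h $ i + 2 * (G2 * (2 * (x \<bullet> h))) * x $ i)) (at x)"
      by (rule has_derivative_transform_within_open[OF _ T]) (simp add: eq)
    from partial_eqI[OF this] show ?thesis
      by (simp add: inner_axis power2_eq_square)
  qed
  then show ?thesis
    by (simp add: laplacian_def sum.distrib inner_vec_def power2_eq_square flip: sum_distrib_left)
qed

lemma inner_self_powr: "(x \<bullet> x) powr a = norm x powr (2 * a)"
proof (cases "x = 0")
  case False
  then have "x \<bullet> x = norm x powr 2"
    by (simp add: power2_norm_eq_inner)
  then show ?thesis by (simp only: powr_powr)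
qed simp

text \<open>\<open>U0\<close> as a function of the squared radius, with the power
  \<open>2(1+\<alpha>)\<close> of the radius halved accordingly; \<open>profile1\<close> and
  \<open>profile2\<close> are its first two derivatives on the positive axis.\<close>

definition profile :: "real \<Rightarrow> real \<Rightarrow> real" where
  "profile \<alpha> r = exp (- (r powr (1 + \<alpha>) / (2 * (1 + \<alpha>))))"

definition profile1 :: "real \<Rightarrow> real \<Rightarrow> real" where
  "profile1 \<alpha> r = - (r powr \<alpha> / 2) * profile \<alpha> r"

definition profile2 :: "real \<Rightarrow> real \<Rightarrow> real" where
  "profile2 \<alpha> r = (r powr (2 * \<alpha>) / 4 - \<alpha> * r powr (\<alpha> - 1) / 2) * profile \<alpha> r"

lemma profile_derivatives:
  assumes "1 + \<alpha> > 0" "r > 0"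
  shows "(profile \<alpha> has_real_derivative profile1 \<alpha> r) (at r)"
    and "(profile1 \<alpha> has_real_derivative profile2 \<alpha> r) (at r)"
proof -
  have "((\<lambda>r. r powr (1 + \<alpha>) / (2 * (1 + \<alpha>))) has_real_derivative r powr \<alpha> / 2) (at r)"
  proof -
    have "((\<lambda>r. r powr p / (2 * p)) has_real_derivative r powr (p - 1) / 2) (at r)" if "p > 0" for p
      using that assms(2) by (auto intro!: derivative_eq_intros)
    from this[of "1 + \<alpha>"] assms(1) show ?thesis by simp
  qed
  from DERIV_chain2[OF DERIV_exp DERIV_minus[OF this]]
  show 1: "(profile \<alpha> has_real_derivative profile1 \<alpha> r) (at r)"
    unfolding profile1_def profile_def[abs_def] by (simp add: mult.commute)
  have "((\<lambda>r. - (r powr \<alpha> / 2)) has_real_derivative - (\<alpha> * r powr (\<alpha> - 1) / 2)) (at r)"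
    using assms by (auto intro!: derivative_eq_intros)
  from DERIV_mult[OF this 1]
  have "(profile1 \<alpha> has_real_derivative
     - (\<alpha> * r powr (\<alpha> - 1) / 2) * profile \<alpha> r + profile1 \<alpha> r * - (r powr \<alpha> / 2)) (at r)"
    unfolding profile1_def[abs_def] .
  moreover have "r powr (2 * \<alpha>) = r powr \<alpha> * r powr \<alpha>" by (simp flip: powr_add)
  ultimately show "(profile1 \<alpha> has_real_derivative profile2 \<alpha> r) (at r)"
    by (simp add: profile1_def profile2_def algebra_simps)
qed

lemma U0_eq_profile: "U0 \<alpha> = (\<lambda>x. profile \<alpha> (x \<bullet> x))"
  by (rule ext) (simp add: U0_def profile_def inner_self_powr)

lemma U0_radial:
  fixes x :: "real^'n::finite"
  assumes "1 + \<alpha> > 0" "x \<noteq> 0"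
  shows "grad (U0 \<alpha>) x = (2 * profile1 \<alpha> (x \<bullet> x)) *\<^sub>R x"
    and "laplacian (U0 \<alpha>) x
      = 2 * real CARD('n) * profile1 \<alpha> (x \<bullet> x) + 4 * (x \<bullet> x) * profile2 \<alpha> (x \<bullet> x)"
  unfolding U0_eq_profile
proof -
  show "grad (\<lambda>x. profile \<alpha> (x \<bullet> x)) x = (2 * profile1 \<alpha> (x \<bullet> x)) *\<^sub>R x"
    using assms by (intro grad_radial profile_derivatives) simp_all
  show "laplacian (\<lambda>x. profile \<alpha> (x \<bullet> x)) x
      = 2 * real CARD('n) * profile1 \<alpha> (x \<bullet> x) + 4 * (x \<bullet> x) * profile2 \<alpha> (x \<bullet> x)"
    by (rule laplacian_radial[where S = "{0<..}"]) (use profile_derivatives[OF assms(1)] assms(2) in auto)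
qed

lemma grad_U0:
  fixes x :: "real^'n::finite"
  assumes "1 + \<alpha> > 0" "x \<noteq> 0"
  shows "grad (U0 \<alpha>) x = (- (norm x powr (2 * \<alpha>) * U0 \<alpha> x)) *\<^sub>R x"
  using U0_radial(1)[OF assms] by (simp add: profile1_def U0_eq_profile inner_self_powr)

text \<open>The right-hand side is \<open>- |x|^{2\<alpha>} (\<nabla>U0 \<bullet> x + (n +
  2\<alpha>) U0)\<close> with n the dimension, which is the proportionality required for equality in
  the Cauchy-Schwarz step.\<close>

lemma laplacian_U0:
  fixes x :: "real^'n::finite"
  assumes "1 + \<alpha> > 0" "x \<noteq> 0"
  shows "laplacian (U0 \<alpha>) x
    = (norm x powr (4 * \<alpha> + 2) - (real CARD('n) + 2 * \<alpha>) * norm x powr (2 * \<alpha>)) * U0 \<alpha> x"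
proof -
  let ?r = "x \<bullet> x"
  have r: "?r > 0" using assms by simp
  have "laplacian (U0 \<alpha>) x = (?r * ?r powr (2 * \<alpha>) - real CARD('n) * ?r powr \<alpha>
      - 2 * \<alpha> * (?r * ?r powr (\<alpha> - 1))) * profile \<alpha> ?r"
    by (simp add: U0_radial(2)[OF assms] profile1_def profile2_def algebra_simps)
  also have "?r * ?r powr (2 * \<alpha>) = ?r powr (2 * \<alpha> + 1)"
    using r by (simp add: powr_add)
  also have "?r * ?r powr (\<alpha> - 1) = ?r powr \<alpha>"
    using r by (simp add: powr_diff)
  finally show ?thesis
    by (simp add: U0_eq_profile inner_self_powr algebra_simps)
qed

section \<open>Moments of the extremal function\<close>

context
  fixes \<alpha> :: real
  assumes a: "1 + \<alpha> > 0"
begin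

text \<open>The type argument carries the dimension, which the result type \<open>real\<close>
  cannot determine.\<close>

definition U0_moment :: "'n::finite itself \<Rightarrow> real \<Rightarrow> real" where
  "U0_moment _ s = (\<integral>(x::real^'n). norm x powr s * (U0 \<alpha> x)\<^sup>2 \<partial>lborel)"

lemma U0_square: "(U0 \<alpha> x)\<^sup>2 = exp (- (1 / (1 + \<alpha>)) * norm x powr (2 * (1 + \<alpha>)))"
proof -
  have "2 * (- (q / (2 * p))) = - (1 / p) * q" for p q :: real by simp
  then show ?thesis by (simp only: U0_def exp_double[symmetric])
qed

lemma U0_moment_integrable:
  assumes "s > - real CARD('n)"
  shows "integrable lborel (\<lambda>x::real^'n::finite. norm x powr s * (U0 \<alpha> x)\<^sup>2)"
  using integrable_norm_powr_exp[of "1 / (1 + \<alpha>)" "2 * (1 + \<alpha>)" s 0, where ?'a = "real^'n"] a assms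
  by (simp add: U0_square add_nonneg_eq_0_iff)

lemma U0_measurable [measurable]: "U0 \<alpha> \<in> borel_measurable borel"
  unfolding U0_def by measurable

text \<open>The Euler identity for \<open>U0^2\<close>, whose radial derivative is
  \<open>- 2 |x|^{2+2\<alpha>} U0^2\<close>: the left side becomes a moment of order raised by
  \<open>2 + 2\<alpha>\<close>.\<close>

lemma U0_moment_recursion:
  assumes s: "s > - real CARD('n)"
  shows "U0_moment TYPE('n::finite) (s + 2 + 2 * \<alpha>) = (s + real CARD('n)) / 2 * U0_moment TYPE('n) s"
proof -
  let ?p = "2 * (1 + \<alpha>)"
  define D where "D x t = - 2 * t powr (?p - 1) * norm x powr ?p * (U0 \<alpha> (t *\<^sub>R x))\<^sup>2" for x :: "real^'n" and t
  have D: "((\<lambda>t. (U0 \<alpha> (t *\<^sub>R x))\<^sup>2) has_real_derivative D x t) (at t)"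
    if "x \<noteq> 0" "1 \<le> t" "t \<le> 2" for x :: "real^'n" and t
  proof -
    have "((\<lambda>t. exp (- (1 / (1 + \<alpha>)) * (t powr ?p * norm x powr ?p))) has_real_derivative D x t) (at t)"
    proof -
      have "((\<lambda>t. exp (- (1 / p) * (t powr (2 * p) * q))) has_real_derivative
          - 2 * t powr (2 * p - 1) * q * exp (- (1 / p) * (t powr (2 * p) * q))) (at t)" if "p > 0" for p q
        using that \<open>1 \<le> t\<close> by (auto intro!: derivative_eq_intros)
      from this[OF a] show ?thesis
        using \<open>1 \<le> t\<close> by (simp only: D_def U0_square norm_scaleR powr_mult) simp
    qed
    then show ?thesis
    proof (rule DERIV_cong_ev[THEN iffD1, rotated 3, OF _ refl _ refl])
      have "eventually (\<lambda>t::real. t > 0) (nhds t)"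
        using that by (intro eventually_nhds_in_open[of "{0<..}", simplified]) auto
      then show "eventually (\<lambda>t. exp (- (1 / (1 + \<alpha>)) * (t powr ?p * norm x powr ?p)) = (U0 \<alpha> (t *\<^sub>R x))\<^sup>2) (nhds t)"
        by eventually_elim (simp add: U0_square powr_mult)
    qed
  qed
  \<comment> \<open>\<open>U0\<close> decreases along rays, so the dilated value is at most the one
    at x. The exponent \<open>?p - 1\<close> may be negative, whereas \<open>?p\<close> is positive,
    so the power of t is first raised to \<open>?p\<close> and then bounded at t = 2.\<close>
  have bound: "norm x powr s * \<bar>D x t\<bar> \<le> 2 * 2 powr ?p * (norm x powr (s + 2 + 2 * \<alpha>) * (U0 \<alpha> x)\<^sup>2)"
    if "x \<noteq> 0" "1 \<le> t" "t \<le> 2" for x :: "real^'n" and t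
  proof -
    have 1: "t powr (?p - 1) \<le> 2 powr ?p"
    proof -
      have "t powr (?p - 1) \<le> t powr ?p" using that by (intro powr_mono) auto
      also have "\<dots> \<le> 2 powr ?p" using that a by (intro powr_mono2) auto
      finally show ?thesis .
    qed
    have "norm x powr ?p \<le> (norm (t *\<^sub>R x)) powr ?p"
      using that a by (intro powr_mono2) (auto simp: mult_le_cancel_right1)
    then have 2: "(U0 \<alpha> (t *\<^sub>R x))\<^sup>2 \<le> (U0 \<alpha> x)\<^sup>2"
      unfolding U0_square using a by (simp add: divide_right_mono)
    have "norm x powr s * \<bar>D x t\<bar> = 2 * t powr (?p - 1) * (norm x powr s * norm x powr ?p * (U0 \<alpha> (t *\<^sub>R x))\<^sup>2)"
      by (simp add: D_def abs_mult)
    also have "norm x powr s * norm x powr ?p = norm x powr (s + 2 + 2 * \<alpha>)"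
      by (simp add: algebra_simps flip: powr_add)
    also have "2 * t powr (?p - 1) * (norm x powr (s + 2 + 2 * \<alpha>) * (U0 \<alpha> (t *\<^sub>R x))\<^sup>2)
      \<le> 2 * 2 powr ?p * (norm x powr (s + 2 + 2 * \<alpha>) * (U0 \<alpha> x)\<^sup>2)"
      using 1 2 by (intro mult_mono) auto
    finally show ?thesis .
  qed
  have gi: "integrable lborel (\<lambda>x::real^'n. 2 * 2 powr ?p * (norm x powr (s + 2 + 2 * \<alpha>) * (U0 \<alpha> x)\<^sup>2))"
    using s a by (intro integrable_mult_right U0_moment_integrable) auto
  have m: "(\<lambda>x::real^'n. (U0 \<alpha> x)\<^sup>2) \<in> borel_measurable borel" by measurable
  have "(\<integral>x. norm x powr s * D x 1 \<partial>lborel) = - (s + real DIM(real^'n)) * (\<integral>(x::real^'n). norm x powr s * (U0 \<alpha> x)\<^sup>2 \<partial>lborel)"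
    by (rule integral_euler_homogeneous(2)[OF m U0_moment_integrable[OF s] gi D bound])
  moreover have "(\<integral>x. norm x powr s * D x 1 \<partial>lborel) = (\<integral>(x::real^'n). - 2 * (norm x powr (s + 2 + 2 * \<alpha>) * (U0 \<alpha> x)\<^sup>2) \<partial>lborel)"
  proof (intro Bochner_Integration.integral_cong refl)
    fix x :: "real^'n"
    have "norm x powr (s + 2 + 2 * \<alpha>) = norm x powr s * norm x powr ?p"
      by (simp add: algebra_simps flip: powr_add)
    then show "norm x powr s * D x 1 = - 2 * (norm x powr (s + 2 + 2 * \<alpha>) * (U0 \<alpha> x)\<^sup>2)"
      by (simp add: D_def)
  qed
  moreover have "(\<integral>(x::real^'n). - 2 * (norm x powr (s + 2 + 2 * \<alpha>) * (U0 \<alpha> x)\<^sup>2) \<partial>lborel)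
      = - 2 * U0_moment TYPE('n) (s + 2 + 2 * \<alpha>)"
    by (simp only: integral_mult_right_zero U0_moment_def)
  ultimately have "- 2 * U0_moment TYPE('n) (s + 2 + 2 * \<alpha>) = - (s + real CARD('n)) * U0_moment TYPE('n) s"
    by (simp add: U0_moment_def)
  then show ?thesis by (simp add: algebra_simps)
qed

text \<open>The integrand is positive off the origin. Strictness matters for sharpness, which
  compares two multiples of a squared moment.\<close>

lemma U0_moment_pos:
  assumes s: "s > - real CARD('n)"
  shows "U0_moment TYPE('n::finite) s > 0"
proof -
  let ?f = "\<lambda>x::real^'n. norm x powr s * (U0 \<alpha> x)\<^sup>2"
  have "U0_moment TYPE('n) s \<noteq> 0"
  proof
    assume "U0_moment TYPE('n) s = 0"
    then have "AE x in lborel. ?f x = 0"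
      using integral_nonneg_eq_0_iff_AE[OF U0_moment_integrable[OF s]] by (simp add: U0_moment_def)
    with AE_lborel_singleton[of "0::real^'n"] have "AE x::real^'n in lborel. False"
      by eventually_elim (simp add: U0_def)
    then have "emeasure lborel (UNIV::(real^'n) set) = 0"
      by (subst (asm) AE_iff_measurable[OF _ refl]) auto
    then show False by simp
  qed
  moreover have "U0_moment TYPE('n) s \<ge> 0" unfolding U0_moment_def by (rule integral_nonneg_AE) simp
  ultimately show ?thesis by simp
qed

lemma nn_integral_U0_moment:
  assumes "s > - real CARD('n)"
  shows "(\<integral>\<^sup>+(x::real^'n::finite). ennreal (norm x powr s * (U0 \<alpha> x)\<^sup>2) \<partial>lborel) = ennreal (U0_moment TYPE('n) s)"
  unfolding U0_moment_def using U0_moment_integrable[OF assms] by (intro nn_integral_eq_integral) auto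

lemma U0_integrals:
  fixes n :: real
  defines "n \<equiv> real CARD('n)"
  assumes n: "n + 2 * \<alpha> > 0"
  obtains D where "D > 0"
    "(\<integral>\<^sup>+x. ennreal ((norm (grad (U0 \<alpha> :: real^'n::finite \<Rightarrow> real) x))\<^sup>2) \<partial>lborel) = ennreal D"
    "(\<integral>\<^sup>+x. ennreal ((laplacian (U0 \<alpha> :: real^'n \<Rightarrow> real) x)\<^sup>2 / norm x powr (2 * \<alpha>)) \<partial>lborel) = ennreal ((n + 4 * \<alpha> + 2) / 2 * D)"
    "(\<integral>\<^sup>+x. ennreal (norm x powr (2 * \<alpha>) * (grad (U0 \<alpha> :: real^'n \<Rightarrow> real) x \<bullet> x)\<^sup>2) \<partial>lborel) = ennreal ((n + 4 * \<alpha> + 2) / 2 * D)"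
proof -
  let ?M = "U0_moment TYPE('n)"
  \<comment> \<open>The higher orders exceed \<open>2\<alpha>\<close> by
    \<open>2(1+\<alpha>)\<close> and \<open>4(1+\<alpha>)\<close>, both positive.\<close>
  have s: "2 * \<alpha> > - real CARD('n)" "4 * \<alpha> + 2 > - real CARD('n)" "6 * \<alpha> + 4 > - real CARD('n)"
    using n a by (auto simp: n_def)
  define D where "D = ?M (4 * \<alpha> + 2)"
  define m where "m = n + 2 * \<alpha>"
  have M1: "D = m / 2 * ?M (2 * \<alpha>)"
    using U0_moment_recursion[OF s(1)] by (simp add: D_def m_def n_def algebra_simps)
  have M2: "?M (6 * \<alpha> + 4) = (n + 4 * \<alpha> + 2) / 2 * D"
    using U0_moment_recursion[OF s(2)] by (simp add: D_def n_def algebra_simps)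
  have ne: "AE x::real^'n in lborel. x \<noteq> 0" by (rule AE_lborel_singleton)
  have p2: "(norm x powr b)\<^sup>2 = norm x powr (2 * b)" for x :: "real^'n" and b
    by (simp add: power2_eq_square flip: powr_add)
  have n2: "(norm x)\<^sup>2 = norm x powr 2" for x :: "real^'n"
    by (cases "x = 0") (simp_all)
  have E1: "(norm (grad (U0 \<alpha>) x))\<^sup>2 = norm x powr (4 * \<alpha> + 2) * (U0 \<alpha> x)\<^sup>2" if "x \<noteq> 0" for x :: "real^'n"
  proof -
    have "(norm (grad (U0 \<alpha>) x))\<^sup>2 = (norm x powr (2 * \<alpha>))\<^sup>2 * (norm x)\<^sup>2 * (U0 \<alpha> x)\<^sup>2"
      using that by (simp add: grad_U0[OF a] power_mult_distrib abs_mult)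
    also have "(norm x powr (2 * \<alpha>))\<^sup>2 * (norm x)\<^sup>2 = norm x powr (4 * \<alpha> + 2)"
      unfolding p2 n2 powr_add[symmetric] by simp
    finally show ?thesis .
  qed
  have E2: "norm x powr (2 * \<alpha>) * (grad (U0 \<alpha>) x \<bullet> x)\<^sup>2 = norm x powr (6 * \<alpha> + 4) * (U0 \<alpha> x)\<^sup>2" if "x \<noteq> 0" for x :: "real^'n"
  proof -
    have "norm x powr (2 * \<alpha>) * (grad (U0 \<alpha>) x \<bullet> x)\<^sup>2
      = norm x powr (2 * \<alpha>) * (norm x powr (2 * \<alpha>))\<^sup>2 * ((norm x)\<^sup>2)\<^sup>2 * (U0 \<alpha> x)\<^sup>2"
      using that by (simp add: grad_U0[OF a] power_mult_distrib power2_norm_eq_inner)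
    also have "norm x powr (2 * \<alpha>) * (norm x powr (2 * \<alpha>))\<^sup>2 * ((norm x)\<^sup>2)\<^sup>2 = norm x powr (6 * \<alpha> + 4)"
      unfolding n2 p2 powr_add[symmetric] by simp
    finally show ?thesis .
  qed
  have E3: "(laplacian (U0 \<alpha>) x)\<^sup>2 / norm x powr (2 * \<alpha>) = norm x powr (6 * \<alpha> + 4) * (U0 \<alpha> x)\<^sup>2
      - 2 * m * (norm x powr (4 * \<alpha> + 2) * (U0 \<alpha> x)\<^sup>2) + m\<^sup>2 * (norm x powr (2 * \<alpha>) * (U0 \<alpha> x)\<^sup>2)"
    if "x \<noteq> 0" for x :: "real^'n"
  proof -
    define q where "q = norm x powr (2 * \<alpha>)"
    have q: "q > 0" using that by (simp add: q_def)
    define w where "w = norm x powr (2 * \<alpha> + 2)"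
    have 1: "norm x powr (4 * \<alpha> + 2) = q * w" "norm x powr (6 * \<alpha> + 4) = q * w * w"
      by (simp_all add: q_def w_def flip: powr_add)
    show ?thesis unfolding laplacian_U0[OF a that] 1 q_def[symmetric] m_def n_def
      using q by (simp add: power2_eq_square field_simps)
  qed
  show thesis
  proof (rule that)
    show "D > 0" unfolding D_def by (rule U0_moment_pos[OF s(2)])
    have "(\<integral>\<^sup>+x. ennreal ((norm (grad (U0 \<alpha> :: real^'n \<Rightarrow> real) x))\<^sup>2) \<partial>lborel)
      = (\<integral>\<^sup>+(x::real^'n). ennreal (norm x powr (4 * \<alpha> + 2) * (U0 \<alpha> x)\<^sup>2) \<partial>lborel)"
      using ne by (intro nn_integral_cong_AE, eventually_elim) (simp add: E1)
    then show "(\<integral>\<^sup>+x. ennreal ((norm (grad (U0 \<alpha> :: real^'n \<Rightarrow> real) x))\<^sup>2) \<partial>lborel) = ennreal D"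
      by (simp add: nn_integral_U0_moment[OF s(2)] D_def)
    have "(\<integral>\<^sup>+x. ennreal (norm x powr (2 * \<alpha>) * (grad (U0 \<alpha> :: real^'n \<Rightarrow> real) x \<bullet> x)\<^sup>2) \<partial>lborel)
      = (\<integral>\<^sup>+(x::real^'n). ennreal (norm x powr (6 * \<alpha> + 4) * (U0 \<alpha> x)\<^sup>2) \<partial>lborel)"
      using ne by (intro nn_integral_cong_AE, eventually_elim) (simp add: E2)
    then show "(\<integral>\<^sup>+x. ennreal (norm x powr (2 * \<alpha>) * (grad (U0 \<alpha> :: real^'n \<Rightarrow> real) x \<bullet> x)\<^sup>2) \<partial>lborel)
      = ennreal ((n + 4 * \<alpha> + 2) / 2 * D)"
      by (simp only: nn_integral_U0_moment[OF s(3)] M2)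
    let ?F = "\<lambda>x::real^'n. norm x powr (6 * \<alpha> + 4) * (U0 \<alpha> x)\<^sup>2
      - 2 * m * (norm x powr (4 * \<alpha> + 2) * (U0 \<alpha> x)\<^sup>2) + m\<^sup>2 * (norm x powr (2 * \<alpha>) * (U0 \<alpha> x)\<^sup>2)"
    note i = U0_moment_integrable[OF s(1)] U0_moment_integrable[OF s(2)] U0_moment_integrable[OF s(3)]
    have "(\<integral>\<^sup>+x. ennreal ((laplacian (U0 \<alpha> :: real^'n \<Rightarrow> real) x)\<^sup>2 / norm x powr (2 * \<alpha>)) \<partial>lborel)
      = (\<integral>\<^sup>+x. ennreal (?F x) \<partial>lborel)"
    proof (rule nn_integral_cong_AE)
      show "AE x in lborel. ennreal ((laplacian (U0 \<alpha> :: real^'n \<Rightarrow> real) x)\<^sup>2 / norm x powr (2 * \<alpha>)) = ennreal (?F x)"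
        using ne by eventually_elim (simp only: E3 not_False_eq_True)
    qed
    also have "\<dots> = ennreal (\<integral>x. ?F x \<partial>lborel)"
    proof (rule nn_integral_eq_integral)
      show "integrable lborel ?F" using i by simp
      show "AE x in lborel. 0 \<le> ?F x" using ne by eventually_elim (simp flip: E3)
    qed
    also have "(\<integral>x. ?F x \<partial>lborel) = ?M (6 * \<alpha> + 4) - 2 * m * D + m\<^sup>2 * ?M (2 * \<alpha>)"
      using i by (simp add: U0_moment_def D_def)
    \<comment> \<open>By \<open>M1\<close> the last two terms cancel:
      \<open>m^2 M(2\<alpha>) = 2 m D\<close>. The remaining top moment is given by
      \<open>M2\<close>.\<close>
    also have "\<dots> = (n + 4 * \<alpha> + 2) / 2 * D"
      unfolding M2 M1 by (simp add: power2_eq_square algebra_simps)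
    finally show "(\<integral>\<^sup>+x. ennreal ((laplacian (U0 \<alpha> :: real^'n \<Rightarrow> real) x)\<^sup>2 / norm x powr (2 * \<alpha>)) \<partial>lborel)
      = ennreal ((n + 4 * \<alpha> + 2) / 2 * D)" .
  qed
qed

end

section \<open>Smooth compactly supported approximations\<close>

text \<open>The functions \<open>t^(-j) exp(-1/t)\<close>, extended by 0, are indexed by j because
  derivatives of members are combinations of members; smoothness of the cutoff \<open>bump 0\<close>
  then needs no formula for higher derivatives.\<close>

definition bump :: "nat \<Rightarrow> real \<Rightarrow> real" where
  "bump j t = (if t > 0 then inverse t ^ j * exp (- inverse t) else 0)"

lemma bump_nonneg: "bump j t \<ge> 0"
  by (simp add: bump_def)

text \<open>A single term of the exponential series at \<open>y = 1/t\<close> gives flatness at 0 to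
  any order k: k = 2 yields the vanishing derivative at 0, and k = 0 the global bound by
  \<open>fact j\<close>.\<close>

lemma bump_le_power:
  assumes "t > 0"
  shows "bump j t \<le> fact (j + k) * t ^ k"
proof -
  define y where "y = inverse t"
  have y: "y > 0" "t = inverse y" using assms by (simp_all add: y_def)
  have "y ^ (j + k) \<le> fact (j + k) * exp y"
    using power_div_fact_le_exp[of y "j + k"] y by (simp add: divide_simps mult.commute)
  then have "y ^ (j + k) * (exp (- y) * t ^ k) \<le> fact (j + k) * exp y * (exp (- y) * t ^ k)"
    using assms by (intro mult_right_mono) auto
  moreover have "y ^ k * t ^ k = 1" using y by (simp flip: power_mult_distrib)
  then have "y ^ (j + k) * (exp (- y) * t ^ k) = y ^ j * exp (- y)" by (simp add: power_add)
  moreover have "fact (j + k) * exp y * (exp (- y) * t ^ k) = fact (j + k) * t ^ k"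
    by (simp add: exp_minus)
  ultimately have "y ^ j * exp (- y) \<le> fact (j + k) * t ^ k" by argo
  then show ?thesis
    using assms by (simp add: bump_def y_def)
qed

lemma bump_le_fact: "bump j t \<le> fact j"
  using bump_le_power[of t j 0] by (cases "t > 0") (auto simp: bump_def)

lemma bump_has_derivative:
  "(bump j has_real_derivative (bump (j + 2) t - real j * bump (j + 1) t)) (at t)"
proof -
  consider "t > 0" | "t < 0" | "t = 0" by linarith
  then show ?thesis
  proof cases
    case 1
    have "((\<lambda>t. inverse t ^ j * exp (- inverse t)) has_real_derivative
      (bump (j + 2) t - real j * bump (j + 1) t)) (at t)"
    proof -
      have i: "(inverse has_real_derivative - (inverse t ^ 2)) (at t)"
        using DERIV_inverse[of t] 1 by (simp add: power2_eq_square)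
      have e: "((\<lambda>t. exp (- inverse t)) has_real_derivative exp (- inverse t) * inverse t ^ 2) (at t)"
        using DERIV_chain2[OF DERIV_exp DERIV_minus[OF i]] by simp
      show ?thesis
        by (rule DERIV_cong[OF DERIV_mult[OF DERIV_power[OF i, of j] e]], cases j)
           (use 1 in \<open>simp_all add: bump_def power2_eq_square algebra_simps\<close>)
    qed
    then show ?thesis
      by (rule has_field_derivative_transform_within_open[where S = "{0<..}"]) (use 1 in \<open>auto simp: bump_def\<close>)
  next
    case 2
    have "((\<lambda>t. 0) has_real_derivative (bump (j + 2) t - real j * bump (j + 1) t)) (at t)"
      using 2 by (simp add: bump_def)
    then show ?thesis
      by (rule has_field_derivative_transform_within_open[where S = "{..<0}"]) (use 2 in \<open>auto simp: bump_def\<close>)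
  next
    case 3
    have "((\<lambda>h. bump j h / h) \<longlongrightarrow> 0) (at 0)"
    proof (rule Lim_null_comparison)
      show "eventually (\<lambda>h. norm (bump j h / h) \<le> fact (j + 2) * \<bar>h\<bar>) (at 0)"
      proof (intro always_eventually allI)
        fix h :: real
        show "norm (bump j h / h) \<le> fact (j + 2) * \<bar>h\<bar>"
        proof (cases "h > 0")
          case True
          then have "bump j h / h \<le> fact (j + 2) * h ^ 2 / h"
            by (intro divide_right_mono bump_le_power) auto
          then show ?thesis using True bump_nonneg[of j h] by (simp add: power2_eq_square)
        next
          case False
          then have "norm (bump j h / h) = 0" by (simp add: bump_def)
          also have "\<dots> \<le> fact (j + 2) * \<bar>h\<bar>" by (intro mult_nonneg_nonneg) auto
          finally show ?thesis .
        qed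
      qed
      show "((\<lambda>h. fact (j + 2) * \<bar>h\<bar>) \<longlongrightarrow> 0) (at (0::real))"
        by (auto intro!: tendsto_eq_intros)
    qed
    then show ?thesis using 3 by (simp add: DERIV_def bump_def)
  qed
qed

text \<open>The algebra of functions generated by F. If the generators are differentiable and their
  partial derivatives lie in the algebra, the product rule makes the whole algebra closed under
  \<open>partial\<close>, so all iterated derivatives are differentiable.\<close>

inductive generated :: "(real^'n::finite \<Rightarrow> real) set \<Rightarrow> (real^'n \<Rightarrow> real) \<Rightarrow> bool" for F where
  generator: "f \<in> F \<Longrightarrow> generated F f"
| const: "generated F (\<lambda>x. c)"
| add: "generated F f \<Longrightarrow> generated F g \<Longrightarrow> generated F (\<lambda>x. f x + g x)"
| mult: "generated F f \<Longrightarrow> generated F g \<Longrightarrow> generated F (\<lambda>x. f x * g x)"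

lemma generated_smooth:
  assumes F: "\<And>f x. f \<in> F \<Longrightarrow> f differentiable (at x)" "\<And>f i. f \<in> F \<Longrightarrow> generated F (partial i f)"
    and f: "generated F f"
  shows "foldr partial is f differentiable (at x)"
proof -
  have step: "(\<forall>x. g differentiable (at x)) \<and> (\<forall>i. generated F (partial i g))" if "generated F g" for g
    using that
  proof induction
    case (const c)
    have "partial i (\<lambda>x. c) = (\<lambda>x. 0)" for i :: 'a
      by (rule ext) (simp add: partial_def)
    then show ?case by (auto intro: generated.const)
  next
    case (add f g)
    then have "partial i (\<lambda>x. f x + g x) = (\<lambda>x. partial i f x + partial i g x)" for i
      by (intro ext partial_add) auto
    then show ?case using add by (auto intro: generated.add)
  next
    case (mult f g)
    then have "partial i (\<lambda>x. f x * g x) = (\<lambda>x. f x * partial i g x + partial i f x * g x)" for i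
      by (intro ext partial_mult) auto
    moreover have "generated F (\<lambda>x. f x * partial i g x + partial i f x * g x)" for i
      using mult by (intro generated.add generated.mult) auto
    ultimately show ?case using mult by auto
  qed (use F in auto)
  have "generated F (foldr partial is f)"
    by (induction "is") (use f step in auto)
  then show ?thesis using step by blast
qed

text \<open>Adding \<open>\<delta>\<close> removes the singularity of \<open>profile \<alpha>\<close> at the origin, the bump cuts off outside the ball of radius
  \<open>\<delta>^(-1/2)\<close>, and \<open>exp 1\<close> compensates for its value at \<open>1\<close>, so that no plateau function is needed:
  as \<open>\<delta> \<longlonglongrightarrow> 0\<close> the cutoff tends to \<open>1\<close> with bounded derivatives.\<close>

definition approximant :: "real \<Rightarrow> real \<Rightarrow> real \<Rightarrow> real" where
  "approximant \<alpha> \<delta> r = exp 1 * (profile \<alpha> (r + \<delta>) * bump 0 (1 - \<delta> * r))"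

text \<open>Chosen to be closed under differentiation up to the algebra operations: the chain rule
  produces coordinates, a derivative of a power or of the profile produces other powers, and a
  derivative of a bump produces bumps of higher index. Since \<delta> > 0, the base of the powers
  stays positive.\<close>

definition radial_generators :: "real \<Rightarrow> real \<Rightarrow> (real^'n::finite \<Rightarrow> real) set" where
  "radial_generators \<alpha> \<delta> = range (\<lambda>i x. x $ i) \<union> range (\<lambda>b x. (x \<bullet> x + \<delta>) powr b)
     \<union> {\<lambda>x. profile \<alpha> (x \<bullet> x + \<delta>)} \<union> range (\<lambda>j x. bump j (1 - \<delta> * (x \<bullet> x)))"

lemma radial_generators_I:
  "(\<lambda>x. x $ i) \<in> radial_generators \<alpha> \<delta>"
  "(\<lambda>x. (x \<bullet> x + \<delta>) powr b) \<in> radial_generators \<alpha> \<delta>"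
  "(\<lambda>x. profile \<alpha> (x \<bullet> x + \<delta>)) \<in> radial_generators \<alpha> \<delta>"
  "(\<lambda>x. bump j (1 - \<delta> * (x \<bullet> x))) \<in> radial_generators \<alpha> \<delta>"
  unfolding radial_generators_def by auto

lemma has_real_derivative_shift:
  fixes f :: "real \<Rightarrow> real"
  assumes "(f has_real_derivative f') (at (r + \<delta>))"
  shows "((\<lambda>r. f (r + \<delta>)) has_real_derivative f') (at r)"
  using assms by (subst DERIV_shift[symmetric])

lemma bump_scaled_derivative:
  "((\<lambda>r. bump j (1 - \<delta> * r)) has_real_derivative
     (- \<delta>) * (bump (j + 2) (1 - \<delta> * r) - real j * bump (j + 1) (1 - \<delta> * r))) (at r)"
proof -
  have "((\<lambda>r. 1 - \<delta> * r) has_real_derivative (- \<delta>)) (at r)"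
    by (auto intro!: derivative_eq_intros)
  from DERIV_chain2[OF bump_has_derivative this] show ?thesis by (simp add: mult.commute)
qed

lemma test_function_approximant:
  assumes \<alpha>: "1 + \<alpha> > 0" and \<delta>: "\<delta> > 0"
  shows "test_function (\<lambda>x::real^'n::finite. approximant \<alpha> \<delta> (x \<bullet> x))"
proof -
  let ?F = "radial_generators \<alpha> \<delta> :: (real^'n \<Rightarrow> real) set"
  note gI = generated.generator[OF radial_generators_I(1)] generated.generator[OF radial_generators_I(2)]
    generated.generator[OF radial_generators_I(3)] generated.generator[OF radial_generators_I(4)]
  have pos: "x \<bullet> x + \<delta> > 0" for x :: "real^'n" using \<delta> by (simp add: add_nonneg_pos)
  have d1: "((\<lambda>r. (r + \<delta>) powr b) has_real_derivative b * (x \<bullet> x + \<delta>) powr (b - 1)) (at (x \<bullet> x))"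
    for b and x :: "real^'n"
    by (rule has_real_derivative_shift, rule has_real_derivative_powr) (rule pos)
  have d2: "((\<lambda>r. profile \<alpha> (r + \<delta>)) has_real_derivative profile1 \<alpha> (x \<bullet> x + \<delta>)) (at (x \<bullet> x))" for x :: "real^'n"
    by (rule has_real_derivative_shift, rule profile_derivatives[OF \<alpha> pos])
  have diff: "(\<lambda>x. G (x \<bullet> x)) differentiable (at x)" if "(G has_real_derivative G') (at (x \<bullet> x))" for G G' and x :: "real^'n"
    using has_derivative_radial[OF that] by (rule differentiableI)
  have F1: "f differentiable (at x)" if f: "f \<in> ?F" for f x
    using that unfolding radial_generators_def
    by (auto intro: diff[OF d1] diff[OF d2] diff[OF bump_scaled_derivative] differentiableI[OF has_derivative_component])
  have F2: "generated ?F (partial i f)" if f: "f \<in> ?F" for f i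
  proof -
    consider j where "f = (\<lambda>x. x $ j)" | b where "f = (\<lambda>x. (x \<bullet> x + \<delta>) powr b)"
      | "f = (\<lambda>x. profile \<alpha> (x \<bullet> x + \<delta>))" | j where "f = (\<lambda>x. bump j (1 - \<delta> * (x \<bullet> x)))"
      using f unfolding radial_generators_def by auto
    then show ?thesis
    proof cases
      case 1
      then show ?thesis by (simp add: partial_component generated.const)
    next
      case (2 b)
      have "partial i f = (\<lambda>x. (2 * b) * ((x \<bullet> x + \<delta>) powr (b - 1) * x $ i))"
        unfolding 2 by (rule ext) (simp add: partial_radial[OF d1])
      then show ?thesis by (simp only:) (intro generated.mult generated.const gI)
    next
      case 3
      have "partial i f = (\<lambda>x. (- 1) * ((x \<bullet> x + \<delta>) powr \<alpha> * (profile \<alpha> (x \<bullet> x + \<delta>) * x $ i)))"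
        unfolding 3 by (rule ext) (simp add: partial_radial[OF d2] profile1_def)
      then show ?thesis by (simp only:) (intro generated.mult generated.const gI)
    next
      case (4 j)
      have "partial i f = (\<lambda>x. (- 2 * \<delta>) * ((bump (j + 2) (1 - \<delta> * (x \<bullet> x))
          + (- real j) * bump (j + 1) (1 - \<delta> * (x \<bullet> x))) * x $ i))"
        unfolding 4 by (rule ext) (simp add: partial_radial[OF bump_scaled_derivative])
      then show ?thesis by (simp only:) (intro generated.mult generated.add generated.const gI)
    qed
  qed
  have "generated ?F (\<lambda>x. approximant \<alpha> \<delta> (x \<bullet> x))"
    unfolding approximant_def by (intro generated.mult generated.const gI)
  from generated_smooth[OF F1 F2 this]
  have "foldr partial is (\<lambda>x::real^'n. approximant \<alpha> \<delta> (x \<bullet> x)) differentiable_on UNIV" for "is"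
    by (simp add: differentiable_on_def)
  moreover have "{x::real^'n. approximant \<alpha> \<delta> (x \<bullet> x) \<noteq> 0} \<subseteq> cball 0 (sqrt (1 / \<delta>))"
  proof
    fix x :: "real^'n" assume "x \<in> {x. approximant \<alpha> \<delta> (x \<bullet> x) \<noteq> 0}"
    then have "1 - \<delta> * (x \<bullet> x) > 0" by (auto simp: approximant_def bump_def split: if_splits)
    then have "(norm x)\<^sup>2 \<le> 1 / \<delta>" using \<delta> by (simp add: power2_norm_eq_inner field_simps)
    then show "x \<in> cball 0 (sqrt (1 / \<delta>))" by (simp add: real_le_rsqrt)
  qed
  then have "compact (closure {x::real^'n. approximant \<alpha> \<delta> (x \<bullet> x) \<noteq> 0})"
    using bounded_subset[OF bounded_cball] by (simp add: compact_closure)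
  ultimately show ?thesis by (simp add: test_function_def)
qed

definition approximant1 :: "real \<Rightarrow> real \<Rightarrow> real \<Rightarrow> real" where
  "approximant1 \<alpha> \<delta> r = exp 1 * (profile1 \<alpha> (r + \<delta>) * bump 0 (1 - \<delta> * r)
     - \<delta> * (profile \<alpha> (r + \<delta>) * bump 2 (1 - \<delta> * r)))"

definition approximant2 :: "real \<Rightarrow> real \<Rightarrow> real \<Rightarrow> real" where
  "approximant2 \<alpha> \<delta> r = exp 1 * (profile2 \<alpha> (r + \<delta>) * bump 0 (1 - \<delta> * r)
     - 2 * \<delta> * (profile1 \<alpha> (r + \<delta>) * bump 2 (1 - \<delta> * r))
     + \<delta>\<^sup>2 * (profile \<alpha> (r + \<delta>) * (bump 4 (1 - \<delta> * r) - 2 * bump 3 (1 - \<delta> * r))))"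

lemma approximant_derivatives:
  assumes \<alpha>: "1 + \<alpha> > 0" and r: "r + \<delta> > 0"
  shows "(approximant \<alpha> \<delta> has_real_derivative approximant1 \<alpha> \<delta> r) (at r)"
    and "(approximant1 \<alpha> \<delta> has_real_derivative approximant2 \<alpha> \<delta> r) (at r)"
proof -
  have p: "((\<lambda>r. profile \<alpha> (r + \<delta>)) has_real_derivative profile1 \<alpha> (r + \<delta>)) (at r)"
    by (rule has_real_derivative_shift, rule profile_derivatives[OF \<alpha> r])
  have p1: "((\<lambda>r. profile1 \<alpha> (r + \<delta>)) has_real_derivative profile2 \<alpha> (r + \<delta>)) (at r)"
    by (rule has_real_derivative_shift, rule profile_derivatives[OF \<alpha> r])
  have b0: "((\<lambda>r. bump 0 (1 - \<delta> * r)) has_real_derivative - \<delta> * bump 2 (1 - \<delta> * r)) (at r)"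
    using bump_scaled_derivative[of 0 \<delta> r] by (simp add: numeral_2_eq_2)
  have b2: "((\<lambda>r. bump 2 (1 - \<delta> * r)) has_real_derivative - \<delta> * (bump 4 (1 - \<delta> * r) - 2 * bump 3 (1 - \<delta> * r))) (at r)"
    using bump_scaled_derivative[of 2 \<delta> r] by simp
  show "(approximant \<alpha> \<delta> has_real_derivative approximant1 \<alpha> \<delta> r) (at r)"
    unfolding approximant_def[abs_def] approximant1_def
    by (rule DERIV_cong[OF DERIV_cmult[OF DERIV_mult[OF p b0]]]) (simp add: algebra_simps)
  show "(approximant1 \<alpha> \<delta> has_real_derivative approximant2 \<alpha> \<delta> r) (at r)"
    unfolding approximant1_def[abs_def] approximant2_def
    by (rule DERIV_cong[OF DERIV_cmult[OF DERIV_diff[OF DERIV_mult[OF p1 b0] DERIV_cmult[OF DERIV_mult[OF p b2]]]]])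
       (simp add: algebra_simps power2_eq_square)
qed

lemma approximant_limits:
  assumes \<alpha>: "1 + \<alpha> > 0" and r: "r > 0" and \<delta>: "\<delta> \<longlonglongrightarrow> 0"
  shows "(\<lambda>k. approximant \<alpha> (\<delta> k) r) \<longlonglongrightarrow> profile \<alpha> r"
    and "(\<lambda>k. approximant1 \<alpha> (\<delta> k) r) \<longlonglongrightarrow> profile1 \<alpha> r"
    and "(\<lambda>k. approximant2 \<alpha> (\<delta> k) r) \<longlonglongrightarrow> profile2 \<alpha> r"
proof -
  have rd: "(\<lambda>k. r + \<delta> k) \<longlonglongrightarrow> r" using tendsto_add[OF tendsto_const \<delta>, of r] by simp
  have p: "(\<lambda>k. profile \<alpha> (r + \<delta> k)) \<longlonglongrightarrow> profile \<alpha> r"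
    by (rule isCont_tendsto_compose[OF DERIV_isCont[OF profile_derivatives(1)[OF \<alpha> r]] rd])
  have p1: "(\<lambda>k. profile1 \<alpha> (r + \<delta> k)) \<longlonglongrightarrow> profile1 \<alpha> r"
    unfolding profile1_def using r by (intro tendsto_intros rd p) auto
  have p2: "(\<lambda>k. profile2 \<alpha> (r + \<delta> k)) \<longlonglongrightarrow> profile2 \<alpha> r"
    unfolding profile2_def using r by (intro tendsto_intros rd p) auto
  have "(\<lambda>k. 1 - \<delta> k * r) \<longlonglongrightarrow> 1 - 0 * r" by (intro tendsto_intros \<delta>)
  then have "(\<lambda>k. 1 - \<delta> k * r) \<longlonglongrightarrow> 1" by simp
  from isCont_tendsto_compose[OF DERIV_isCont[OF bump_has_derivative] this]
  have b: "(\<lambda>k. bump j (1 - \<delta> k * r)) \<longlonglongrightarrow> exp (- 1)" for j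
    by (simp add: bump_def)
  have e: "exp 1 * (y * exp (- 1)) = (y::real)" for y
    by (simp flip: exp_add)
  have "(\<lambda>k. approximant \<alpha> (\<delta> k) r) \<longlonglongrightarrow> exp 1 * (profile \<alpha> r * exp (- 1))"
    unfolding approximant_def by (intro tendsto_intros p b)
  then show "(\<lambda>k. approximant \<alpha> (\<delta> k) r) \<longlonglongrightarrow> profile \<alpha> r" unfolding e .
  have "(\<lambda>k. approximant1 \<alpha> (\<delta> k) r) \<longlonglongrightarrow> exp 1 * (profile1 \<alpha> r * exp (- 1) - 0 * (profile \<alpha> r * exp (- 1)))"
    unfolding approximant1_def by (intro tendsto_intros p p1 b \<delta>)
  then show "(\<lambda>k. approximant1 \<alpha> (\<delta> k) r) \<longlonglongrightarrow> profile1 \<alpha> r" by (simp only: e mult_zero_left diff_zero)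
  have "(\<lambda>k. approximant2 \<alpha> (\<delta> k) r) \<longlonglongrightarrow> exp 1 * (profile2 \<alpha> r * exp (- 1) - 2 * 0 * (profile1 \<alpha> r * exp (- 1))
      + 0\<^sup>2 * (profile \<alpha> r * (exp (- 1) - 2 * exp (- 1))))"
    unfolding approximant2_def by (intro tendsto_intros p p1 p2 b \<delta>)
  then show "(\<lambda>k. approximant2 \<alpha> (\<delta> k) r) \<longlonglongrightarrow> profile2 \<alpha> r"
    by (simp only: e mult_zero_left mult_zero_right diff_zero zero_power2 add_0_right)
qed

text \<open>The bounds are uniform in \<delta>, as dominated convergence demands. The second
  derivative comes with the factor r that it carries in the Laplacian; this factor absorbs the
  exponent \<open>\<alpha> - 1\<close>, because
  \<open>r (r+\<delta>)^(\<alpha>-1) \<le> (r+\<delta>)^\<alpha>\<close>. In \<open>K\<close>, the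
  summands \<open>1 + |\<alpha>|\<close>, 4 and 36 come from the three terms of
  \<open>approximant2\<close>, using \<open>bump j \<le> j!\<close>, and \<open>exp 1\<close> is the
  prefactor.\<close>

lemma approximant_bounds:
  fixes \<alpha> \<delta> r :: real
  defines "K \<equiv> exp 1 * (41 + \<bar>\<alpha>\<bar>)"
    and "W \<equiv> r powr min \<alpha> 0 * (1 + r) powr (1 + 2 * \<bar>\<alpha>\<bar>) * profile \<alpha> r"
  assumes \<alpha>: "1 + \<alpha> > 0" and r: "r > 0" and \<delta>: "0 < \<delta>" "\<delta> \<le> 1"
  shows "\<bar>approximant1 \<alpha> \<delta> r\<bar> \<le> K * W" and "r * \<bar>approximant2 \<alpha> \<delta> r\<bar> \<le> K * W"
proof -
  define s where "s = r + \<delta>"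
  have s: "s > 0" "r \<le> s" "s \<le> 1 + r" using r \<delta> by (auto simp: s_def)
  define p where "p = profile \<alpha> s"
  define P where "P = profile \<alpha> r"
  have p: "0 < p" "p \<le> P"
  proof -
    have "r powr (1 + \<alpha>) \<le> s powr (1 + \<alpha>)" using r s \<alpha> by (intro powr_mono2) auto
    then show "p \<le> P" using \<alpha> by (simp add: p_def P_def profile_def divide_right_mono)
  qed (simp add: p_def profile_def)
  \<comment> \<open>\<open>T\<close> dominates both \<open>(r+\<delta>)^\<alpha>\<close> and 1 for
    either sign of \<alpha>: a negative power is largest at r, a nonnegative one at 1 + r.
    \<open>Z\<close> dominates \<open>1 + r\<close> and, because \<alpha> > -1, also
    \<open>r * T\<close>.\<close>
  define T where "T = r powr min \<alpha> 0 * (1 + r) powr \<bar>\<alpha>\<bar>"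
  define Z where "Z = (1 + r) powr (1 + \<bar>\<alpha>\<bar>)"
  have Zr: "1 + r \<le> Z" unfolding Z_def using r powr_mono[of 1 "1 + \<bar>\<alpha>\<bar>" "1 + r"] by simp
  have W: "W = Z * T * P"
  proof -
    have "1 + 2 * \<bar>\<alpha>\<bar> = (1 + \<bar>\<alpha>\<bar>) + \<bar>\<alpha>\<bar>" by simp
    then show ?thesis unfolding W_def Z_def T_def P_def by (simp only: powr_add mult_ac)
  qed
  have sT: "s powr \<alpha> \<le> T"
  proof (cases "\<alpha> < 0")
    case True
    have "s powr \<alpha> * 1 \<le> r powr \<alpha> * (1 + r) powr \<bar>\<alpha>\<bar>"
      using True r s by (intro mult_mono powr_mono2') (auto simp: ge_one_powr_ge_zero)
    then show ?thesis using True by (simp add: T_def)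
  next
    case False
    then have "s powr \<alpha> \<le> (1 + r) powr \<alpha>" using s by (intro powr_mono2) auto
    then show ?thesis using False r by (simp add: T_def)
  qed
  have T1: "1 \<le> T"
  proof (cases "\<alpha> < 0")
    case True
    have "r powr (- \<alpha>) \<le> (1 + r) powr (- \<alpha>)" using True r by (intro powr_mono2) auto
    then have "r powr \<alpha> * r powr (- \<alpha>) \<le> r powr \<alpha> * (1 + r) powr (- \<alpha>)"
      by (rule mult_left_mono) simp
    moreover have "r powr \<alpha> * r powr (- \<alpha>) = 1" using r by (simp flip: powr_add)
    ultimately show ?thesis using True by (simp add: T_def)
  next
    case False
    then show ?thesis using r by (simp add: T_def ge_one_powr_ge_zero)
  qed
  have s2: "r * s powr (2 * \<alpha>) \<le> Z * T"
  proof -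
    have "r * s powr (2 * \<alpha>) = r * s powr \<alpha> * s powr \<alpha>" by (simp flip: powr_add)
    also have "\<dots> \<le> r * T * T" using sT r T1 by (intro mult_mono) auto
    also have "r * T = r powr (1 + min \<alpha> 0) * (1 + r) powr \<bar>\<alpha>\<bar>"
      using r by (simp add: T_def powr_add)
    also have "\<dots> \<le> (1 + r) powr 1 * (1 + r) powr \<bar>\<alpha>\<bar>"
    proof (intro mult_right_mono)
      have "r powr (1 + min \<alpha> 0) \<le> (1 + r) powr (1 + min \<alpha> 0)" using r \<alpha> by (intro powr_mono2) auto
      also have "\<dots> \<le> (1 + r) powr 1" using r by (intro powr_mono) auto
      finally show "r powr (1 + min \<alpha> 0) \<le> (1 + r) powr 1" .
    qed simp
    also have "\<dots> = Z" unfolding Z_def by (simp only: powr_add)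
    finally show ?thesis using T1 by (simp add: mult_right_mono)
  qed
  have s3: "r * s powr (\<alpha> - 1) \<le> T"
  proof -
    have "r * s powr (\<alpha> - 1) \<le> s * s powr (\<alpha> - 1)" using s by (intro mult_right_mono) auto
    also have "\<dots> = s powr \<alpha>" using s by (simp add: powr_diff)
    finally show ?thesis using sT by linarith
  qed
  have q1: "\<bar>profile1 \<alpha> s\<bar> \<le> T * p"
    using sT T1 p(1) by (simp add: profile1_def p_def[symmetric] abs_mult mult_right_mono)
  have q2: "r * \<bar>profile2 \<alpha> s\<bar> \<le> (1 + \<bar>\<alpha>\<bar>) * (Z * T) * p"
  proof -
    have "r * \<bar>s powr (2 * \<alpha>) / 4 - \<alpha> * s powr (\<alpha> - 1) / 2\<bar>
      \<le> r * (s powr (2 * \<alpha>) / 4 + \<bar>\<alpha>\<bar> * s powr (\<alpha> - 1) / 2)"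
      using r abs_triangle_ineq4[of "s powr (2 * \<alpha>) / 4" "\<alpha> * s powr (\<alpha> - 1) / 2"]
      by (intro mult_left_mono) (auto simp: abs_mult)
    also have "\<dots> = r * s powr (2 * \<alpha>) / 4 + \<bar>\<alpha>\<bar> * (r * s powr (\<alpha> - 1)) / 2"
      by (simp add: algebra_simps)
    also have "\<dots> \<le> Z * T + \<bar>\<alpha>\<bar> * (Z * T)"
    proof (rule add_mono)
      have "0 \<le> Z * T" using Zr r T1 by (intro mult_nonneg_nonneg) auto
      then show "r * s powr (2 * \<alpha>) / 4 \<le> Z * T" using s2 by linarith
      have "1 * T \<le> Z * T" using Zr r T1 by (intro mult_right_mono) auto
      then have "\<bar>\<alpha>\<bar> * (r * s powr (\<alpha> - 1)) \<le> \<bar>\<alpha>\<bar> * (Z * T)"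
        using s3 by (intro mult_left_mono) auto
      moreover have "0 \<le> \<bar>\<alpha>\<bar> * (Z * T)" using \<open>0 \<le> Z * T\<close> by simp
      ultimately show "\<bar>\<alpha>\<bar> * (r * s powr (\<alpha> - 1)) / 2 \<le> \<bar>\<alpha>\<bar> * (Z * T)" by linarith
    qed
    finally have "r * \<bar>s powr (2 * \<alpha>) / 4 - \<alpha> * s powr (\<alpha> - 1) / 2\<bar> \<le> (1 + \<bar>\<alpha>\<bar>) * (Z * T)"
      by (simp add: algebra_simps)
    from mult_right_mono[OF this, of p] p(1) show ?thesis
      by (simp add: profile2_def p_def[symmetric] abs_mult mult.assoc)
  qed
  define b where "b j = bump j (1 - \<delta> * r)" for j
  have b: "0 \<le> b j" "b j \<le> fact j" for j
    unfolding b_def by (rule bump_nonneg bump_le_fact)+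
  have b0: "b 0 \<le> 1" and b2: "b 2 \<le> 2" and b3: "b 3 \<le> 6" and b4: "b 4 \<le> 24"
    using b(2)[of 0] b(2)[of 2] b(2)[of 3] b(2)[of 4] by (simp_all add: fact_numeral)
  have TpW: "T * p \<le> W" "r * (T * p) \<le> W" "r * p \<le> W" "Z * T * p \<le> W"
  proof -
    have "1 * T * p \<le> Z * T * P" "r * T * p \<le> Z * T * P" "r * 1 * p \<le> Z * T * P" "Z * T * p \<le> Z * T * P"
      using Zr T1 p r by (intro mult_mono mult_nonneg_nonneg; simp)+
    then show "T * p \<le> W" "r * (T * p) \<le> W" "r * p \<le> W" "Z * T * p \<le> W"
      by (simp_all add: W mult.assoc)
  qed
  have W0: "0 \<le> W" using order_trans[OF _ TpW(3)] r p by simp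
  have pT: "p \<le> T * p" using T1 p by simp
  show "\<bar>approximant1 \<alpha> \<delta> r\<bar> \<le> K * W"
  proof -
    have "\<bar>profile1 \<alpha> s * b 0 - \<delta> * (p * b 2)\<bar> \<le> \<bar>profile1 \<alpha> s\<bar> * b 0 + \<delta> * (p * b 2)"
      using abs_triangle_ineq4[of "profile1 \<alpha> s * b 0" "\<delta> * (p * b 2)"] b \<delta> p by (simp add: abs_mult)
    also have "\<dots> \<le> T * p * 1 + 1 * (p * 2)"
      using q1 b0 b2 b \<delta> p T1 by (intro add_mono mult_mono) auto
    also have "\<dots> \<le> 3 * W" using pT TpW by simp
    also have "\<dots> \<le> (41 + \<bar>\<alpha>\<bar>) * W" using W0 by (intro mult_right_mono) auto
    finally have "exp 1 * \<bar>profile1 \<alpha> s * b 0 - \<delta> * (p * b 2)\<bar> \<le> exp 1 * ((41 + \<bar>\<alpha>\<bar>) * W)"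
      by (intro mult_left_mono) auto
    then show ?thesis
      by (simp add: approximant1_def K_def b_def s_def p_def abs_mult mult.assoc)
  qed
  show "r * \<bar>approximant2 \<alpha> \<delta> r\<bar> \<le> K * W"
  proof -
    let ?A = "profile2 \<alpha> s * b 0" and ?B = "2 * \<delta> * (profile1 \<alpha> s * b 2)" and ?C = "\<delta>\<^sup>2 * (p * (b 4 - 2 * b 3))"
    have A: "r * \<bar>?A\<bar> \<le> (1 + \<bar>\<alpha>\<bar>) * W"
    proof -
      have "r * \<bar>?A\<bar> = r * \<bar>profile2 \<alpha> s\<bar> * b 0" using b by (simp add: abs_mult)
      also have "\<dots> \<le> r * \<bar>profile2 \<alpha> s\<bar> * 1" using b0 r by (intro mult_left_mono) auto
      also have "\<dots> \<le> (1 + \<bar>\<alpha>\<bar>) * (Z * T * p)" using q2 by (simp add: mult.assoc)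
      also have "\<dots> \<le> (1 + \<bar>\<alpha>\<bar>) * W" using TpW by (intro mult_left_mono) auto
      finally show ?thesis .
    qed
    have B: "r * \<bar>?B\<bar> \<le> 4 * W"
    proof -
      have "r * \<bar>?B\<bar> = 2 * \<delta> * (r * (\<bar>profile1 \<alpha> s\<bar> * b 2))" using b \<delta> by (simp add: abs_mult)
      also have "\<dots> \<le> 2 * 1 * (r * (T * p * 2))"
        using \<delta> r q1 b b2 p T1 by (intro mult_mono) auto
      also have "\<dots> \<le> 4 * W" using TpW by simp
      finally show ?thesis .
    qed
    have C: "r * \<bar>?C\<bar> \<le> 36 * W"
    proof -
      have "\<bar>b 4 - 2 * b 3\<bar> \<le> 36" using b3 b4 b(1)[of 3] b(1)[of 4] by (auto simp: abs_le_iff)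
      moreover have "\<delta>\<^sup>2 \<le> 1" using \<delta> by (simp add: power_le_one)
      ultimately have "\<delta>\<^sup>2 * (r * p * \<bar>b 4 - 2 * b 3\<bar>) \<le> 1 * (r * p * 36)"
        using r p by (intro mult_mono) auto
      moreover have "r * \<bar>?C\<bar> = \<delta>\<^sup>2 * (r * p * \<bar>b 4 - 2 * b 3\<bar>)"
        using p(1) by (simp only: abs_mult abs_power2 abs_of_pos mult_ac)
      ultimately have "r * \<bar>?C\<bar> \<le> 36 * (r * p)" by linarith
      also have "\<dots> \<le> 36 * W" using TpW by simp
      finally show ?thesis .
    qed
    have "\<bar>?A - ?B + ?C\<bar> \<le> \<bar>?A\<bar> + \<bar>?B\<bar> + \<bar>?C\<bar>" by linarith
    then have "r * \<bar>?A - ?B + ?C\<bar> \<le> r * (\<bar>?A\<bar> + \<bar>?B\<bar> + \<bar>?C\<bar>)" using r by (intro mult_left_mono) auto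
    also have "\<dots> \<le> (1 + \<bar>\<alpha>\<bar>) * W + 4 * W + 36 * W"
      unfolding distrib_left by (intro add_mono A B C)
    also have "\<dots> = (41 + \<bar>\<alpha>\<bar>) * W" by (simp add: distrib_right)
    finally have "exp 1 * (r * \<bar>?A - ?B + ?C\<bar>) \<le> exp 1 * ((41 + \<bar>\<alpha>\<bar>) * W)"
      by (intro mult_left_mono) auto
    then show ?thesis
      by (simp add: approximant2_def K_def b_def s_def p_def abs_mult mult_ac)
  qed
qed

section \<open>Membership of the extremal function in the completion\<close>

lemma weighted_L2_dominated:
  fixes f :: "nat \<Rightarrow> 'a \<Rightarrow> 'b::{real_normed_vector, second_countable_topology}" and w h :: "'a \<Rightarrow> real"
  assumes [measurable]: "\<And>k. f k \<in> borel_measurable M" "g \<in> borel_measurable M" "w \<in> borel_measurable M"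
    and w: "\<And>x. w x \<ge> 0"
    and bound: "AE x in M. \<forall>k. norm (f k x) \<le> h x"
    and lim: "AE x in M. (\<lambda>k. f k x) \<longlonglongrightarrow> g x"
    and h: "integrable M (\<lambda>x. (h x)\<^sup>2 * w x)"
  shows "(\<lambda>k. \<integral>\<^sup>+x. ennreal ((norm (f k x - g x))\<^sup>2 * w x) \<partial>M) \<longlonglongrightarrow> 0"
proof -
  have hm: "(\<lambda>x. ennreal (4 * ((h x)\<^sup>2 * w x))) \<in> borel_measurable M"
    using borel_measurable_integrable[OF h] by measurable
  have "(\<lambda>k. \<integral>\<^sup>+x. ennreal ((norm (f k x - g x))\<^sup>2 * w x) \<partial>M) \<longlonglongrightarrow> (\<integral>\<^sup>+x. ennreal 0 \<partial>M)"
  proof (rule nn_integral_dominated_convergence[where w = "\<lambda>x. ennreal (4 * ((h x)\<^sup>2 * w x))"])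
    have "integrable M (\<lambda>x. 4 * ((h x)\<^sup>2 * w x))" using h by simp
    then show "(\<integral>\<^sup>+x. ennreal (4 * ((h x)\<^sup>2 * w x)) \<partial>M) < \<infinity>"
    proof -
      have "norm (4 * ((h x)\<^sup>2 * w x)) = 4 * ((h x)\<^sup>2 * w x)" for x
        using w[of x] by (simp add: abs_mult)
      then show ?thesis using \<open>integrable M (\<lambda>x. 4 * ((h x)\<^sup>2 * w x))\<close>
        unfolding integrable_iff_bounded by (simp only:)
    qed
    show "AE x in M. ennreal ((norm (f j x - g x))\<^sup>2 * w x) \<le> ennreal (4 * ((h x)\<^sup>2 * w x))" for j
      using bound lim
    proof eventually_elim
      case (elim x)
      \<comment> \<open>The limit inherits the bound h, so the squared difference is at most
        \<open>4 h^2\<close>, the majorant chosen above.\<close>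
      have "norm (g x) \<le> h x"
        using elim by (intro tendsto_upperbound[OF tendsto_norm]) auto
      then have "norm (f j x - g x) \<le> 2 * h x"
        using spec[OF elim(1), of j] norm_triangle_ineq4[of "f j x" "g x"] by linarith
      then have "(norm (f j x - g x))\<^sup>2 \<le> (2 * h x)\<^sup>2" by (intro power_mono) auto
      then have "(norm (f j x - g x))\<^sup>2 * w x \<le> (2 * h x)\<^sup>2 * w x" using w by (rule mult_right_mono)
      then show ?case by (intro ennreal_leI) (simp add: power_mult_distrib)
    qed
    show "AE x in M. (\<lambda>k. ennreal ((norm (f k x - g x))\<^sup>2 * w x)) \<longlonglongrightarrow> ennreal 0"
      using lim
    proof eventually_elim
      case (elim x)
      have "(\<lambda>k. (norm (f k x - g x))\<^sup>2 * w x) \<longlonglongrightarrow> (norm (g x - g x))\<^sup>2 * w x"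
        by (intro tendsto_intros elim)
      then show ?case by (intro tendsto_ennrealI) simp
    qed
  qed (use hm in measurable)
  then show ?thesis by simp
qed

text \<open>Inserting the common limit c and using \<open>(p + q)^2 \<le> 2 p^2 + 2 q^2\<close>
  turns convergence to c into the Cauchy property.\<close>

lemma nn_integral_weighted_square_diff_le:
  fixes a b c :: "'a \<Rightarrow> 'b::{real_normed_vector, second_countable_topology}" and w :: "'a \<Rightarrow> real"
  assumes [measurable]: "a \<in> borel_measurable M" "b \<in> borel_measurable M" "c \<in> borel_measurable M" "w \<in> borel_measurable M"
    and w: "\<And>x. w x \<ge> 0"
  shows "(\<integral>\<^sup>+x. ennreal ((norm (a x - b x))\<^sup>2 * w x) \<partial>M)
    \<le> 2 * (\<integral>\<^sup>+x. ennreal ((norm (a x - c x))\<^sup>2 * w x) \<partial>M) + 2 * (\<integral>\<^sup>+x. ennreal ((norm (b x - c x))\<^sup>2 * w x) \<partial>M)"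
proof -
  have le: "(norm (a x - b x))\<^sup>2 * w x \<le> 2 * ((norm (a x - c x))\<^sup>2 * w x) + 2 * ((norm (b x - c x))\<^sup>2 * w x)" for x
  proof -
    have "norm (a x - b x) \<le> norm (a x - c x) + norm (b x - c x)"
      using norm_triangle_ineq4[of "a x - c x" "b x - c x"] by simp
    then have "(norm (a x - b x))\<^sup>2 \<le> (norm (a x - c x) + norm (b x - c x))\<^sup>2" by (intro power_mono) auto
    also have "\<dots> \<le> 2 * (norm (a x - c x))\<^sup>2 + 2 * (norm (b x - c x))\<^sup>2"
      using zero_le_power2[of "norm (a x - c x) - norm (b x - c x)"] by (simp add: power2_eq_square algebra_simps)
    finally have "(norm (a x - b x))\<^sup>2 * w x \<le> (2 * (norm (a x - c x))\<^sup>2 + 2 * (norm (b x - c x))\<^sup>2) * w x"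
      using w by (rule mult_right_mono)
    then show ?thesis by (simp add: algebra_simps)
  qed
  have "(\<integral>\<^sup>+x. ennreal ((norm (a x - b x))\<^sup>2 * w x) \<partial>M)
    \<le> (\<integral>\<^sup>+x. 2 * ennreal ((norm (a x - c x))\<^sup>2 * w x) + 2 * ennreal ((norm (b x - c x))\<^sup>2 * w x) \<partial>M)"
  proof (intro nn_integral_mono)
    fix x
    have "ennreal (2 * p + 2 * q) = 2 * ennreal p + 2 * ennreal q" if "0 \<le> p" "0 \<le> q" for p q
      using that by (subst ennreal_plus) (auto simp: ennreal_mult)
    note this[of "(norm (a x - c x))\<^sup>2 * w x" "(norm (b x - c x))\<^sup>2 * w x"]
    then show "ennreal ((norm (a x - b x))\<^sup>2 * w x)
      \<le> 2 * ennreal ((norm (a x - c x))\<^sup>2 * w x) + 2 * ennreal ((norm (b x - c x))\<^sup>2 * w x)"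
      using le[of x] w[of x] by (metis ennreal_leI mult_nonneg_nonneg zero_le_power2)
  qed
  then show ?thesis by (simp add: nn_integral_add nn_integral_cmult)
qed

lemma test_function_measurable:
  assumes "test_function f"
  shows "grad f \<in> borel_measurable borel" "laplacian f \<in> borel_measurable borel"
proof -
  obtain R where R: "\<And>x. norm x > R \<Longrightarrow> f x = 0"
    using test_function_support[OF assms] by blast
  show "grad f \<in> borel_measurable borel" "laplacian f \<in> borel_measurable borel"
    using test_function_integrable(4,5)[OF assms R] by auto
qed

lemma H2_elementI:
  fixes u :: "real^'n::finite \<Rightarrow> real"
  assumes \<phi>: "\<And>k. test_function (\<phi> k)"
    and m[measurable]: "u \<in> borel_measurable borel" "Du \<in> borel_measurable borel" "Lu \<in> borel_measurable borel"
    and ae: "AE x in lborel. (\<lambda>k. \<phi> k x) \<longlonglongrightarrow> u x"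
    and limD: "(\<lambda>k. \<integral>\<^sup>+x. ennreal ((norm (grad (\<phi> k) x - Du x))\<^sup>2 * norm x powr (- \<beta>)) \<partial>lborel) \<longlonglongrightarrow> 0"
    and limL: "(\<lambda>k. \<integral>\<^sup>+x. ennreal ((laplacian (\<phi> k) x - Lu x)\<^sup>2 * norm x powr (- 2 * \<alpha>)) \<partial>lborel) \<longlonglongrightarrow> 0"
  shows "H2_element \<alpha> \<beta> u Du Lu"
proof -
  note [measurable] = test_function_measurable[OF \<phi>]
  define E where "E k = (\<integral>\<^sup>+x. ennreal ((norm (grad (\<phi> k) x - Du x))\<^sup>2 * norm x powr (- \<beta>)) \<partial>lborel)" for k
  define F where "F k = (\<integral>\<^sup>+x. ennreal ((norm (laplacian (\<phi> k) x - Lu x))\<^sup>2 * norm x powr (- 2 * \<alpha>)) \<partial>lborel)" for k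
  have "\<exists>N. \<forall>j\<ge>N. \<forall>k\<ge>N. H2_norm \<alpha> \<beta> (\<lambda>x. \<phi> j x - \<phi> k x) < e" if e: "e > 0" for e
  proof -
    \<comment> \<open>Each of the two integrals in the norm is then at most
      \<open>4 * ?e = e\<^sup>2 / 4\<close>, and their sum \<open>e\<^sup>2 / 2\<close> is strictly
      below \<open>e\<^sup>2\<close>.\<close>
    let ?e = "e\<^sup>2 / 16"
    have e2: "?e > 0" using e by simp
    have "E \<longlonglongrightarrow> 0" "F \<longlonglongrightarrow> 0" using limD limL by (simp_all add: E_def[abs_def] F_def[abs_def])
    then have "eventually (\<lambda>k. E k < ennreal ?e \<and> F k < ennreal ?e) sequentially"
      using e2 by (intro eventually_conj order_tendstoD(2)) (auto simp del: ennreal_divide_numeral)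
    then obtain N where N: "\<And>k. k \<ge> N \<Longrightarrow> E k < ennreal ?e" "\<And>k. k \<ge> N \<Longrightarrow> F k < ennreal ?e"
      by (auto simp: eventually_sequentially)
    show ?thesis
    proof (intro exI[of _ N] allI impI)
      fix j k assume jk: "j \<ge> N" "k \<ge> N"
      note d = test_function_differentiable[OF \<phi>, of "[]", simplified] test_function_differentiable[OF \<phi>, of "[_]", simplified]
      have p: "partial i (\<lambda>x. \<phi> j x - \<phi> k x) = (\<lambda>x. partial i (\<phi> j) x - partial i (\<phi> k) x)" for i
        by (intro ext partial_diff d)
      have g: "grad (\<lambda>x. \<phi> j x - \<phi> k x) x = grad (\<phi> j) x - grad (\<phi> k) x" for x
        by (simp add: grad_def p vec_eq_iff)
      have l: "laplacian (\<lambda>x. \<phi> j x - \<phi> k x) x = laplacian (\<phi> j) x - laplacian (\<phi> k) x" for x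
        unfolding laplacian_def p by (simp add: partial_diff d sum_subtractf)
      have small: "2 * a + 2 * b \<le> ennreal (e\<^sup>2 / 4)" if "a < ennreal ?e" "b < ennreal ?e" for a b
      proof -
        have "2 * q = q + q" for q :: ennreal by (rule mult_2)
        then have "2 * a + 2 * b \<le> (ennreal ?e + ennreal ?e) + (ennreal ?e + ennreal ?e)"
          using that by (simp only:) (intro add_mono less_imp_le)
        also have "\<dots> = ennreal ((?e + ?e) + (?e + ?e))"
          using e2 by (simp only: ennreal_plus less_imp_le add_nonneg_nonneg)
        finally show ?thesis by simp
      qed
      have int_le: "(\<integral>x. f x \<partial>lborel) \<le> B"
        if "f \<in> borel_measurable borel" "\<And>x. f x \<ge> 0" "(\<integral>\<^sup>+x. ennreal (f x) \<partial>lborel) \<le> ennreal B" "B \<ge> 0"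
        for f :: "real^'n \<Rightarrow> real" and B
        using that by (subst integral_eq_nn_integral) (auto intro: enn2real_leI)
      have 1: "(\<integral>x. (norm (grad (\<phi> j) x - grad (\<phi> k) x))\<^sup>2 * norm x powr (- \<beta>) \<partial>lborel) \<le> e\<^sup>2 / 4"
      proof -
        have "(\<integral>\<^sup>+x. ennreal ((norm (grad (\<phi> j) x - grad (\<phi> k) x))\<^sup>2 * norm x powr (- \<beta>)) \<partial>lborel) \<le> 2 * E j + 2 * E k"
          unfolding E_def by (rule nn_integral_weighted_square_diff_le) (auto simp: test_function_measurable[OF \<phi>] m)
        also have "\<dots> \<le> ennreal (e\<^sup>2 / 4)" by (rule small) (use N jk in auto)
        finally show ?thesis
          by (intro int_le) auto
      qed
      have 2: "(\<integral>x. (laplacian (\<phi> j) x - laplacian (\<phi> k) x)\<^sup>2 * norm x powr (- 2 * \<alpha>) \<partial>lborel) \<le> e\<^sup>2 / 4"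
      proof -
        have "(\<integral>\<^sup>+x. ennreal ((norm (laplacian (\<phi> j) x - laplacian (\<phi> k) x))\<^sup>2 * norm x powr (- 2 * \<alpha>)) \<partial>lborel) \<le> 2 * F j + 2 * F k"
          unfolding F_def by (rule nn_integral_weighted_square_diff_le) (auto simp: test_function_measurable[OF \<phi>] m)
        also have "\<dots> \<le> ennreal (e\<^sup>2 / 4)" by (rule small) (use N jk in auto)
        finally show ?thesis
          by (intro int_le) auto
      qed
      have "(H2_norm \<alpha> \<beta> (\<lambda>x. \<phi> j x - \<phi> k x)) \<le> sqrt (e\<^sup>2 / 4 + e\<^sup>2 / 4)"
        unfolding H2_norm_def g l using 1 2 by (intro real_sqrt_le_mono add_mono)
      also have "\<dots> < sqrt (e\<^sup>2)" using e by (intro real_sqrt_less_mono) simp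
      finally show "H2_norm \<alpha> \<beta> (\<lambda>x. \<phi> j x - \<phi> k x) < e" using e by simp
    qed
  qed
  then show ?thesis
    unfolding H2_element_def using \<phi> m ae limD limL by blast
qed

lemma U0_H2_element:
  fixes \<alpha> n :: real
  defines "n \<equiv> real CARD('n::finite)"
  assumes n: "n - 2 * \<alpha> > 0" "n + 2 * \<alpha> > 0" and \<alpha>: "1 + \<alpha> > 0"
  shows "H2_element \<alpha> (- 2 - 2 * \<alpha>) (U0 \<alpha> :: real^'n \<Rightarrow> real) (grad (U0 \<alpha>)) (laplacian (U0 \<alpha>))"
proof -
  define \<delta> where "\<delta> k = 1 / real (Suc k)" for k
  have \<delta>: "0 < \<delta> k" "\<delta> k \<le> 1" for k by (auto simp: \<delta>_def)
  have \<delta>0: "\<delta> \<longlonglongrightarrow> 0" unfolding \<delta>_def by (rule LIMSEQ_Suc[OF lim_1_over_n])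
  define \<phi> where "\<phi> k = (\<lambda>x::real^'n. approximant \<alpha> (\<delta> k) (x \<bullet> x))" for k
  have tf: "test_function (\<phi> k)" for k unfolding \<phi>_def by (rule test_function_approximant[OF \<alpha> \<delta>(1)])
  note [measurable] = test_function_measurable[OF tf] U0_measurable[OF \<alpha>]
  have xd: "0 < x \<bullet> x + \<delta> k" for x :: "real^'n" and k using \<delta>(1)[of k] by (simp add: add_nonneg_pos)
  have g: "grad (\<phi> k) x = (2 * approximant1 \<alpha> (\<delta> k) (x \<bullet> x)) *\<^sub>R x" for k x
    unfolding \<phi>_def by (rule grad_radial[OF approximant_derivatives(1)[OF \<alpha> xd]])
  have l: "laplacian (\<phi> k) x = 2 * n * approximant1 \<alpha> (\<delta> k) (x \<bullet> x) + 4 * (x \<bullet> x) * approximant2 \<alpha> (\<delta> k) (x \<bullet> x)" for k x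
    unfolding \<phi>_def n_def
  proof (rule laplacian_radial[where S = "{- \<delta> k<..}"])
    show "x \<bullet> x \<in> {- \<delta> k<..}" using xd[of x k] by simp
    show "(approximant \<alpha> (\<delta> k) has_real_derivative approximant1 \<alpha> (\<delta> k) r) (at r)" if "r \<in> {- \<delta> k<..}" for r
      by (rule approximant_derivatives(1)[OF \<alpha>]) (use that in simp)
    show "(approximant1 \<alpha> (\<delta> k) has_real_derivative approximant2 \<alpha> (\<delta> k) (x \<bullet> x)) (at (x \<bullet> x))"
      by (rule approximant_derivatives(2)[OF \<alpha> xd])
  qed simp
  have [measurable]: "profile1 \<alpha> \<in> borel_measurable borel" "profile2 \<alpha> \<in> borel_measurable borel"
    unfolding profile1_def profile2_def profile_def by measurable
  \<comment> \<open>Measurability concerns every point, while the radial formula excludes the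
    origin; the value there is kept as an unspecified constant.\<close>
  have mg: "grad (U0 \<alpha> :: real^'n \<Rightarrow> real) \<in> borel_measurable borel"
  proof -
    have "grad (U0 \<alpha>) = (\<lambda>x::real^'n. if x = 0 then grad (U0 \<alpha>) 0 else (2 * profile1 \<alpha> (x \<bullet> x)) *\<^sub>R x)"
      by (rule ext) (simp add: U0_radial[OF \<alpha>])
    also have "\<dots> \<in> borel_measurable borel" by measurable
    finally show ?thesis .
  qed
  have ml: "laplacian (U0 \<alpha> :: real^'n \<Rightarrow> real) \<in> borel_measurable borel"
  proof -
    have "laplacian (U0 \<alpha>) = (\<lambda>x::real^'n. if x = 0 then laplacian (U0 \<alpha>) (0 :: real^'n)
        else 2 * n * profile1 \<alpha> (x \<bullet> x) + 4 * (x \<bullet> x) * profile2 \<alpha> (x \<bullet> x))"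
      by (rule ext) (simp add: U0_radial[OF \<alpha>] n_def)
    also have "\<dots> \<in> borel_measurable borel" by measurable
    finally show ?thesis .
  qed
  have ne: "AE x::real^'n in lborel. x \<noteq> 0" by (rule AE_lborel_singleton)
  define K where "K = exp 1 * (41 + \<bar>\<alpha>\<bar>)"
  define W where "W r = r powr min \<alpha> 0 * (1 + r) powr (1 + 2 * \<bar>\<alpha>\<bar>) * profile \<alpha> r" for r
  note bounds = approximant_bounds[OF \<alpha> _ \<delta>, folded K_def W_def]
  have W2: "(W (x \<bullet> x))\<^sup>2 = norm x powr (4 * min \<alpha> 0) * (1 + (norm x)\<^sup>2) powr (2 + 4 * \<bar>\<alpha>\<bar>)
      * exp (- (1 / (1 + \<alpha>)) * norm x powr (2 * (1 + \<alpha>)))" for x :: "real^'n"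
  proof -
    have "(a powr b)\<^sup>2 = a powr (2 * b)" for a b :: real
      by (simp add: power2_eq_square flip: powr_add)
    moreover have "(profile \<alpha> (x \<bullet> x))\<^sup>2 = exp (- (1 / (1 + \<alpha>)) * norm x powr (2 * (1 + \<alpha>)))"
      using U0_square[OF \<alpha>, of x] by (simp add: U0_eq_profile)
    moreover have "(x \<bullet> x) powr (2 * min \<alpha> 0) = norm x powr (4 * min \<alpha> 0)"
      by (simp add: inner_self_powr)
    ultimately show ?thesis
      unfolding W_def by (simp add: power_mult_distrib power2_norm_eq_inner)
  qed
  \<comment> \<open>The gradient uses \<open>s = 4 + 2\<alpha>\<close> and the Laplacian
    \<open>s = - 2\<alpha>\<close>. For \<alpha> < 0 the conditions read
    \<open>4 + 6\<alpha> > -n\<close> and \<open>2\<alpha> > -n\<close>, which follow from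
    \<open>n + 2\<alpha> > 0\<close> and \<open>1 + \<alpha> > 0\<close>. For \<alpha> \<ge> 0 the
    second one is \<open>n - 2\<alpha> > 0\<close>.\<close>
  have W_int: "integrable lborel (\<lambda>x::real^'n. (W (x \<bullet> x))\<^sup>2 * norm x powr s)" if "s + 4 * min \<alpha> 0 > - n" for s
  proof -
    have "(W (x \<bullet> x))\<^sup>2 * norm x powr s = norm x powr (s + 4 * min \<alpha> 0) * (1 + (norm x)\<^sup>2) powr (2 + 4 * \<bar>\<alpha>\<bar>)
      * exp (- (1 / (1 + \<alpha>)) * norm x powr (2 * (1 + \<alpha>)))" for x :: "real^'n"
      unfolding W2 by (simp add: powr_add mult_ac)
    then show ?thesis
      using that \<alpha> by (simp only:) (intro integrable_norm_powr_exp, auto simp: n_def)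
  qed
  show ?thesis
  proof (rule H2_elementI[OF tf _ mg ml])
    show "AE x in lborel. (\<lambda>k. \<phi> k x) \<longlonglongrightarrow> U0 \<alpha> x"
      using ne by eventually_elim (auto simp: \<phi>_def U0_eq_profile intro: approximant_limits[OF \<alpha> _ \<delta>0])
    show "(\<lambda>k. \<integral>\<^sup>+x. ennreal ((norm (grad (\<phi> k) x - grad (U0 \<alpha>) x))\<^sup>2 * norm x powr - (- 2 - 2 * \<alpha>)) \<partial>lborel) \<longlonglongrightarrow> 0"
    proof (rule weighted_L2_dominated)
      show "AE x in lborel. \<forall>k. norm (grad (\<phi> k) x) \<le> 2 * K * W (x \<bullet> x) * norm x"
        using ne
      proof eventually_elim
        case (elim x)
        then show ?case using bounds(1)[of "x \<bullet> x"] by (auto simp: g abs_mult mult.assoc intro!: mult_right_mono)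
      qed
      show "AE x in lborel. (\<lambda>k. grad (\<phi> k) x) \<longlonglongrightarrow> grad (U0 \<alpha>) x"
        using ne
      proof eventually_elim
        case (elim x)
        then have "x \<bullet> x > 0" by simp
        from approximant_limits(2)[OF \<alpha> this \<delta>0] show ?case
          unfolding g U0_radial(1)[OF \<alpha> elim] by (intro tendsto_intros)
      qed
      have "(2 * K * W (x \<bullet> x) * norm x)\<^sup>2 * norm x powr - (- 2 - 2 * \<alpha>) = (4 * K\<^sup>2) * ((W (x \<bullet> x))\<^sup>2 * norm x powr (4 + 2 * \<alpha>))" for x :: "real^'n"
      proof -
        have "(norm x)\<^sup>2 * norm x powr (2 + 2 * \<alpha>) = norm x powr (4 + 2 * \<alpha>)"
        proof (cases "x = 0")
          case False
          then have "(norm x)\<^sup>2 = norm x powr 2" by simp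
          then show ?thesis by (simp only: powr_add[symmetric]) simp
        qed simp
        then show ?thesis by (simp add: power_mult_distrib algebra_simps)
      qed
      moreover have "integrable lborel (\<lambda>x::real^'n. (4 * K\<^sup>2) * ((W (x \<bullet> x))\<^sup>2 * norm x powr (4 + 2 * \<alpha>)))"
        by (intro integrable_mult_right W_int) (use n \<alpha> in \<open>auto simp: min_def\<close>)
      ultimately show "integrable lborel (\<lambda>x::real^'n. (2 * K * W (x \<bullet> x) * norm x)\<^sup>2 * norm x powr - (- 2 - 2 * \<alpha>))"
        by simp
    qed (use mg in \<open>auto simp: test_function_measurable[OF tf]\<close>)
    have "(\<lambda>k. \<integral>\<^sup>+x. ennreal ((norm (laplacian (\<phi> k) x - laplacian (U0 \<alpha>) x))\<^sup>2 * norm x powr (- 2 * \<alpha>)) \<partial>lborel) \<longlonglongrightarrow> 0"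
    proof (rule weighted_L2_dominated)
      show "AE x in lborel. \<forall>k. norm (laplacian (\<phi> k) x) \<le> (2 * n + 4) * K * W (x \<bullet> x)"
        using ne
      proof eventually_elim
        case (elim x)
        then have x: "x \<bullet> x > 0" by simp
        show ?case
        proof
          fix k
          have "2 * n * \<bar>approximant1 \<alpha> (\<delta> k) (x \<bullet> x)\<bar> \<le> 2 * n * (K * W (x \<bullet> x))"
            by (intro mult_left_mono bounds x) (auto simp: n_def)
          moreover have "\<bar>laplacian (\<phi> k) x\<bar> \<le> 2 * n * \<bar>approximant1 \<alpha> (\<delta> k) (x \<bullet> x)\<bar> + 4 * ((x \<bullet> x) * \<bar>approximant2 \<alpha> (\<delta> k) (x \<bullet> x)\<bar>)"
            unfolding l by (rule order_trans[OF abs_triangle_ineq]) (simp add: abs_mult n_def)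
          ultimately show "norm (laplacian (\<phi> k) x) \<le> (2 * n + 4) * K * W (x \<bullet> x)"
            using bounds(2)[OF x, of k] by (simp add: algebra_simps)
        qed
      qed
      show "AE x in lborel. (\<lambda>k. laplacian (\<phi> k) x) \<longlonglongrightarrow> laplacian (U0 \<alpha>) x"
        using ne
      proof eventually_elim
        case (elim x)
        then have "x \<bullet> x > 0" by simp
        from approximant_limits(2,3)[OF \<alpha> this \<delta>0] show ?case
          unfolding l U0_radial(2)[OF \<alpha> elim] n_def[symmetric] by (intro tendsto_intros)
      qed
      have "((2 * n + 4) * K * W (x \<bullet> x))\<^sup>2 * norm x powr (- 2 * \<alpha>) = ((2 * n + 4) * K)\<^sup>2 * ((W (x \<bullet> x))\<^sup>2 * norm x powr (- 2 * \<alpha>))" for x :: "real^'n"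
        by (simp add: power_mult_distrib)
      moreover have "integrable lborel (\<lambda>x::real^'n. ((2 * n + 4) * K)\<^sup>2 * ((W (x \<bullet> x))\<^sup>2 * norm x powr (- 2 * \<alpha>)))"
        by (intro integrable_mult_right W_int) (use n \<alpha> in \<open>auto simp: min_def\<close>)
      ultimately show "integrable lborel (\<lambda>x::real^'n. ((2 * n + 4) * K * W (x \<bullet> x))\<^sup>2 * norm x powr (- 2 * \<alpha>))"
        by (simp only:)
    qed (use ml in \<open>auto simp: test_function_measurable[OF tf]\<close>)
    then show "(\<lambda>k. \<integral>\<^sup>+x. ennreal ((laplacian (\<phi> k) x - laplacian (U0 \<alpha>) x)\<^sup>2 * norm x powr (- 2 * \<alpha>)) \<partial>lborel) \<longlonglongrightarrow> 0"
      by simp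
  qed (use U0_measurable[OF \<alpha>] in auto)
qed

theorem theorem1p1:
  fixes \<alpha> n :: real
  defines "n \<equiv> real CARD('n::finite)"
  assumes "n - 2 * \<alpha> > 0" and "n + 2 * \<alpha> > 0" and "n + 2 + 4 * \<alpha> > 0"
  shows
    "(\<forall>(u :: real^'n \<Rightarrow> real) Du Lu. H2_element \<alpha> (- 2 - 2 * \<alpha>) u Du Lu \<longrightarrow>
        (\<integral>\<^sup>+x. ennreal ((Lu x)\<^sup>2 / norm x powr (2 * \<alpha>)) \<partial>lborel)
          * (\<integral>\<^sup>+x. ennreal (norm x powr (2 * \<alpha>) * (Du x \<bullet> x)\<^sup>2) \<partial>lborel)
        \<ge> ennreal (((n + 4 * \<alpha> + 2) / 2)\<^sup>2)
          * (\<integral>\<^sup>+x. ennreal ((norm (Du x))\<^sup>2) \<partial>lborel)\<^sup>2)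
     \<and>
     (1 + \<alpha> > 0 \<longrightarrow>
        (\<forall>C > ((n + 4 * \<alpha> + 2) / 2)\<^sup>2.
           \<exists>(u :: real^'n \<Rightarrow> real) Du Lu. H2_element \<alpha> (- 2 - 2 * \<alpha>) u Du Lu \<and>
             (\<integral>\<^sup>+x. ennreal ((Lu x)\<^sup>2 / norm x powr (2 * \<alpha>)) \<partial>lborel)
               * (\<integral>\<^sup>+x. ennreal (norm x powr (2 * \<alpha>) * (Du x \<bullet> x)\<^sup>2) \<partial>lborel)
             < ennreal C * (\<integral>\<^sup>+x. ennreal ((norm (Du x))\<^sup>2) \<partial>lborel)\<^sup>2)
        \<and>
        H2_element \<alpha> (- 2 - 2 * \<alpha>) (U0 \<alpha> :: real^'n \<Rightarrow> real) (grad (U0 \<alpha>)) (laplacian (U0 \<alpha>))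
        \<and>
        (\<integral>\<^sup>+x. ennreal ((laplacian (U0 \<alpha> :: real^'n \<Rightarrow> real) x)\<^sup>2 / norm x powr (2 * \<alpha>)) \<partial>lborel)
          * (\<integral>\<^sup>+x. ennreal (norm x powr (2 * \<alpha>) * (grad (U0 \<alpha> :: real^'n \<Rightarrow> real) x \<bullet> x)\<^sup>2) \<partial>lborel)
        = ennreal (((n + 4 * \<alpha> + 2) / 2)\<^sup>2)
          * (\<integral>\<^sup>+x. ennreal ((norm (grad (U0 \<alpha> :: real^'n \<Rightarrow> real) x))\<^sup>2) \<partial>lborel)\<^sup>2)"
proof -
  let ?c = "((n + 4 * \<alpha> + 2) / 2)\<^sup>2"
  let ?A = "\<lambda>Lu :: real^'n \<Rightarrow> real. \<integral>\<^sup>+x. ennreal ((Lu x)\<^sup>2 / norm x powr (2 * \<alpha>)) \<partial>lborel"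
  let ?B = "\<lambda>Du :: real^'n \<Rightarrow> real^'n. \<integral>\<^sup>+x. ennreal (norm x powr (2 * \<alpha>) * (Du x \<bullet> x)\<^sup>2) \<partial>lborel"
  let ?D = "\<lambda>Du :: real^'n \<Rightarrow> real^'n. \<integral>\<^sup>+x. ennreal ((norm (Du x))\<^sup>2) \<partial>lborel"
  let ?U = "U0 \<alpha> :: real^'n \<Rightarrow> real"
  have n: "real CARD('n) - 2 * \<alpha> > 0" "real CARD('n) + 2 * \<alpha> > 0" "real CARD('n) + 2 + 4 * \<alpha> > 0"
    using assms unfolding n_def by simp_all
  have ineq: "ennreal ?c * (?D Du)\<^sup>2 \<le> ?A Lu * ?B Du"
    if "H2_element \<alpha> (- 2 - 2 * \<alpha>) u Du Lu" for u :: "real^'n \<Rightarrow> real" and Du Lu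
    unfolding n_def by (rule H2_element_CKN[OF n that])
  have U0: "H2_element \<alpha> (- 2 - 2 * \<alpha>) ?U (grad ?U) (laplacian ?U)" if "1 + \<alpha> > 0"
    by (rule U0_H2_element[OF n(1,2) that])
  \<comment> \<open>Sharpness is witnessed by \<open>U0\<close> for every larger C: the product
    equals the optimal constant times \<open>D\<^sup>2\<close>, and
    \<open>0 < D < \<infinity>\<close> makes the comparison strict in
    \<open>ennreal\<close>.\<close>
  have eq: "?A (laplacian ?U) * ?B (grad ?U) = ennreal ?c * (?D (grad ?U))\<^sup>2
      \<and> (\<forall>C > ?c. ?A (laplacian ?U) * ?B (grad ?U) < ennreal C * (?D (grad ?U))\<^sup>2)" if \<alpha>: "1 + \<alpha> > 0"
  proof -
    obtain D where D: "D > 0" "?D (grad ?U) = ennreal D"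
      "?A (laplacian ?U) = ennreal ((n + 4 * \<alpha> + 2) / 2 * D)"
      "?B (grad ?U) = ennreal ((n + 4 * \<alpha> + 2) / 2 * D)"
      using U0_integrals[OF \<alpha> n(2)] unfolding n_def by blast
    have pos: "(n + 4 * \<alpha> + 2) / 2 * D \<ge> 0" using D(1) assms(4) by simp
    have AB: "?A (laplacian ?U) * ?B (grad ?U) = ennreal (?c * D\<^sup>2)"
      unfolding D(3,4) using pos by (simp only: ennreal_mult[symmetric]) (simp add: power2_eq_square mult_ac)
    have CD: "ennreal C * (?D (grad ?U))\<^sup>2 = ennreal (C * D\<^sup>2)" if "C \<ge> 0" for C
      unfolding D(2) using D(1) that by (simp add: ennreal_mult ennreal_power)
    show ?thesis
    proof (intro conjI allI impI)
      show "?A (laplacian ?U) * ?B (grad ?U) = ennreal ?c * (?D (grad ?U))\<^sup>2"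
        unfolding AB by (rule CD[symmetric]) simp
      fix C assume C: "C > ?c"
      then have C0: "C > 0" by (rule le_less_trans[OF zero_le_power2])
      show "?A (laplacian ?U) * ?B (grad ?U) < ennreal C * (?D (grad ?U))\<^sup>2"
        unfolding AB CD[OF less_imp_le[OF C0]] using C C0 D(1) by (intro ennreal_lessI) auto
    qed
  qed
  show ?thesis
    using ineq U0 eq by blast
qed

end
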